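(* Suppose that $(G,X)$ is a free second-countable transformation group and let $\nu$ be a right Haar measure on $G$. Let $M\in\mathbb{R}$ with $M\geq 1$, let $z\in X$ and let $(x_n)_{n\geq 1}$ be a sequence in $X$. Assume that $G\cdot z$ is locally closed in $X$. Suppose that there exists an open neighbourhood $V$ of $z$ in $X$ such that $\phi_z^{-1}(V)$ is relatively compact and $$\nu(\phi_{x_n}^{-1}(V))\leq M\,\nu(\phi_z^{-1}(V))$$ frequently. Then $M_L(\operatorname{Ind}\epsilon_z,(\operatorname{Ind}\epsilon_{x_n}))\leq\lfloor M\rfloor$.
   Context: Transformation groups. A transformation group $(G,X)$ consists of a locally compact Hausdorff group $G$ and a locally compact Hausdorff space $X$ with a jointly continuous action $G\times X\to X$, $(s,x)\mapsto s\cdot x$. It is second countable if both $G$ and $X$ are, and free if $s\cdot x=x$ implies $s=e$. $G\cdot x=\{s\cdot x:s\in G\}$ is the orbit of $x$. For $x\in X$, $\phi_x:G\to G\cdot x$ is $\phi_x(s)=s\cdot x$, so $\phi_x^{-1}(V)=\{s\in G:s\cdot x\in V\}$ for $V\subset X$. A subset is locally closed if it is relatively open in its closure. "Frequently" means for infinitely many $n$. The $C^*$-algebra and induced representations. $C_0(X)\times G$ is the transformation-group $C^*$-algebra (full crossed product of $C_0(X)$ by the action $\operatorname{lt}_s(f)(x)=f(s^{-1}\cdot x)$), i.e. the enveloping $C^*$-algebra of $L^1(G,C_0(X))$. Let $\mu$ be a left Haar measure with modular function $\Delta$, and $\nu(E)=\mu(E^{-1})$. For $x\in X$, with $\epsilon_x:C_0(X)\to\mathbb{C}$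 evaluation at $x$, $\operatorname{Ind}\epsilon_x$ is the representation $\tilde\epsilon_x\times\lambda$ of $C_0(X)\times G$ on $L^2(G,\nu)$ given by the covariant pair $(\tilde\epsilon_x(f)\xi)(s)=f(s\cdot x)\xi(s)$, $(\lambda_t\xi)(s)=\Delta(t)^{1/2}\xi(t^{-1}s)$. For free actions it is irreducible. Multiplicities. Let $A$ be a $C^*$-algebra with spectrum $\hat A$ and set of pure states $P(A)$. Let $\mathcal N$ be the weak*-neighbourhood base at $0$ in $A^*$ of all sets $\{\psi\in A^*:|\psi(a_i)|<\epsilon,\ 1\le i\le n\}$ ($\epsilon>0$, $a_1,\dots,a_n\in A$). Let $\pi\in\hat A$ and let $\phi$ be a pure state associated with $\pi$. For $\sigma\in\hat A$ (on Hilbert space $H_\sigma$) and $N\in\mathcal N$ let $\mathrm{Vec}(\sigma,\phi,N)=\{\eta\in H_\sigma:\|\eta\|=1,\ \langle\sigma(\cdot)\eta,\eta\rangle\in\phi+N\}$ and let $d(\sigma,\phi,N)\in\mathbb{N}\cup\{\infty\}$ be the supremum of the cardinalities of finite orthonormal subsets of $\mathrm{Vec}(\sigma,\phi,N)$ ($0$ if it is empty). For a net $\Omega=(\pi_\alpha)$ in $\hat A$, $M_L(\pi,\Omega)=\inf_{N\in\mathcal N}\liminf_\alpha d(\pi_\alpha,\phi,N)$; this is independent of the choice of $\phi$. *)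

theory Defs
  imports "HOL-Analysis.Analysis"
begin

section \<open>The Banach space \<open>C\<^sub>0(X)\<close>\<close>

lemma vanishing_compactI:
  fixes F :: "'x::topological_space \<Rightarrow> complex"
  assumes "continuous_on UNIV F" "compact K" "\<And>x. x \<notin> K \<Longrightarrow> norm (F x) < e"
  shows "compact {x. e \<le> norm (F x)}"
proof -
  have "closed {x. e \<le> norm (F x)}"
    using assms(1) by (intro closed_Collect_le continuous_intros) auto
  moreover have "K \<inter> {x. e \<le> norm (F x)} = {x. e \<le> norm (F x)}"
    using assms(3) by force
  ultimately show ?thesis
    using compact_Int_closed[OF assms(2)] by metis
qed

typedef (overloaded) 'x c0 =
  "{f :: 'x::topological_space \<Rightarrow>\<^sub>C complex. \<forall>e>0. compact {x. e \<le> norm (apply_bcontfun f x)}}"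
  morphisms c0_bcontfun Abs_c0
  by (rule exI[of _ 0]) auto

setup_lifting type_definition_c0

definition c0_apply :: "'x::topological_space c0 \<Rightarrow> 'x \<Rightarrow> complex" where
  "c0_apply f = apply_bcontfun (c0_bcontfun f)"

definition vanishing_functions :: "('x::topological_space \<Rightarrow> complex) set" where
  "vanishing_functions = {F. continuous_on UNIV F \<and> (\<forall>e>0. compact {x. e \<le> norm (F x)})}"

text \<open>Only meaningful for arguments in \<^const>\<open>vanishing_functions\<close>.\<close>

definition c0_of :: "('x::topological_space \<Rightarrow> complex) \<Rightarrow> 'x c0" where
  "c0_of F = Abs_c0 (Bcontfun F)"

lemma c0_eqI: "(\<And>x. c0_apply f x = c0_apply g x) \<Longrightarrow> f = g"
  by (metis bcontfun_eqI c0_apply_def c0_bcontfun_inject)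

lemma continuous_c0_apply [continuous_intros]: "continuous_on S (c0_apply f)"
  by (simp add: c0_apply_def)

lemma compact_c0_apply: "e > 0 \<Longrightarrow> compact {x. e \<le> norm (c0_apply f x)}"
  using c0_bcontfun[of f] by (simp add: c0_apply_def)

lemma c0_apply_in_vanishing: "c0_apply f \<in> vanishing_functions"
  by (auto simp: vanishing_functions_def continuous_c0_apply compact_c0_apply)

lemma vanishing_imp_bcontfun:
  assumes "F \<in> vanishing_functions"
  shows "F \<in> bcontfun"
proof -
  have cont: "continuous_on UNIV F" and c: "compact {x. 1 \<le> norm (F x)}"
    using assms by (auto simp: vanishing_functions_def)
  have "bounded (F ` {x. 1 \<le> norm (F x)})"
    by (intro compact_imp_bounded compact_continuous_image continuous_on_subset[OF cont] c) auto
  then obtain B where B: "\<And>x. 1 \<le> norm (F x) \<Longrightarrow> norm (F x) \<le> B"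
    by (auto simp: bounded_iff)
  show ?thesis
    by (rule bcontfun_normI[OF cont, of "max 1 B"]) (meson B le_max_iff_disj linear)
qed

lemma c0_apply_c0_of:
  assumes "F \<in> vanishing_functions"
  shows "c0_apply (c0_of F) = F"
  using assms vanishing_imp_bcontfun[OF assms]
  by (simp add: c0_apply_def c0_of_def vanishing_functions_def Abs_c0_inverse Bcontfun_inverse)

lemma vanishing_dominated:
  assumes "continuous_on UNIV F" "\<And>x. norm (F x) \<le> C * norm (c0_apply f x)" "C > 0"
  shows "F \<in> vanishing_functions"
  unfolding vanishing_functions_def
proof (safe intro!: assms(1))
  fix e :: real assume e: "e > 0"
  have "norm (F x) < e" if "x \<notin> {x. e / C \<le> norm (c0_apply f x)}" for x
  proof -
    have "C * norm (c0_apply f x) < e"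
      using that assms(3) by (simp add: not_le pos_less_divide_eq mult.commute)
    then show ?thesis using assms(2)[of x] by linarith
  qed
  then show "compact {x. e \<le> norm (F x)}"
    using vanishing_compactI[OF assms(1) compact_c0_apply[of "e / C" f]] e assms(3) by auto
qed

lemma vanishing_add:
  "(\<lambda>x. c0_apply f x + c0_apply g x) \<in> vanishing_functions"
  unfolding vanishing_functions_def
proof safe
  show cont: "continuous_on UNIV (\<lambda>x. c0_apply f x + c0_apply g x)"
    by (intro continuous_intros)
  fix e :: real assume e: "e > 0"
  let ?K = "{x. e/2 \<le> norm (c0_apply f x)} \<union> {x. e/2 \<le> norm (c0_apply g x)}"
  have K: "compact ?K" using e by (intro compact_Un compact_c0_apply) auto
  have "norm (c0_apply f x + c0_apply g x) < e" if "x \<notin> ?K" for x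
    using that norm_triangle_ineq[of "c0_apply f x" "c0_apply g x"] by auto
  then show "compact {x. e \<le> norm (c0_apply f x + c0_apply g x)}"
    by (rule vanishing_compactI[OF cont K])
qed

lemma vanishing_scaleR:
  "(\<lambda>x. r *\<^sub>R c0_apply f x) \<in> vanishing_functions"
  by (rule vanishing_dominated[of _ "\<bar>r\<bar> + 1" f])
     (auto intro!: continuous_intros mult_right_mono)

instantiation c0 :: (topological_space) real_vector
begin

lift_definition zero_c0 :: "'a c0" is 0 by auto

lift_definition plus_c0 :: "'a c0 \<Rightarrow> 'a c0 \<Rightarrow> 'a c0" is "(+)"
proof -
  fix f g :: "'a \<Rightarrow>\<^sub>C complex" and d :: real
  assume fg: "\<And>e. 0 < e \<Longrightarrow> compact {x. e \<le> norm (apply_bcontfun f x)}"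
    "\<And>e. 0 < e \<Longrightarrow> compact {x. e \<le> norm (apply_bcontfun g x)}" and d: "0 < d"
  have *: "c0_apply (Abs_c0 f) = apply_bcontfun f" "c0_apply (Abs_c0 g) = apply_bcontfun g"
    using fg by (auto simp: c0_apply_def Abs_c0_inverse)
  show "compact {x. d \<le> norm (apply_bcontfun (f + g) x)}"
    using vanishing_add[of "Abs_c0 f" "Abs_c0 g"] d by (simp add: vanishing_functions_def *)
qed

lift_definition uminus_c0 :: "'a c0 \<Rightarrow> 'a c0" is uminus by auto

lift_definition scaleR_c0 :: "real \<Rightarrow> 'a c0 \<Rightarrow> 'a c0" is scaleR
proof -
  fix r d :: real and f :: "'a \<Rightarrow>\<^sub>C complex"
  assume f: "\<And>e. 0 < e \<Longrightarrow> compact {x. e \<le> norm (apply_bcontfun f x)}" and d: "0 < d"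
  have *: "c0_apply (Abs_c0 f) = apply_bcontfun f"
    using f by (auto simp: c0_apply_def Abs_c0_inverse)
  show "compact {x. d \<le> norm (apply_bcontfun (r *\<^sub>R f) x)}"
    using vanishing_scaleR[of r "Abs_c0 f"] d by (simp add: vanishing_functions_def *)
qed

definition minus_c0 :: "'a c0 \<Rightarrow> 'a c0 \<Rightarrow> 'a c0" where
  "minus_c0 f g = f + - g"

instance
proof
  fix a b c :: "'a c0" and r t :: real
  show "a + b + c = a + (b + c)" by transfer (simp add: algebra_simps)
  show "a + b = b + a" by transfer (simp add: algebra_simps)
  show "0 + a = a" by transfer simp
  show "- a + a = 0" by transfer simp
  show "a - b = a + - b" by (rule minus_c0_def)
  show "r *\<^sub>R (a + b) = r *\<^sub>R a + r *\<^sub>R b" by transfer (simp add: algebra_simps)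
  show "(r + t) *\<^sub>R a = r *\<^sub>R a + t *\<^sub>R a" by transfer (simp add: algebra_simps)
  show "r *\<^sub>R t *\<^sub>R a = (r * t) *\<^sub>R a" by transfer simp
  show "1 *\<^sub>R a = a" by transfer simp
qed

end

instantiation c0 :: (topological_space) real_normed_vector
begin

lift_definition norm_c0 :: "'a c0 \<Rightarrow> real" is norm .

definition dist_c0 :: "'a c0 \<Rightarrow> 'a c0 \<Rightarrow> real" where
  "dist_c0 f g = norm (f - g)"

definition sgn_c0 :: "'a c0 \<Rightarrow> 'a c0" where
  "sgn_c0 f = f /\<^sub>R norm f"

definition uniformity_c0 :: "('a c0 \<times> 'a c0) filter" where
  "uniformity_c0 = (INF e\<in>{0 <..}. principal {(x, y). dist x y < e})"

definition open_c0 :: "'a c0 set \<Rightarrow> bool" where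
  "open_c0 S = (\<forall>x\<in>S. \<forall>\<^sub>F (x', y) in uniformity. x' = x \<longrightarrow> y \<in> S)"

instance
proof
  fix a b :: "'a c0" and r :: real
  show "(norm a = 0) = (a = 0)" by transfer simp
  show "norm (a + b) \<le> norm a + norm b" by transfer (rule norm_triangle_ineq)
  show "norm (r *\<^sub>R a) = \<bar>r\<bar> * norm a" by transfer simp
  show "dist a b = norm (a - b)" by (rule dist_c0_def)
  show "sgn a = a /\<^sub>R norm a" by (rule sgn_c0_def)
  show "uniformity = (INF e\<in>{0 <..}. principal {(x :: 'a c0, y). dist x y < e})"
    by (rule uniformity_c0_def)
  show "open U = (\<forall>x\<in>U. \<forall>\<^sub>F (x', y) in uniformity. x' = x \<longrightarrow> y \<in> U)" for U :: "'a c0 set"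
    by (rule open_c0_def)
qed

end

lemma c0_apply_simps [simp]:
  shows "c0_apply 0 x = 0"
    and "c0_apply (f + g) x = c0_apply f x + c0_apply g x"
    and "c0_apply (- f) x = - c0_apply f x"
    and c0_apply_diff: "c0_apply (f - g) x = c0_apply f x - c0_apply g x"
    and "c0_apply (r *\<^sub>R f) x = r *\<^sub>R c0_apply f x"
proof -
  show *: "c0_apply 0 x = 0" "c0_apply (f + g) x = c0_apply f x + c0_apply g x"
    "c0_apply (- f) x = - c0_apply f x" "c0_apply (r *\<^sub>R f) x = r *\<^sub>R c0_apply f x" for f g
    by (simp_all add: c0_apply_def zero_c0.rep_eq plus_c0.rep_eq uminus_c0.rep_eq scaleR_c0.rep_eq)
  show "c0_apply (f - g) x = c0_apply f x - c0_apply g x"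
    using *(2)[of f "- g"] by (simp add: *(3))
qed

lemma norm_c0_apply_le: "norm (c0_apply f x) \<le> norm f"
  by (simp add: c0_apply_def norm_c0.rep_eq norm_bounded)

lemma norm_c0_bound: "(\<And>x. norm (c0_apply f x) \<le> b) \<Longrightarrow> norm f \<le> b"
  by (simp add: c0_apply_def norm_c0.rep_eq norm_bound)

instance c0 :: (topological_space) banach
proof
  fix f :: "nat \<Rightarrow> 'a c0"
  assume C: "Cauchy f"
  define h where "h x = lim (\<lambda>n. c0_apply (f n) x)" for x
  have close: "\<exists>N. \<forall>n\<ge>N. \<forall>x. norm (c0_apply (f n) x - h x) \<le> e" if e: "e > 0" for e
  proof -
    obtain N where N: "\<And>m n. m \<ge> N \<Longrightarrow> n \<ge> N \<Longrightarrow> norm (f m - f n) < e"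
      using CauchyD[OF C e] by blast
    have "norm (c0_apply (f n) x - h x) \<le> e" if n: "n \<ge> N" for n x
    proof -
      have "Cauchy (\<lambda>n. c0_apply (f n) x)"
      proof (rule CauchyI)
        fix d :: real assume "d > 0"
        then obtain M where M: "\<forall>m\<ge>M. \<forall>n\<ge>M. norm (f m - f n) < d"
          using CauchyD[OF C] by blast
        have "norm (c0_apply (f m) x - c0_apply (f n) x) < d" if "m \<ge> M" "n \<ge> M" for m n
          using le_less_trans[OF norm_c0_apply_le[of "f m - f n" x]] M that by simp
        then show "\<exists>M. \<forall>m\<ge>M. \<forall>n\<ge>M. norm (c0_apply (f m) x - c0_apply (f n) x) < d"
          by blast
      qed
      then have "(\<lambda>m. c0_apply (f m) x) \<longlonglongrightarrow> h x"
        unfolding h_def by (simp add: Cauchy_convergent_iff convergent_LIMSEQ_iff)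
      then have "(\<lambda>m. norm (c0_apply (f n) x - c0_apply (f m) x))
          \<longlonglongrightarrow> norm (c0_apply (f n) x - h x)"
        by (intro tendsto_intros)
      moreover have "norm (c0_apply (f n) x - c0_apply (f m) x) \<le> e" if "m \<ge> N" for m
        using le_less_trans[OF norm_c0_apply_le[of "f n - f m" x] N[OF n that]] by simp
      ultimately show ?thesis by (intro LIMSEQ_le_const2) auto
    qed
    then show ?thesis by blast
  qed
  have unif: "uniform_limit UNIV (\<lambda>n. c0_apply (f n)) h sequentially"
  proof (rule uniform_limitI)
    fix e :: real assume "e > 0"
    then obtain N where N: "\<forall>n\<ge>N. \<forall>x. norm (c0_apply (f n) x - h x) \<le> e/2"
      using close[of "e/2"] by auto
    have "dist (c0_apply (f n) x) (h x) < e" if "n \<ge> N" for n x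
    proof -
      have "norm (c0_apply (f n) x - h x) \<le> e/2" using N that by blast
      then show ?thesis using \<open>e > 0\<close> by (simp add: dist_norm)
    qed
    then show "\<forall>\<^sub>F n in sequentially. \<forall>x\<in>UNIV. dist (c0_apply (f n) x) (h x) < e"
      unfolding eventually_sequentially by blast
  qed
  have cont: "continuous_on UNIV h"
    by (rule uniform_limit_theorem[OF _ unif]) (simp_all add: continuous_c0_apply)
  have "h \<in> vanishing_functions"
    unfolding vanishing_functions_def
  proof (safe intro!: cont)
    fix e :: real assume e: "e > 0"
    then obtain n where n: "\<And>x. norm (c0_apply (f n) x - h x) \<le> e/2"
      using close[of "e/2"] by auto
    have "norm (h x) < e" if "x \<notin> {x. e/2 \<le> norm (c0_apply (f n) x)}" for x
    proof -
      have "norm (h x) \<le> norm (c0_apply (f n) x - h x) + norm (c0_apply (f n) x)"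
        using norm_triangle_ineq4[of "c0_apply (f n) x" "c0_apply (f n) x - h x"] by simp
      then show ?thesis using that n[of x] by simp
    qed
    then show "compact {x. e \<le> norm (h x)}"
      using e by (intro vanishing_compactI[OF cont compact_c0_apply[of "e/2" "f n"]]) auto
  qed
  then have h: "c0_apply (c0_of h) = h" by (rule c0_apply_c0_of)
  have "f \<longlonglongrightarrow> c0_of h"
  proof (rule LIMSEQ_I)
    fix e :: real assume e: "e > 0"
    then obtain N where N: "\<forall>n\<ge>N. \<forall>x. norm (c0_apply (f n) x - h x) \<le> e/2"
      using close[of "e/2"] by auto
    have "norm (f n - c0_of h) < e" if "n \<ge> N" for n
    proof -
      have "norm (f n - c0_of h) \<le> e/2"
        by (rule norm_c0_bound) (use N that in \<open>simp add: h\<close>)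
      then show ?thesis using e by simp
    qed
    then show "\<exists>N. \<forall>n\<ge>N. norm (f n - c0_of h) < e" by blast
  qed
  then show "convergent f" by (rule convergentI)
qed

instance c0 :: (second_countable_topology) second_countable_topology
proof
  obtain B :: "'a set set" where B: "countable B" "topological_basis B"
    using ex_countable_basis by blast
  obtain Q :: "complex set" where Q: "countable Q"
      "\<And>S. open S \<Longrightarrow> S \<noteq> {} \<Longrightarrow> \<exists>q\<in>Q. q \<in> S"
    using countable_dense_exists by metis
  define W :: "real \<Rightarrow> ('a set \<times> complex) set \<Rightarrow> 'a c0 set" where
    "W e P = {f. (\<forall>(b, q)\<in>P. \<forall>x\<in>b. norm (c0_apply f x - q) \<le> e) \<and>
                 (\<forall>x. x \<notin> \<Union>(fst ` P) \<longrightarrow> norm (c0_apply f x) \<le> e)}" for e P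
  have diam: "norm (f - g) \<le> 2 * e" if "f \<in> W e P" "g \<in> W e P" for f g e P
  proof (rule norm_c0_bound)
    fix x
    have fg: "norm (c0_apply f' x - q) \<le> e" if "f' \<in> W e P" "(b, q) \<in> P" "x \<in> b" for f' b q
      using that by (auto simp: W_def)
    have fg0: "norm (c0_apply f' x) \<le> e" if "f' \<in> W e P" "x \<notin> \<Union>(fst ` P)" for f'
      using that by (simp add: W_def)
    have "\<exists>q. norm (c0_apply f x - q) \<le> e \<and> norm (c0_apply g x - q) \<le> e"
    proof (cases "x \<in> \<Union>(fst ` P)")
      case True
      then obtain b q where "(b, q) \<in> P" "x \<in> b" by auto
      then show ?thesis using that by (intro exI[of _ q] conjI fg)
    next
      case False
      then show ?thesis using that fg0[OF _ False] by (intro exI[of _ 0]) simp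
    qed
    then obtain q where "norm (c0_apply f x - q) \<le> e" "norm (c0_apply g x - q) \<le> e" by blast
    then show "norm (c0_apply (f - g) x) \<le> 2 * e"
      using norm_triangle_ineq4[of "c0_apply f x - q" "c0_apply g x - q"] by simp
  qed
  have cover: "\<exists>P. finite P \<and> P \<subseteq> B \<times> Q \<and> f \<in> W e P" if e: "e > 0" for f :: "'a c0" and e
  proof -
    let ?K = "{x. e \<le> norm (c0_apply f x)}"
    define I where "I = {(b, q) \<in> B \<times> Q. \<forall>x\<in>b. norm (c0_apply f x - q) \<le> e}"
    have "?K \<subseteq> \<Union>(fst ` I)"
    proof
      fix x
      obtain q where q: "q \<in> Q" "q \<in> ball (c0_apply f x) e"
        using Q(2)[of "ball (c0_apply f x) e"] e by auto
      let ?U = "{y. norm (c0_apply f y - q) < e}"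
      have "open ?U" by (intro open_Collect_less continuous_intros)
      moreover have "x \<in> ?U" using q by (simp add: dist_norm)
      ultimately obtain b where "b \<in> B" "x \<in> b" "b \<subseteq> ?U"
        using topological_basisE[OF B(2)] by metis
      then show "x \<in> \<Union>(fst ` I)"
        using q(1) by (intro UN_I[of "(b, q)"]) (auto simp: I_def subset_iff intro: less_imp_le)
    qed
    moreover have "\<And>b. b \<in> fst ` I \<Longrightarrow> open b"
      using topological_basis_open[OF B(2)] by (auto simp: I_def)
    ultimately obtain D where D: "D \<subseteq> fst ` I" "finite D" "?K \<subseteq> \<Union>D"
      by (rule compactE[OF compact_c0_apply[OF e]])
    then obtain P where P: "P \<subseteq> I" "finite P" "D = fst ` P"
      using finite_subset_image[OF D(2,1)] by blast
    have "f \<in> W e P"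
      unfolding W_def
    proof (intro CollectI conjI allI impI ballI)
      fix p assume "p \<in> P"
      then have "p \<in> I" using P(1) by blast
      then show "case p of (b, q) \<Rightarrow> \<forall>x\<in>b. norm (c0_apply f x - q) \<le> e"
        by (auto simp: I_def)
    next
      fix x assume "x \<notin> \<Union>(fst ` P)"
      then have "x \<notin> ?K" using D(3) P(3) by blast
      then show "norm (c0_apply f x) \<le> e" by simp
    qed
    then show ?thesis using P unfolding I_def by blast
  qed
  define codes where "codes = (UNIV :: nat set) \<times> {P. finite P \<and> P \<subseteq> B \<times> Q}"
  define pt where "pt = (\<lambda>(n, P). SOME f. f \<in> W (inverse (real (Suc n))) P)"
  define D where "D = pt ` codes"
  have "countable codes"
    unfolding codes_def using B(1) Q(1)
    by (intro countable_SIGMA) (auto intro!: countable_Collect_finite_subset)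
  then have cD: "countable D" by (simp add: D_def)
  have dense: "\<exists>d\<in>D. norm (f - d) < e" if e: "e > 0" for f e
  proof -
    obtain n where n: "inverse (real (Suc n)) < e / 2"
      using reals_Archimedean[of "e/2"] e by auto
    obtain P where P: "finite P" "P \<subseteq> B \<times> Q" "f \<in> W (inverse (real (Suc n))) P"
      using cover[of "inverse (real (Suc n))" f] by auto
    have "pt (n, P) \<in> W (inverse (real (Suc n))) P"
      unfolding pt_def prod.case using P(3) by (rule someI)
    then have "norm (f - pt (n, P)) \<le> 2 * inverse (real (Suc n))"
      by (rule diam[OF P(3)])
    then have "norm (f - pt (n, P)) < e" using n by linarith
    moreover have "pt (n, P) \<in> D" using P by (auto simp: D_def codes_def)
    ultimately show ?thesis by blast
  qed
  define BB where "BB = (\<lambda>(d, n). ball d (inverse (real (Suc n)))) ` (D \<times> (UNIV :: nat set))"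
  have "topological_basis BB"
  proof (rule topological_basisI)
    fix S assume "S \<in> BB" then show "open S" by (auto simp: BB_def)
  next
    fix S :: "'a c0 set" and f assume "open S" "f \<in> S"
    then obtain e where e: "e > 0" "ball f e \<subseteq> S" by (meson open_contains_ball)
    obtain n where n: "inverse (real (Suc n)) < e / 2"
      using reals_Archimedean[of "e/2"] e by auto
    obtain d where d: "d \<in> D" "norm (f - d) < inverse (real (Suc n))"
      using dense[of "inverse (real (Suc n))" f] by auto
    have "ball d (inverse (real (Suc n))) \<subseteq> ball f e"
    proof
      fix g assume "g \<in> ball d (inverse (real (Suc n)))"
      then have "dist d g < e/2" using n by simp
      moreover have "dist f d < e/2" using d(2) n by (simp add: dist_norm)
      ultimately show "g \<in> ball f e"
        using dist_triangle_half_r[of d f e g] by (simp add: dist_commute)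
    qed
    moreover have "f \<in> ball d (inverse (real (Suc n)))"
      using d(2) by (simp add: dist_norm norm_minus_commute)
    moreover have "ball d (inverse (real (Suc n))) \<in> BB" using d(1) by (auto simp: BB_def)
    ultimately show "\<exists>S'\<in>BB. f \<in> S' \<and> S' \<subseteq> S" using e(2) by blast
  qed
  moreover have "countable BB" using cD by (simp add: BB_def)
  ultimately show "\<exists>B :: 'a c0 set set. countable B \<and> open = generate_topology B"
    using topological_basis_imp_subbasis by blast
qed

definition c0_scale :: "complex \<Rightarrow> 'x::topological_space c0 \<Rightarrow> 'x c0" where
  "c0_scale c f = c0_of (\<lambda>x. c * c0_apply f x)"

definition c0_mult :: "'x::topological_space c0 \<Rightarrow> 'x c0 \<Rightarrow> 'x c0" where
  "c0_mult f g = c0_of (\<lambda>x. c0_apply f x * c0_apply g x)"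

definition c0_cnj :: "'x::topological_space c0 \<Rightarrow> 'x c0" where
  "c0_cnj f = c0_of (\<lambda>x. cnj (c0_apply f x))"

lemma c0_apply_scale [simp]: "c0_apply (c0_scale c f) x = c * c0_apply f x"
proof -
  have "(\<lambda>x. c * c0_apply f x) \<in> vanishing_functions"
    by (rule vanishing_dominated[of _ "norm c + 1" f])
       (auto intro!: continuous_intros mult_right_mono simp: norm_mult add_nonneg_pos)
  then show ?thesis by (simp add: c0_scale_def c0_apply_c0_of)
qed

lemma c0_apply_mult [simp]: "c0_apply (c0_mult f g) x = c0_apply f x * c0_apply g x"
proof -
  have "norm (c0_apply f x * c0_apply g x) \<le> (norm f + 1) * norm (c0_apply g x)" for x
    using norm_c0_apply_le[of f x] by (auto intro!: mult_right_mono simp: norm_mult)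
  then have "(\<lambda>x. c0_apply f x * c0_apply g x) \<in> vanishing_functions"
    by (rule vanishing_dominated[rotated]) (auto intro!: continuous_intros simp: add_nonneg_pos)
  then show ?thesis by (simp add: c0_mult_def c0_apply_c0_of)
qed

lemma c0_apply_cnj [simp]: "c0_apply (c0_cnj f) x = cnj (c0_apply f x)"
proof -
  have "(\<lambda>x. cnj (c0_apply f x)) \<in> vanishing_functions"
    by (rule vanishing_dominated[of _ 1 f]) (auto intro!: continuous_intros)
  then show ?thesis by (simp add: c0_cnj_def c0_apply_c0_of)
qed


section \<open>Transformation groups and Haar measure\<close>

text \<open>
  Groups are types of class \<^class>\<open>topological_group_add\<close>. They are written additively,
  but are not assumed to be abelian: \<open>s + t\<close>, \<open>0\<close> and \<open>- s\<close> stand for \<open>st\<close>, \<open>e\<close> and \<open>s\<^sup>-\<^sup>1\<close>.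
\<close>

definition transformation_group ::
  "('g::{topological_group_add,t2_space} \<Rightarrow> 'x::t2_space \<Rightarrow> 'x) \<Rightarrow> bool" where
  "transformation_group act \<longleftrightarrow>
     locally_compact_space (euclidean :: 'g topology) \<and>
     locally_compact_space (euclidean :: 'x topology) \<and>
     (\<forall>x. act 0 x = x) \<and>
     (\<forall>s t x. act (s + t) x = act s (act t x)) \<and>
     continuous_on UNIV (\<lambda>(s, x). act s x)"

definition free_action :: "('g::zero \<Rightarrow> 'x \<Rightarrow> 'x) \<Rightarrow> bool" where
  "free_action act \<longleftrightarrow> (\<forall>s x. act s x = x \<longrightarrow> s = 0)"

definition orbit :: "('g \<Rightarrow> 'x \<Rightarrow> 'x) \<Rightarrow> 'x \<Rightarrow> 'x set" where
  "orbit act x = range (\<lambda>s. act s x)"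

definition locally_closed :: "'x::topological_space set \<Rightarrow> bool" where
  "locally_closed S \<longleftrightarrow> openin (top_of_set (closure S)) S"

text \<open>The usual regularity conditions on a Haar measure are automatic for Borel measures that
  are finite on compact sets when the group is second countable.\<close>

definition right_haar_measure ::
  "'g::{topological_group_add,t2_space,second_countable_topology} measure \<Rightarrow> bool" where
  "right_haar_measure \<nu> \<longleftrightarrow>
     sets \<nu> = sets borel \<and>
     emeasure \<nu> UNIV \<noteq> 0 \<and>
     (\<forall>K. compact K \<longrightarrow> emeasure \<nu> K < \<infinity>) \<and>
     (\<forall>t. \<forall>E\<in>sets borel. emeasure \<nu> ((\<lambda>s. s + t) ` E) = emeasure \<nu> E)"

text \<open>The left Haar measure \<open>\<mu>\<close> with \<open>\<nu>(E) = \<mu>(E\<^sup>-\<^sup>1)\<close>.\<close>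

definition left_haar :: "'g::topological_group_add measure \<Rightarrow> 'g measure" where
  "left_haar \<nu> = distr \<nu> borel uminus"

text \<open>The convention is \<open>\<mu>(Et) = \<Delta>(t) \<mu>(E)\<close>, which makes the operators \<open>\<lambda>\<^sub>t\<close> below unitary.\<close>

definition modular_function ::
  "'g::topological_group_add measure \<Rightarrow> ('g \<Rightarrow> real) \<Rightarrow> bool" where
  "modular_function \<mu> \<Delta> \<longleftrightarrow>
     (\<forall>t. 0 < \<Delta> t \<and>
       (\<forall>E\<in>sets borel. emeasure \<mu> ((\<lambda>s. s + t) ` E) = ennreal (\<Delta> t) * emeasure \<mu> E))"


section \<open>Enveloping \<open>C\<^sup>*\<close>-algebras\<close>

text \<open>
  The norm of a \<open>star_alg\<close> may have a non-trivial null space, and the algebraic laws are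
  only expected to hold modulo that null space. This allows \<open>L\<^sup>1\<close>-spaces of functions,
  not identified almost everywhere.
\<close>

record 'a star_alg =
  elts :: "'a set"
  sa_add :: "'a \<Rightarrow> 'a \<Rightarrow> 'a"
  sa_scale :: "complex \<Rightarrow> 'a \<Rightarrow> 'a"
  sa_mult :: "'a \<Rightarrow> 'a \<Rightarrow> 'a"
  sa_star :: "'a \<Rightarrow> 'a"
  sa_norm :: "'a \<Rightarrow> real"

definition sa_diff :: "('a, 'm) star_alg_scheme \<Rightarrow> 'a \<Rightarrow> 'a \<Rightarrow> 'a" where
  "sa_diff A a b = sa_add A a (sa_scale A (-1) b)"

definition cstar_seminorm :: "('a, 'm) star_alg_scheme \<Rightarrow> ('a \<Rightarrow> real) \<Rightarrow> bool" where
  "cstar_seminorm B p \<longleftrightarrow>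
     (\<forall>a\<in>elts B. 0 \<le> p a \<and> p a \<le> sa_norm B a) \<and>
     (\<forall>c. \<forall>a\<in>elts B. p (sa_scale B c a) = cmod c * p a) \<and>
     (\<forall>a\<in>elts B. \<forall>b\<in>elts B. p (sa_add B a b) \<le> p a + p b) \<and>
     (\<forall>a\<in>elts B. \<forall>b\<in>elts B. p (sa_mult B a b) \<le> p a * p b) \<and>
     (\<forall>a\<in>elts B. p (sa_mult B (sa_star B a) a) = (p a)\<^sup>2)"

text \<open>
  The \<open>C\<^sup>*\<close>-seminorms are the functions \<open>a \<mapsto> \<parallel>\<pi>(a)\<parallel>\<close> for \<open>*\<close>-representations \<open>\<pi>\<close> on
  Hilbert spaces (Gelfand-Naimark), so this is the supremum of \<open>\<parallel>\<pi>(a)\<parallel>\<close> over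
  all \<open>*\<close>-representations, without quantifying over Hilbert spaces.
\<close>

definition enveloping_norm :: "('a, 'm) star_alg_scheme \<Rightarrow> 'a \<Rightarrow> real" where
  "enveloping_norm B a = (SUP p\<in>{p. cstar_seminorm B p}. p a)"

text \<open>
  The enveloping \<open>C\<^sup>*\<close>-algebra is the Hausdorff completion for \<^const>\<open>enveloping_norm\<close>,
  realised by classes of Cauchy sequences.
\<close>

definition env_cauchy :: "('a, 'm) star_alg_scheme \<Rightarrow> (nat \<Rightarrow> 'a) set" where
  "env_cauchy B = {F. (\<forall>n. F n \<in> elts B) \<and>
     (\<forall>e>0. \<exists>N. \<forall>m\<ge>N. \<forall>n\<ge>N. enveloping_norm B (sa_diff B (F m) (F n)) < e)}"

definition env_class :: "('a, 'm) star_alg_scheme \<Rightarrow> (nat \<Rightarrow> 'a) \<Rightarrow> (nat \<Rightarrow> 'a) set" where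
  "env_class B F = {G \<in> env_cauchy B. (\<lambda>n. enveloping_norm B (sa_diff B (F n) (G n))) \<longlonglongrightarrow> 0}"

definition env_rep :: "(nat \<Rightarrow> 'a) set \<Rightarrow> nat \<Rightarrow> 'a" where
  "env_rep a = (SOME F. F \<in> a)"

definition enveloping_algebra ::
  "('a, 'm) star_alg_scheme \<Rightarrow> (nat \<Rightarrow> 'a) set star_alg" where
  "enveloping_algebra B =
    \<lparr> elts = env_class B ` env_cauchy B,
      sa_add = (\<lambda>a b. env_class B (\<lambda>n. sa_add B (env_rep a n) (env_rep b n))),
      sa_scale = (\<lambda>c a. env_class B (\<lambda>n. sa_scale B c (env_rep a n))),
      sa_mult = (\<lambda>a b. env_class B (\<lambda>n. sa_mult B (env_rep a n) (env_rep b n))),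
      sa_star = (\<lambda>a. env_class B (\<lambda>n. sa_star B (env_rep a n))),
      sa_norm = (\<lambda>a. lim (\<lambda>n. enveloping_norm B (env_rep a n))) \<rparr>"


section \<open>The transformation-group \<open>C\<^sup>*\<close>-algebra\<close>

definition lt :: "('g::uminus \<Rightarrow> 'x \<Rightarrow> 'x) \<Rightarrow> 'g \<Rightarrow> 'x::topological_space c0 \<Rightarrow> 'x c0" where
  "lt act s f = c0_of (\<lambda>x. c0_apply f (act (- s) x))"

lemma c0_apply_lt:
  assumes "transformation_group act"
  shows "c0_apply (lt act s f) x = c0_apply f (act (- s) x)"
proof -
  have C: "continuous_on UNIV (\<lambda>(s, x). act s x)" and
    A: "\<And>x. act 0 x = x" "\<And>s t x. act (s + t) x = act s (act t x)"
    using assms by (auto simp: transformation_group_def)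
  have cont: "continuous_on UNIV (act t)" for t
    using continuous_on_compose2[OF C continuous_on_Pair[OF continuous_on_const[of UNIV t]
          continuous_on_id[of UNIV]]] by simp
  have cf: "continuous_on UNIV (\<lambda>x. c0_apply f (act (- s) x))"
    by (rule continuous_on_compose2[OF continuous_c0_apply cont]) auto
  have "(\<lambda>x. c0_apply f (act (- s) x)) \<in> vanishing_functions"
    unfolding vanishing_functions_def
  proof (safe intro!: cf)
    fix e :: real assume "e > 0"
    then have "compact (act s ` {x. e \<le> norm (c0_apply f x)})"
      by (intro compact_continuous_image continuous_on_subset[OF cont] compact_c0_apply) auto
    moreover have "act s (act (- s) x) = x" for x
      by (metis A add.right_inverse)
    then have "norm (c0_apply f (act (- s) x)) < e"
      if "x \<notin> act s ` {x. e \<le> norm (c0_apply f x)}" for x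
      using that by (metis (mono_tags, lifting) imageI mem_Collect_eq not_le)
    ultimately show "compact {x. e \<le> norm (c0_apply f (act (- s) x))}"
      by (rule vanishing_compactI[OF cf])
  qed
  then show ?thesis by (simp add: lt_def c0_apply_c0_of)
qed

text \<open>\<open>L\<^sup>1(G, C\<^sub>0(X))\<close>, with the standard operations
  \<open>(f * g)(s) = \<integral> f(t) lt\<^sub>t(g(t\<^sup>-\<^sup>1s)) d\<mu>(t)\<close> and \<open>f\<^sup>*(s) = \<Delta>(s\<^sup>-\<^sup>1) lt\<^sub>s(f(s\<^sup>-\<^sup>1)\<^sup>*)\<close>.\<close>

definition L1_algebra ::
  "('g::{topological_group_add,t2_space,second_countable_topology} \<Rightarrow>
    'x::{t2_space,second_countable_topology} \<Rightarrow> 'x) \<Rightarrow> 'g measure \<Rightarrow> ('g \<Rightarrow> real) \<Rightarrow>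
    ('g \<Rightarrow> 'x c0) star_alg" where
  "L1_algebra act \<mu> \<Delta> =
    \<lparr> elts = {f. integrable \<mu> f},
      sa_add = (\<lambda>f g s. f s + g s),
      sa_scale = (\<lambda>c f s. c0_scale c (f s)),
      sa_mult = (\<lambda>f g s. \<integral>t. c0_mult (f t) (lt act t (g (- t + s))) \<partial>\<mu>),
      sa_star = (\<lambda>f s. \<Delta> (- s) *\<^sub>R lt act s (c0_cnj (f (- s)))),
      sa_norm = (\<lambda>f. \<integral>s. norm (f s) \<partial>\<mu>) \<rparr>"

definition crossed_product ::
  "('g::{topological_group_add,t2_space,second_countable_topology} \<Rightarrow>
    'x::{t2_space,second_countable_topology} \<Rightarrow> 'x) \<Rightarrow> 'g measure \<Rightarrow> ('g \<Rightarrow> real) \<Rightarrow>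
    (nat \<Rightarrow> 'g \<Rightarrow> 'x c0) set star_alg" where
  "crossed_product act \<mu> \<Delta> = enveloping_algebra (L1_algebra act \<mu> \<Delta>)"


section \<open>Induced representations\<close>

record ('a, 'h) repr =
  rep_space :: "'h set"
  rep_inner :: "'h \<Rightarrow> 'h \<Rightarrow> complex"
  rep_act :: "'a \<Rightarrow> 'h \<Rightarrow> 'h"

text \<open>Square-integrable functions (\<open>L2_fun\<close>), and the Hilbert space \<open>L\<^sup>2\<close> of their
  almost-everywhere classes.\<close>

definition L2_fun :: "'g measure \<Rightarrow> ('g \<Rightarrow> complex) set" where
  "L2_fun \<nu> = {\<xi> \<in> borel_measurable \<nu>. integrable \<nu> (\<lambda>s. (cmod (\<xi> s))\<^sup>2)}"

definition L2_fun_inner :: "'g measure \<Rightarrow> ('g \<Rightarrow> complex) \<Rightarrow> ('g \<Rightarrow> complex) \<Rightarrow> complex" where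
  "L2_fun_inner \<nu> \<xi> \<eta> = (\<integral>s. \<xi> s * cnj (\<eta> s) \<partial>\<nu>)"

definition L2_class :: "'g measure \<Rightarrow> ('g \<Rightarrow> complex) \<Rightarrow> ('g \<Rightarrow> complex) set" where
  "L2_class \<nu> \<xi> = {\<eta> \<in> L2_fun \<nu>. AE s in \<nu>. \<eta> s = \<xi> s}"

definition L2_space :: "'g measure \<Rightarrow> ('g \<Rightarrow> complex) set set" where
  "L2_space \<nu> = L2_class \<nu> ` L2_fun \<nu>"

definition L2_inner :: "'g measure \<Rightarrow> ('g \<Rightarrow> complex) set \<Rightarrow> ('g \<Rightarrow> complex) set \<Rightarrow> complex" where
  "L2_inner \<nu> u v = (THE c. \<exists>\<xi>\<in>u. \<exists>\<eta>\<in>v. c = L2_fun_inner \<nu> \<xi> \<eta>)"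

definition eval_rep ::
  "('g \<Rightarrow> 'x \<Rightarrow> 'x) \<Rightarrow> 'x \<Rightarrow> 'x::topological_space c0 \<Rightarrow> ('g \<Rightarrow> complex) \<Rightarrow> 'g \<Rightarrow> complex" where
  "eval_rep act x f \<xi> = (\<lambda>s. c0_apply f (act s x) * \<xi> s)"

definition translation_rep ::
  "('g::group_add \<Rightarrow> real) \<Rightarrow> 'g \<Rightarrow> ('g \<Rightarrow> complex) \<Rightarrow> 'g \<Rightarrow> complex" where
  "translation_rep \<Delta> t \<xi> = (\<lambda>s. complex_of_real (sqrt (\<Delta> t)) * \<xi> (- t + s))"

text \<open>
  The integrated form of the covariant pair on \<open>L\<^sup>1(G, C\<^sub>0(X))\<close>, as a weak integral:
  the value at \<open>f\<close> and \<open>u\<close> is the class of those \<open>\<eta>\<close> for which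
  \<open>\<langle>\<eta>, \<zeta>\<rangle> = \<integral> \<langle>f(t) \<lambda>\<^sub>t \<xi>, \<zeta>\<rangle> d\<mu>(t)\<close> for all \<open>\<zeta>\<close>, where \<open>\<xi>\<close> represents \<open>u\<close>.
\<close>

definition integrated_form ::
  "('g::{topological_group_add,t2_space,second_countable_topology} \<Rightarrow>
    'x::{t2_space,second_countable_topology} \<Rightarrow> 'x) \<Rightarrow> 'g measure \<Rightarrow> ('g \<Rightarrow> real) \<Rightarrow> 'x \<Rightarrow>
    ('g \<Rightarrow> 'x c0) \<Rightarrow> ('g \<Rightarrow> complex) set \<Rightarrow> ('g \<Rightarrow> complex) set" where
  "integrated_form act \<nu> \<Delta> x f u =
     {\<eta> \<in> L2_fun \<nu>. \<exists>\<xi>\<in>u. \<forall>\<zeta>\<in>L2_fun \<nu>.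
        L2_fun_inner \<nu> \<eta> \<zeta> =
        (\<integral>t. L2_fun_inner \<nu> (eval_rep act x (f t) (translation_rep \<Delta> t \<xi>)) \<zeta> \<partial>left_haar \<nu>)}"

text \<open>Elements of the crossed product are classes \<open>a\<close> of Cauchy sequences in
  \<open>L\<^sup>1(G, C\<^sub>0(X))\<close>, and \<open>Ind \<epsilon>\<^sub>x\<close> is the extension by continuity of the integrated form.\<close>

definition Ind ::
  "('g::{topological_group_add,t2_space,second_countable_topology} \<Rightarrow>
    'x::{t2_space,second_countable_topology} \<Rightarrow> 'x) \<Rightarrow> 'g measure \<Rightarrow> ('g \<Rightarrow> real) \<Rightarrow> 'x \<Rightarrow>
    ((nat \<Rightarrow> 'g \<Rightarrow> 'x c0) set, ('g \<Rightarrow> complex) set) repr" where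
  "Ind act \<nu> \<Delta> x =
    \<lparr> rep_space = L2_space \<nu>,
      rep_inner = L2_inner \<nu>,
      rep_act = (\<lambda>a u. {\<eta> \<in> L2_fun \<nu>. \<exists>F\<in>a. \<exists>\<zeta>.
        (\<forall>n. \<zeta> n \<in> integrated_form act \<nu> \<Delta> x (F n) u) \<and>
        (\<lambda>n. \<integral>s. (cmod (\<zeta> n s - \<eta> s))\<^sup>2 \<partial>\<nu>) \<longlonglongrightarrow> 0}) \<rparr>"


section \<open>Pure states and lower multiplicity\<close>

text \<open>Functionals on \<open>A\<close> are functions on the whole type, of which only the values on
  \<^term>\<open>elts A\<close> matter.\<close>

definition dual :: "('a, 'm) star_alg_scheme \<Rightarrow> ('a \<Rightarrow> complex) set" where
  "dual A = {\<psi>.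
     (\<forall>a\<in>elts A. \<forall>b\<in>elts A. \<psi> (sa_add A a b) = \<psi> a + \<psi> b) \<and>
     (\<forall>c. \<forall>a\<in>elts A. \<psi> (sa_scale A c a) = c * \<psi> a) \<and>
     (\<exists>K. \<forall>a\<in>elts A. cmod (\<psi> a) \<le> K * sa_norm A a)}"

definition dual_norm :: "('a, 'm) star_alg_scheme \<Rightarrow> ('a \<Rightarrow> complex) \<Rightarrow> real" where
  "dual_norm A \<psi> = (SUP a\<in>{a \<in> elts A. sa_norm A a \<le> 1}. cmod (\<psi> a))"

definition states :: "('a, 'm) star_alg_scheme \<Rightarrow> ('a \<Rightarrow> complex) set" where
  "states A = {\<psi> \<in> dual A. dual_norm A \<psi> = 1 \<and>
     (\<forall>a\<in>elts A. \<psi> (sa_mult A (sa_star A a) a) \<in> \<real> \<and> 0 \<le> Re (\<psi> (sa_mult A (sa_star A a) a)))}"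

definition pure_states :: "('a, 'm) star_alg_scheme \<Rightarrow> ('a \<Rightarrow> complex) set" where
  "pure_states A = {\<phi> \<in> states A.
     \<forall>\<psi>\<in>states A. \<forall>\<theta>\<in>states A. \<forall>r. 0 < r \<and> r < 1 \<longrightarrow>
       (\<forall>a\<in>elts A. \<phi> a = complex_of_real r * \<psi> a + complex_of_real (1 - r) * \<theta> a) \<longrightarrow>
       (\<forall>a\<in>elts A. \<psi> a = \<phi> a \<and> \<theta> a = \<phi> a)}"

definition vector_functional :: "('a, 'h, 'm) repr_scheme \<Rightarrow> 'h \<Rightarrow> 'a \<Rightarrow> complex" where
  "vector_functional \<sigma> u = (\<lambda>a. rep_inner \<sigma> (rep_act \<sigma> a u) u)"

text \<open>A pure state is associated with the irreducible representation \<open>\<pi>\<close> (that is, its GNS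
  representation is equivalent to \<open>\<pi>\<close>) iff it is a vector state of \<open>\<pi>\<close>.\<close>

definition associated_pure_states ::
  "('a, 'm) star_alg_scheme \<Rightarrow> ('a, 'h, 'n) repr_scheme \<Rightarrow> ('a \<Rightarrow> complex) set" where
  "associated_pure_states A \<pi> = {\<phi> \<in> pure_states A.
     \<exists>u\<in>rep_space \<pi>. rep_inner \<pi> u u = 1 \<and> (\<forall>a\<in>elts A. \<phi> a = vector_functional \<pi> u a)}"

definition zero_nhd_base :: "('a, 'm) star_alg_scheme \<Rightarrow> ('a \<Rightarrow> complex) set set" where
  "zero_nhd_base A = {{\<psi> \<in> dual A. \<forall>a\<in>S. cmod (\<psi> a) < e} |S e. finite S \<and> S \<subseteq> elts A \<and> 0 < e}"

definition Vec ::
  "('a, 'h, 'm) repr_scheme \<Rightarrow> ('a \<Rightarrow> complex) \<Rightarrow> ('a \<Rightarrow> complex) set \<Rightarrow> 'h set" where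
  "Vec \<sigma> \<phi> N = {u \<in> rep_space \<sigma>. rep_inner \<sigma> u u = 1 \<and>
     (\<lambda>a. vector_functional \<sigma> u a - \<phi> a) \<in> N}"

definition orthonormal :: "('a, 'h, 'm) repr_scheme \<Rightarrow> 'h set \<Rightarrow> bool" where
  "orthonormal \<sigma> S \<longleftrightarrow> (\<forall>u\<in>S. \<forall>v\<in>S. rep_inner \<sigma> u v = (if u = v then 1 else 0))"

definition vec_dim ::
  "('a, 'h, 'm) repr_scheme \<Rightarrow> ('a \<Rightarrow> complex) \<Rightarrow> ('a \<Rightarrow> complex) set \<Rightarrow> enat" where
  "vec_dim \<sigma> \<phi> N = (SUP S\<in>{S. finite S \<and> S \<subseteq> Vec \<sigma> \<phi> N \<and> orthonormal \<sigma> S}. enat (card S))"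

text \<open>\<open>M\<^sub>L(\<pi>, \<Omega>)\<close> for the net \<open>\<Omega>\<close> along the filter \<open>\<F>\<close>, computed from a pure state \<open>\<phi>\<close>
  associated with \<open>\<pi>\<close>; the value does not depend on \<open>\<phi>\<close>.\<close>

definition lower_multiplicity ::
  "('a, 'm) star_alg_scheme \<Rightarrow> ('a \<Rightarrow> complex) \<Rightarrow> 'i filter \<Rightarrow>
    ('i \<Rightarrow> ('a, 'h, 'n) repr_scheme) \<Rightarrow> enat" where
  "lower_multiplicity A \<phi> \<F> \<Omega> = (INF N\<in>zero_nhd_base A. Liminf \<F> (\<lambda>i. vec_dim (\<Omega> i) \<phi> N))"

end

theory Submission
  imports Defs
begin

text \<open>
  Let \<open>u\<close> be a unit vector whose vector state under \<open>Ind \<epsilon>\<^sub>z\<close> is \<open>\<phi>\<close>, and write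
  \<open>h\<^sub>x(s) = h(s \<cdot> x)\<close>. The functions \<open>g\<^sub>z\<close> with \<open>g \<in> C\<^sub>0(X)\<close> are dense in \<open>L\<^sup>2(G, \<nu>)\<close>, since
  translates of \<open>\<phi>\<^sub>z\<^sup>-\<^sup>1(V)\<close> are relatively compact and cover \<open>G\<close>, so some \<open>g\<^sub>z\<close> of norm at most 1
  has \<open>|\<langle>u, g\<^sub>z\<rangle>|\<close> close to 1. For a large compact \<open>C \<subseteq> G\<close>, an element \<open>c\<close> of \<open>L\<^sup>1(G, C\<^sub>0(X))\<close> acts
  under every \<open>Ind \<epsilon>\<^sub>x\<close> by the kernel
  \<open>f(s \<cdot> x) cnj (g(v \<cdot> x)) 1\<^sub>C(sv\<^sup>-\<^sup>1)\<close>. At \<open>z\<close> this is the rank-one operator \<open>\<xi> \<mapsto> \<langle>\<xi>, g\<^sub>z\<rangle> f\<^sub>z\<close>.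
  The square norm of a row of the kernel depends only, and continuously, on \<open>s \<cdot> x\<close>, and it is at
  most 1 on the orbit of \<open>z\<close>. Hence if \<open>f\<close> approximates \<open>1\<^sub>V\<close> from below along that orbit and is
  supported where the square norms of the rows are below \<open>1 + \<epsilon>\<close>, then the square of the
  Hilbert-Schmidt norm at \<open>x\<^sub>n\<close> is at most \<open>(1 + \<epsilon>) \<nu>(\<phi>\<^bsub>x\<^sub>n\<^esub>\<^sup>-\<^sup>1(V)) \<le> (1 + \<epsilon>) M \<nu>(\<phi>\<^sub>z\<^sup>-\<^sup>1(V))\<close>, while
  each unit vector at \<open>x\<^sub>n\<close> whose state is close to \<open>\<phi>\<close> on \<open>c\<^sup>*c\<close> contributes
  at least about \<open>\<nu>(\<phi>\<^sub>z\<^sup>-\<^sup>1(V))\<close> by Bessel's inequality. At most \<open>\<lfloor>M\<rfloor>\<close> such vectors are orthonormal.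
\<close>

section \<open>Square-integrable functions\<close>

text \<open>The obstacle is that the choice of g is made along the orbit of z only: at x_n the
  function v \<mapsto> g(v\<cdot>x_n) may have a large or infinite square norm, because v\<cdot>x_n
  may meet the support of g far more often than v\<cdot>z does. Cutting by 1_C(s v^-1) turns the
  square norm of row s, at any base point x, into the integral of |g(t^-1\<cdot>y)|^2 over t in C
  with y = s\<cdot>x. One open condition on y, valid on the orbit of z, then serves every x_n at
  once. If C contains s v^-1 for all s in \<phi>_z^-1(V) and all v with g(v\<cdot>z) nonzero, the
  cut is invisible at z. The tested element is c^* c because its vector states are \<parallel>c
  \<xi>\<parallel>^2, the summands of a Hilbert-Schmidt norm. Density of the functions g_z is needed
  because the unit vector u is prescribed by \<phi> and cannot be adapted to the construction;
  freeness enters there, as injectivity of the orbit map. In the final factor (1 - \<epsilon>)^3 -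
  \<epsilon>, two powers come from |<u, g_z>|^2, one from the approximation of 1_V by f, and the
  subtracted \<epsilon> is the tolerance of the weak* neighbourhood.\<close>

definition L2_norm :: "'a measure \<Rightarrow> ('a \<Rightarrow> complex) \<Rightarrow> real" where
  "L2_norm M \<xi> = sqrt (\<integral>s. (cmod (\<xi> s))\<^sup>2 \<partial>M)"

lemma L2_funD:
  assumes "\<xi> \<in> L2_fun M"
  shows "\<xi> \<in> borel_measurable M" "integrable M (\<lambda>s. (cmod (\<xi> s))\<^sup>2)"
  using assms by (auto simp: L2_fun_def)

lemma L2_norm_nonneg [simp]: "0 \<le> L2_norm M \<xi>"
  by (simp add: L2_norm_def)

lemma L2_norm_power2: "(L2_norm M \<xi>)\<^sup>2 = (\<integral>s. (cmod (\<xi> s))\<^sup>2 \<partial>M)"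
  by (simp add: L2_norm_def)

lemma L2_fun_iff_nn_integral:
  assumes [measurable]: "\<xi> \<in> borel_measurable M"
  shows "\<xi> \<in> L2_fun M \<longleftrightarrow> (\<integral>\<^sup>+s. ennreal ((cmod (\<xi> s))\<^sup>2) \<partial>M) < \<infinity>"
  by (auto simp: L2_fun_def integrable_iff_bounded)

lemma L2_norm_eq_nn_integral:
  assumes "\<xi> \<in> L2_fun M"
  shows "ennreal ((L2_norm M \<xi>)\<^sup>2) = (\<integral>\<^sup>+s. ennreal ((cmod (\<xi> s))\<^sup>2) \<partial>M)"
  using L2_funD[OF assms] by (subst nn_integral_eq_integral) (auto simp: L2_norm_power2)

lemma L2_fun_boundI:
  assumes [measurable]: "\<xi> \<in> borel_measurable M"
    and "(\<integral>\<^sup>+s. ennreal ((cmod (\<xi> s))\<^sup>2) \<partial>M) \<le> ennreal (B\<^sup>2)" "0 \<le> B"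
  shows "\<xi> \<in> L2_fun M" "L2_norm M \<xi> \<le> B"
proof -
  show *: "\<xi> \<in> L2_fun M"
    using assms(2) by (auto simp: L2_fun_iff_nn_integral intro: le_less_trans)
  have "(L2_norm M \<xi>)\<^sup>2 \<le> B\<^sup>2"
    using assms(2) by (simp add: L2_norm_eq_nn_integral[OF *, symmetric])
  then show "L2_norm M \<xi> \<le> B" using assms(3) by (rule power2_le_imp_le)
qed

lemma L2_fun_dominated:
  assumes "\<zeta> \<in> L2_fun M" "\<xi> \<in> borel_measurable M" "AE s in M. cmod (\<xi> s) \<le> C * cmod (\<zeta> s)"
  shows "\<xi> \<in> L2_fun M"
proof -
  have "integrable M (\<lambda>s. C\<^sup>2 * (cmod (\<zeta> s))\<^sup>2)" using L2_funD[OF assms(1)] by simp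
  then have "integrable M (\<lambda>s. (cmod (\<xi> s))\<^sup>2)"
  proof (rule Bochner_Integration.integrable_bound)
    show "AE s in M. norm ((cmod (\<xi> s))\<^sup>2) \<le> norm (C\<^sup>2 * (cmod (\<zeta> s))\<^sup>2)"
      using assms(3)
    proof eventually_elim
      case (elim s)
      then have "(cmod (\<xi> s))\<^sup>2 \<le> (C * cmod (\<zeta> s))\<^sup>2" by (intro power_mono) auto
      then show ?case by (simp add: power_mult_distrib)
    qed
  qed (use assms(2) in measurable)
  then show ?thesis using assms(2) by (simp add: L2_fun_def)
qed

lemma L2_fun_scale:
  assumes "\<xi> \<in> L2_fun M" shows "(\<lambda>s. c * \<xi> s) \<in> L2_fun M"
  by (rule L2_fun_dominated[OF assms, of _ "cmod c"]) (use L2_funD[OF assms] in \<open>auto simp: norm_mult\<close>)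

lemma L2_fun_add:
  assumes "\<xi> \<in> L2_fun M" "\<zeta> \<in> L2_fun M"
  shows "(\<lambda>s. \<xi> s + \<zeta> s) \<in> L2_fun M"
proof -
  have "integrable M (\<lambda>s. 2 * (cmod (\<xi> s))\<^sup>2 + 2 * (cmod (\<zeta> s))\<^sup>2)"
    using L2_funD[OF assms(1)] L2_funD[OF assms(2)] by simp
  then have "integrable M (\<lambda>s. (cmod (\<xi> s + \<zeta> s))\<^sup>2)"
  proof (rule Bochner_Integration.integrable_bound)
    have "(cmod (\<xi> s + \<zeta> s))\<^sup>2 \<le> 2 * (cmod (\<xi> s))\<^sup>2 + 2 * (cmod (\<zeta> s))\<^sup>2" for s
    proof -
      have "(cmod (\<xi> s + \<zeta> s))\<^sup>2 \<le> (cmod (\<xi> s) + cmod (\<zeta> s))\<^sup>2"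
        by (intro power_mono norm_triangle_ineq) auto
      also have "\<dots> \<le> 2 * (cmod (\<xi> s))\<^sup>2 + 2 * (cmod (\<zeta> s))\<^sup>2"
        using zero_le_power2[of "cmod (\<xi> s) - cmod (\<zeta> s)"] by (simp add: power2_eq_square algebra_simps)
      finally show ?thesis .
    qed
    then show "AE s in M. norm ((cmod (\<xi> s + \<zeta> s))\<^sup>2) \<le> norm (2 * (cmod (\<xi> s))\<^sup>2 + 2 * (cmod (\<zeta> s))\<^sup>2)"
      by auto
  qed (use L2_funD[OF assms(1)] L2_funD[OF assms(2)] in measurable)
  then show ?thesis using L2_funD[OF assms(1)] L2_funD[OF assms(2)] by (simp add: L2_fun_def)
qed

lemma L2_fun_zero: "(\<lambda>s. 0) \<in> L2_fun M"
  by (simp add: L2_fun_def)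

lemma L2_fun_diff:
  assumes "\<xi> \<in> L2_fun M" "\<zeta> \<in> L2_fun M"
  shows "(\<lambda>s. \<xi> s - \<zeta> s) \<in> L2_fun M"
  using L2_fun_add[OF assms(1) L2_fun_scale[OF assms(2), of "-1"]] by simp

lemma L2_fun_sum:
  assumes "\<And>i. i \<in> I \<Longrightarrow> \<xi> i \<in> L2_fun M"
  shows "(\<lambda>s. \<Sum>i\<in>I. \<xi> i s) \<in> L2_fun M"
  using assms by (induction I rule: infinite_finite_induct) (auto intro: L2_fun_zero L2_fun_add)

lemma L2_fun_cnj:
  assumes "\<xi> \<in> L2_fun M" shows "(\<lambda>s. cnj (\<xi> s)) \<in> L2_fun M"
proof (rule L2_fun_dominated[OF assms, of _ 1])
  have [measurable]: "\<xi> \<in> borel_measurable M" using L2_funD[OF assms] by simp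
  show "(\<lambda>s. cnj (\<xi> s)) \<in> borel_measurable M"
    by (rule borel_measurable_continuous_on[of cnj]) (auto intro: continuous_intros)
qed auto

lemma L2_mult_integrable:
  assumes "\<xi> \<in> L2_fun M" "\<zeta> \<in> L2_fun M"
  shows "integrable M (\<lambda>s. \<xi> s * cnj (\<zeta> s))"
proof -
  have "integrable M (\<lambda>s. (cmod (\<xi> s))\<^sup>2 + (cmod (\<zeta> s))\<^sup>2)"
    using L2_funD[OF assms(1)] L2_funD[OF assms(2)] by simp
  then show ?thesis
  proof (rule Bochner_Integration.integrable_bound)
    have "cmod (\<xi> s) * cmod (\<zeta> s) \<le> (cmod (\<xi> s))\<^sup>2 + (cmod (\<zeta> s))\<^sup>2" for s
    proof -
      have "2 * (cmod (\<xi> s) * cmod (\<zeta> s)) \<le> (cmod (\<xi> s))\<^sup>2 + (cmod (\<zeta> s))\<^sup>2"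
        using zero_le_power2[of "cmod (\<xi> s) - cmod (\<zeta> s)"]
        by (simp add: power2_eq_square algebra_simps)
      then show ?thesis using mult_nonneg_nonneg[OF norm_ge_zero[of "\<xi> s"] norm_ge_zero[of "\<zeta> s"]] by linarith
    qed
    then show "AE s in M. norm (\<xi> s * cnj (\<zeta> s)) \<le> norm ((cmod (\<xi> s))\<^sup>2 + (cmod (\<zeta> s))\<^sup>2)"
      by (auto simp: norm_mult)
  qed (use L2_funD[OF assms(1)] L2_funD[OF L2_fun_cnj[OF assms(2)]] in measurable)
qed

lemma L2_fun_inner_scale_left:
  "L2_fun_inner M (\<lambda>s. c * \<xi> s) \<zeta> = c * L2_fun_inner M \<xi> \<zeta>"
  by (simp add: L2_fun_inner_def mult.assoc)

lemma L2_fun_inner_diff_left: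
  assumes "\<xi> \<in> L2_fun M" "\<eta> \<in> L2_fun M" "\<zeta> \<in> L2_fun M"
  shows "L2_fun_inner M (\<lambda>s. \<xi> s - \<eta> s) \<zeta> = L2_fun_inner M \<xi> \<zeta> - L2_fun_inner M \<eta> \<zeta>"
  using L2_mult_integrable[OF assms(1,3)] L2_mult_integrable[OF assms(2,3)]
  by (simp add: L2_fun_inner_def left_diff_distrib)

lemma L2_fun_inner_sum_left:
  assumes "\<And>i. i \<in> I \<Longrightarrow> \<xi> i \<in> L2_fun M" "\<zeta> \<in> L2_fun M"
  shows "L2_fun_inner M (\<lambda>s. \<Sum>i\<in>I. \<xi> i s) \<zeta> = (\<Sum>i\<in>I. L2_fun_inner M (\<xi> i) \<zeta>)"
  using assms L2_mult_integrable[OF assms]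
  by (simp add: L2_fun_inner_def sum_distrib_right)

lemma L2_fun_inner_cnj: "cnj (L2_fun_inner M \<xi> \<zeta>) = L2_fun_inner M \<zeta> \<xi>"
  unfolding L2_fun_inner_def by (simp add: mult.commute flip: Bochner_Integration.integral_cnj)

lemma L2_fun_inner_self: "L2_fun_inner M \<xi> \<xi> = complex_of_real ((L2_norm M \<xi>)\<^sup>2)"
  unfolding L2_norm_power2 L2_fun_inner_def complex_norm_square[symmetric] integral_complex_of_real ..

lemma L2_fun_inner_cong:
  assumes "\<xi> \<in> L2_fun M" "\<xi>' \<in> L2_fun M" "\<zeta> \<in> L2_fun M" "\<zeta>' \<in> L2_fun M"
    "AE s in M. \<xi>' s = \<xi> s" "AE s in M. \<zeta>' s = \<zeta> s"
  shows "L2_fun_inner M \<xi>' \<zeta>' = L2_fun_inner M \<xi> \<zeta>"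
  unfolding L2_fun_inner_def
proof (rule integral_cong_AE)
  show "AE s in M. \<xi>' s * cnj (\<zeta>' s) = \<xi> s * cnj (\<zeta> s)" using assms(5,6) by eventually_elim simp
qed (auto intro!: borel_measurable_integrable L2_mult_integrable assms)

lemma L2_norm_scale: "L2_norm M (\<lambda>s. c * \<xi> s) = cmod c * L2_norm M \<xi>"
  by (simp add: L2_norm_def norm_mult power_mult_distrib real_sqrt_mult)

lemma L2_norm_zero: "L2_norm M (\<lambda>s. 0) = 0"
  by (simp add: L2_norm_def)

lemma L2_norm_eq_0_iff:
  assumes "\<xi> \<in> L2_fun M"
  shows "L2_norm M \<xi> = 0 \<longleftrightarrow> (AE s in M. \<xi> s = 0)"
  using integral_nonneg_eq_0_iff_AE[OF L2_funD(2)[OF assms]] by (simp add: L2_norm_def)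

lemma L2_norm_cong:
  assumes "\<xi> \<in> L2_fun M" "\<zeta> \<in> L2_fun M" "AE s in M. \<xi> s = \<zeta> s"
  shows "L2_norm M \<xi> = L2_norm M \<zeta>"
proof -
  have "(\<integral>s. (cmod (\<xi> s))\<^sup>2 \<partial>M) = (\<integral>s. (cmod (\<zeta> s))\<^sup>2 \<partial>M)"
    by (rule integral_cong_AE) (use L2_funD(2)[OF assms(1)] L2_funD(2)[OF assms(2)] assms(3) in auto)
  then show ?thesis by (simp add: L2_norm_def)
qed

lemma L2_norm_diff_power2:
  assumes "\<xi> \<in> L2_fun M" "\<zeta> \<in> L2_fun M"
  shows "(L2_norm M (\<lambda>s. \<xi> s - \<zeta> s))\<^sup>2 =
    (L2_norm M \<xi>)\<^sup>2 - 2 * Re (L2_fun_inner M \<xi> \<zeta>) + (L2_norm M \<zeta>)\<^sup>2"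
proof -
  have "(cmod (a - b))\<^sup>2 = (cmod a)\<^sup>2 - 2 * Re (a * cnj b) + (cmod b)\<^sup>2" for a b
    unfolding cmod_power2 by (simp add: power2_eq_square algebra_simps)
  then have "(L2_norm M (\<lambda>s. \<xi> s - \<zeta> s))\<^sup>2 =
      (\<integral>s. (cmod (\<xi> s))\<^sup>2 - 2 * Re (\<xi> s * cnj (\<zeta> s)) + (cmod (\<zeta> s))\<^sup>2 \<partial>M)"
    by (simp add: L2_norm_power2)
  also have "\<dots> = (L2_norm M \<xi>)\<^sup>2 - 2 * (\<integral>s. Re (\<xi> s * cnj (\<zeta> s)) \<partial>M) + (L2_norm M \<zeta>)\<^sup>2"
    using L2_funD(2)[OF assms(1)] L2_funD(2)[OF assms(2)] integrable_Re[OF L2_mult_integrable[OF assms]]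
    by (simp only: L2_norm_power2 Bochner_Integration.integral_add Bochner_Integration.integral_diff
        Bochner_Integration.integrable_add Bochner_Integration.integrable_diff integral_mult_right_zero
        integrable_mult_right)
  also have "(\<integral>s. Re (\<xi> s * cnj (\<zeta> s)) \<partial>M) = Re (L2_fun_inner M \<xi> \<zeta>)"
    unfolding L2_fun_inner_def by (rule integral_Re[OF L2_mult_integrable[OF assms]])
  finally show ?thesis .
qed

text \<open>Expand 0 \<le> \<parallel>\<zeta> - \<eta>\<parallel>^2 for the projection \<zeta> of
  \<eta> onto the span of the family: both <\<zeta>, \<eta>> and <\<zeta>, \<zeta>> equal the sum of
  the |c i|^2.\<close>

lemma L2_Bessel:
  assumes "finite I" "\<And>i. i \<in> I \<Longrightarrow> \<xi> i \<in> L2_fun M" "\<eta> \<in> L2_fun M"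
    and orth: "\<And>i j. i \<in> I \<Longrightarrow> j \<in> I \<Longrightarrow> L2_fun_inner M (\<xi> i) (\<xi> j) = (if i = j then 1 else 0)"
  shows "(\<Sum>i\<in>I. (cmod (L2_fun_inner M \<eta> (\<xi> i)))\<^sup>2) \<le> (L2_norm M \<eta>)\<^sup>2"
proof -
  define c where "c i = L2_fun_inner M \<eta> (\<xi> i)" for i
  define \<zeta> where "\<zeta> s = (\<Sum>i\<in>I. c i * \<xi> i s)" for s
  have sc: "(\<lambda>s. c i * \<xi> i s) \<in> L2_fun M" if "i \<in> I" for i
    using L2_fun_scale assms(2) that by blast
  have \<zeta>: "\<zeta> \<in> L2_fun M" unfolding \<zeta>_def using sc by (rule L2_fun_sum)
  have inner: "L2_fun_inner M \<zeta> \<theta> = (\<Sum>i\<in>I. c i * L2_fun_inner M (\<xi> i) \<theta>)" if "\<theta> \<in> L2_fun M" for \<theta>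
    unfolding \<zeta>_def by (simp add: L2_fun_inner_sum_left[OF sc that] L2_fun_inner_scale_left)
  have "L2_fun_inner M \<zeta> \<eta> = (\<Sum>i\<in>I. c i * cnj (c i))"
    by (simp add: inner[OF assms(3)] c_def L2_fun_inner_cnj)
  then have 1: "L2_fun_inner M \<zeta> \<eta> = of_real (\<Sum>i\<in>I. (cmod (c i))\<^sup>2)"
    by (simp only: of_real_sum complex_norm_square)
  have "L2_fun_inner M (\<xi> i) \<zeta> = cnj (c i)" if "i \<in> I" for i
  proof -
    have "L2_fun_inner M \<zeta> (\<xi> i) = (\<Sum>j\<in>I. if j = i then c j else 0)"
      unfolding inner[OF assms(2)[OF that]] by (rule sum.cong) (auto simp: orth that)
    then have "L2_fun_inner M \<zeta> (\<xi> i) = c i" using assms(1) that by simp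
    then show ?thesis by (metis L2_fun_inner_cnj)
  qed
  then have "L2_fun_inner M \<zeta> \<zeta> = (\<Sum>i\<in>I. c i * cnj (c i))"
    unfolding inner[OF \<zeta>] by (intro sum.cong) auto
  then have 2: "L2_fun_inner M \<zeta> \<zeta> = of_real (\<Sum>i\<in>I. (cmod (c i))\<^sup>2)"
    by (simp only: of_real_sum complex_norm_square)
  have "(L2_norm M \<zeta>)\<^sup>2 = (\<Sum>i\<in>I. (cmod (c i))\<^sup>2)"
    using 2 unfolding L2_fun_inner_self of_real_eq_iff .
  moreover have "0 \<le> (L2_norm M (\<lambda>s. \<zeta> s - \<eta> s))\<^sup>2" by simp
  ultimately show ?thesis
    unfolding L2_norm_diff_power2[OF \<zeta> assms(3)] 1 c_def by simp
qed

text \<open>Bessel's inequality for the family consisting of the normalised second vector alone. A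
  vector of norm 0 cannot be normalised, but it vanishes almost everywhere.\<close>

lemma L2_Cauchy_Schwarz:
  assumes "\<xi> \<in> L2_fun M" "\<zeta> \<in> L2_fun M"
  shows "cmod (L2_fun_inner M \<xi> \<zeta>) \<le> L2_norm M \<xi> * L2_norm M \<zeta>"
proof (cases "L2_norm M \<zeta> = 0")
  case True
  then have "AE s in M. \<zeta> s = 0" using L2_norm_eq_0_iff[OF assms(2)] by simp
  then have "L2_fun_inner M \<xi> \<zeta> = L2_fun_inner M \<xi> (\<lambda>s. 0)"
    by (intro L2_fun_inner_cong assms L2_fun_zero) auto
  then show ?thesis by (simp add: L2_fun_inner_def)
next
  case False
  define \<theta> where "\<theta> s = of_real (1 / L2_norm M \<zeta>) * \<zeta> s" for s
  have \<theta>: "\<theta> \<in> L2_fun M" unfolding \<theta>_def by (rule L2_fun_scale[OF assms(2)])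
  have "L2_norm M \<theta> = 1" unfolding \<theta>_def L2_norm_scale using False by (simp add: norm_divide)
  then have "L2_fun_inner M \<theta> \<theta> = 1" by (simp add: L2_fun_inner_self)
  then have "(cmod (L2_fun_inner M \<xi> \<theta>))\<^sup>2 \<le> (L2_norm M \<xi>)\<^sup>2"
    using L2_Bessel[of "{()}" "\<lambda>_. \<theta>" M \<xi>] \<theta> assms(1) by simp
  then have "cmod (L2_fun_inner M \<theta> \<xi>) \<le> L2_norm M \<xi>"
    using power2_le_imp_le L2_norm_nonneg L2_fun_inner_cnj[of M \<xi> \<theta>] by (metis complex_mod_cnj)
  then have "cmod (L2_fun_inner M \<zeta> \<xi>) \<le> L2_norm M \<xi> * L2_norm M \<zeta>"
    unfolding \<theta>_def L2_fun_inner_scale_left using False L2_norm_nonneg[of M \<zeta>]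
    by (simp add: norm_mult norm_divide field_simps order_less_le)
  then show ?thesis by (metis L2_fun_inner_cnj complex_mod_cnj)
qed

lemma L2_norm_diff_triangle:
  assumes "\<xi> \<in> L2_fun M" "\<zeta> \<in> L2_fun M"
  shows "L2_norm M (\<lambda>s. \<xi> s - \<zeta> s) \<le> L2_norm M \<xi> + L2_norm M \<zeta>"
proof -
  have "- Re (L2_fun_inner M \<xi> \<zeta>) \<le> L2_norm M \<xi> * L2_norm M \<zeta>"
    using abs_Re_le_cmod[of "L2_fun_inner M \<xi> \<zeta>"] L2_Cauchy_Schwarz[OF assms] by linarith
  then have "(L2_norm M (\<lambda>s. \<xi> s - \<zeta> s))\<^sup>2 \<le> (L2_norm M \<xi> + L2_norm M \<zeta>)\<^sup>2"
    unfolding L2_norm_diff_power2[OF assms] by (simp add: power2_sum)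
  then show ?thesis by (rule power2_le_imp_le) simp
qed

lemma L2_norm_triangle:
  assumes "\<xi> \<in> L2_fun M" "\<zeta> \<in> L2_fun M"
  shows "L2_norm M (\<lambda>s. \<xi> s + \<zeta> s) \<le> L2_norm M \<xi> + L2_norm M \<zeta>"
  using L2_norm_diff_triangle[OF assms(1) L2_fun_scale[OF assms(2), of "-1"]]
    L2_norm_scale[of M "-1" \<zeta>] by simp

text \<open>Test against the difference of the two vectors. This is why the weak integral in
  \<open>integrated_form\<close> determines a single class.\<close>

lemma L2_AE_eqI:
  assumes "\<xi> \<in> L2_fun M" "\<eta> \<in> L2_fun M"
    and "\<And>\<zeta>. \<zeta> \<in> L2_fun M \<Longrightarrow> L2_fun_inner M \<xi> \<zeta> = L2_fun_inner M \<eta> \<zeta>"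
  shows "AE s in M. \<xi> s = \<eta> s"
proof -
  have d: "(\<lambda>s. \<xi> s - \<eta> s) \<in> L2_fun M" by (rule L2_fun_diff[OF assms(1,2)])
  have "L2_fun_inner M (\<lambda>s. \<xi> s - \<eta> s) (\<lambda>s. \<xi> s - \<eta> s) = 0"
    by (simp add: L2_fun_inner_diff_left[OF assms(1,2) d] assms(3)[OF d])
  then have "L2_norm M (\<lambda>s. \<xi> s - \<eta> s) = 0" by (simp add: L2_fun_inner_self)
  then show ?thesis using L2_norm_eq_0_iff[OF d] by simp
qed

text \<open>Cauchy-Schwarz for the functions sqrt w and sqrt w * h. If the last integral is
  infinite, the right side is infinite too, unless w vanishes almost everywhere and then the left
  side is 0.\<close>

lemma nn_integral_Cauchy_Schwarz_weighted:
  fixes w h :: "'a \<Rightarrow> real"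
  assumes [measurable]: "w \<in> borel_measurable M" "h \<in> borel_measurable M"
    and nonneg: "\<And>t. 0 \<le> w t" "\<And>t. 0 \<le> h t" and w: "integrable M w"
  shows "(\<integral>\<^sup>+t. ennreal (w t * h t) \<partial>M)\<^sup>2 \<le>
    (\<integral>\<^sup>+t. ennreal (w t) \<partial>M) * (\<integral>\<^sup>+t. ennreal (w t * (h t)\<^sup>2) \<partial>M)"
proof (cases "(\<integral>\<^sup>+t. ennreal (w t * (h t)\<^sup>2) \<partial>M) < \<infinity>")
  case True
  then have i2: "integrable M (\<lambda>t. w t * (h t)\<^sup>2)"
    using nonneg by (auto simp: integrable_iff_bounded abs_mult)
  let ?a = "\<lambda>t. complex_of_real (sqrt (w t))" and ?b = "\<lambda>t. complex_of_real (sqrt (w t) * h t)"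
  have a: "?a \<in> L2_fun M" and b: "?b \<in> L2_fun M"
    using w i2 nonneg by (auto simp: L2_fun_def norm_mult power_mult_distrib)
  have ab: "?b t * cnj (?a t) = of_real (w t * h t)" for t
    using nonneg(1)[of t] by (simp flip: of_real_mult)
  have i1: "integrable M (\<lambda>t. w t * h t)"
    using integrable_Re[OF L2_mult_integrable[OF b a]] unfolding ab by simp
  have "(\<integral>t. w t * h t \<partial>M) \<le> L2_norm M ?b * L2_norm M ?a"
    using L2_Cauchy_Schwarz[OF b a] unfolding L2_fun_inner_def ab integral_complex_of_real by simp
  then have "(\<integral>t. w t * h t \<partial>M)\<^sup>2 \<le> (L2_norm M ?b * L2_norm M ?a)\<^sup>2"
    using nonneg by (intro power_mono) auto
  also have "\<dots> = (\<integral>t. w t \<partial>M) * (\<integral>t. w t * (h t)\<^sup>2 \<partial>M)"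
    using nonneg by (simp add: power_mult_distrib L2_norm_power2 norm_mult)
  finally show ?thesis
    using nonneg w i1 i2 by (simp add: nn_integral_eq_integral ennreal_power ennreal_mult'[symmetric])
next
  case False
  then have top: "(\<integral>\<^sup>+t. ennreal (w t * (h t)\<^sup>2) \<partial>M) = top" by (simp add: less_top[symmetric])
  show ?thesis
  proof (cases "(\<integral>\<^sup>+t. ennreal (w t) \<partial>M) = 0")
    case True
    then have "AE t in M. w t = 0"
      using nonneg by (subst (asm) nn_integral_0_iff_AE) (auto simp: order_antisym_conv)
    then have "(\<integral>\<^sup>+t. ennreal (w t * h t) \<partial>M) = 0"
      by (subst nn_integral_0_iff_AE) auto
    then show ?thesis by simp
  next
    case False
    then show ?thesis unfolding top by (simp add: ennreal_mult_top)
  qed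
qed

lemma L2_classI: "\<xi> \<in> L2_fun M \<Longrightarrow> \<xi> \<in> L2_class M \<xi>"
  by (simp add: L2_class_def)

text \<open>Discharges the definite description in \<open>L2_inner\<close>: representatives differ
  only on null sets, so there is one possible value, and nonemptiness guarantees that there is one
  at all.\<close>

lemma L2_inner_eq:
  assumes "u \<noteq> {}" "v \<noteq> {}" "\<xi> \<in> L2_fun M" "\<eta> \<in> L2_fun M"
    "u \<subseteq> L2_class M \<xi>" "v \<subseteq> L2_class M \<eta>"
  shows "L2_inner M u v = L2_fun_inner M \<xi> \<eta>"
  unfolding L2_inner_def
proof (rule the_equality)
  have *: "L2_fun_inner M \<xi>' \<eta>' = L2_fun_inner M \<xi> \<eta>" if "\<xi>' \<in> u" "\<eta>' \<in> v" for \<xi>' \<eta>'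
    using that assms by (intro L2_fun_inner_cong) (auto simp: L2_class_def)
  then show "\<exists>\<xi>'\<in>u. \<exists>\<eta>'\<in>v. L2_fun_inner M \<xi> \<eta> = L2_fun_inner M \<xi>' \<eta>'"
    using assms(1,2) by fastforce
  show "c = L2_fun_inner M \<xi> \<eta>" if "\<exists>\<xi>'\<in>u. \<exists>\<eta>'\<in>v. c = L2_fun_inner M \<xi>' \<eta>'" for c
    using that * by auto
qed

section \<open>Second countable locally compact spaces\<close>

lemma Hausdorff_space_euclidean_t2: "Hausdorff_space (euclidean :: 'a::t2_space topology)"
  unfolding Hausdorff_space_def by (auto simp: disjnt_def dest!: hausdorff)

text \<open>Each point of U has a compact neighbourhood inside U. The Lindelof property leaves
  countably many of them, and finite unions of these increase to U.\<close>

lemma locally_compact_open_sigma_compact: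
  fixes U :: "'a::{t2_space,second_countable_topology} set"
  assumes lc: "locally_compact_space (euclidean :: 'a topology)" and U: "open U"
  obtains K :: "nat \<Rightarrow> 'a set" where "\<And>n. compact (K n)" "incseq K" "(\<Union>n. K n) = U"
proof -
  have nb: "neighbourhood_base_of (compactin (euclidean :: 'a topology)) euclidean"
    using lc locally_compact_space_neighbourhood_base Hausdorff_space_euclidean_t2 by metis
  have "\<exists>V C. open V \<and> compact C \<and> x \<in> V \<and> V \<subseteq> C \<and> C \<subseteq> U" if "x \<in> U" for x
    using nb U that unfolding neighbourhood_base_of by (auto simp: compactin_euclidean_iff)
  then obtain V C where VC: "\<And>x. x \<in> U \<Longrightarrow> open (V x) \<and> compact (C x) \<and> x \<in> V x \<and> V x \<subseteq> C x \<and> C x \<subseteq> U"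
    by metis
  obtain \<F> where \<F>: "\<F> \<subseteq> V ` U" "countable \<F>" "\<Union>\<F> = \<Union>(V ` U)"
    using Lindelof[of "V ` U"] VC by blast
  then obtain D where D: "D \<subseteq> U" "countable D" "\<F> = V ` D"
    using countable_subset_image[of \<F> V U] by auto
  have cover: "U = (\<Union>x\<in>D. C x)" using VC D \<F>(3) by blast
  show ?thesis
  proof (cases "D = {}")
    case True
    then show ?thesis using cover by (intro that[of "\<lambda>_. {}"]) (auto simp: incseq_def)
  next
    case False
    define d where "d = from_nat_into D"
    have d: "range d = D" unfolding d_def using False D(2) by (rule range_from_nat_into)
    show ?thesis
    proof (rule that[of "\<lambda>n. \<Union>i\<le>n. C (d i)"])
      show "compact (\<Union>i\<le>n. C (d i))" for n
        using VC D(1) d by (intro compact_UN) auto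
      show "incseq (\<lambda>n. \<Union>i\<le>n. C (d i))" by (force simp: incseq_def)
      show "(\<Union>n. \<Union>i\<le>n. C (d i)) = U" unfolding cover using d by auto
    qed
  qed
qed

text \<open>Complete regularity separates K from a closed set but gives no decay at infinity.
  Shrinking U to \<open>V = U \<inter> W\<close>, where W lies in a compact L, forces the function
  to vanish off L and hence to belong to C_0(X).\<close>

lemma c0_Urysohn:
  fixes U :: "'a::t2_space set"
  assumes lc: "locally_compact_space (euclidean :: 'a topology)"
    and K: "compact K" and U: "open U" and KU: "K \<subseteq> U"
  obtains g :: "'a c0" and h :: "'a \<Rightarrow> real"
  where "\<And>x. c0_apply g x = of_real (h x)" "\<And>x. 0 \<le> h x" "\<And>x. h x \<le> 1"
    "\<And>x. x \<in> K \<Longrightarrow> h x = 1" "\<And>x. x \<notin> U \<Longrightarrow> h x = 0"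
proof -
  have cr: "completely_regular_space (euclidean :: 'a topology)"
    using lc Hausdorff_space_euclidean_t2
    by (intro locally_compact_regular_imp_completely_regular_space) auto
  have "\<exists>W L. open W \<and> compact L \<and> closed L \<and> K \<subseteq> W \<and> W \<subseteq> L"
    using lc K locally_compact_space_compact_closed_compact[OF disjI1[OF Hausdorff_space_euclidean_t2[where 'a='a]]]
    by (auto simp: compactin_euclidean_iff)
  then obtain W L where WL: "open W" "compact L" "K \<subseteq> W" "W \<subseteq> L" by blast
  define V where "V = U \<inter> W"
  have V: "open V" "K \<subseteq> V" "V \<subseteq> U" "V \<subseteq> L" using U WL KU by (auto simp: V_def)
  obtain h where h: "continuous_map euclidean (top_of_set {0..1::real}) h"
    "h ` (- V) \<subseteq> {0}" "h ` K \<subseteq> {1}"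
    using Urysohn_completely_regular_compact_closed[of 0 1 "euclidean" K "- V"] cr K V
    by (auto simp: compactin_euclidean_iff disjnt_def)
  have cont: "continuous_on UNIV h" and range: "h x \<in> {0..1}" for x
    using h(1) by (auto simp: continuous_map_in_subtopology Pi_iff)
  have "(\<lambda>x. complex_of_real (h x)) \<in> vanishing_functions"
    unfolding vanishing_functions_def
  proof safe
    show c: "continuous_on UNIV (\<lambda>x. complex_of_real (h x))"
      by (intro continuous_intros cont)
    show "compact {x. e \<le> cmod (of_real (h x))}" if "e > 0" for e
      by (rule vanishing_compactI[OF c WL(2)]) (use V h(2) that in force)
  qed
  moreover have "h x = 0" if "x \<notin> U" for x using V(3) h(2) that by blast
  ultimately show ?thesis
    using h(3) range by (intro that[of "c0_of (\<lambda>x. of_real (h x))" h]) (auto simp: c0_apply_c0_of)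
qed

text \<open>Urysohn functions equal to 1 on the n-th set of a compact exhaustion of U. At each point
  the sequence is eventually constant, and the common bound 1 prepares for dominated
  convergence.\<close>

lemma c0_approx_indicator:
  fixes U :: "'a::{t2_space,second_countable_topology} set"
  assumes lc: "locally_compact_space (euclidean :: 'a topology)" and U: "open U"
  obtains g :: "nat \<Rightarrow> 'a c0" and h :: "nat \<Rightarrow> 'a \<Rightarrow> real"
  where "\<And>n x. c0_apply (g n) x = of_real (h n x)" "\<And>n x. 0 \<le> h n x" "\<And>n x. h n x \<le> 1"
    "\<And>n x. x \<notin> U \<Longrightarrow> h n x = 0" "\<And>x. (\<lambda>n. h n x) \<longlonglongrightarrow> indicator U x"
proof -
  obtain K where K: "\<And>n. compact (K n)" "incseq K" "(\<Union>n. K n) = U"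
    using locally_compact_open_sigma_compact[OF lc U] by blast
  have "\<exists>(g :: 'a c0) h. (\<forall>x. c0_apply g x = of_real (h x)) \<and> (\<forall>x. 0 \<le> h x \<and> h x \<le> (1::real)) \<and>
     (\<forall>x\<in>K n. h x = 1) \<and> (\<forall>x. x \<notin> U \<longrightarrow> h x = 0)" for n
  proof -
    have "K n \<subseteq> U" using K(3) by blast
    with lc K(1) U obtain g :: "'a c0" and h where "\<And>x. c0_apply g x = of_real (h x)"
      "\<And>x. 0 \<le> h x" "\<And>x. h x \<le> (1::real)" "\<And>x. x \<in> K n \<Longrightarrow> h x = 1" "\<And>x. x \<notin> U \<Longrightarrow> h x = 0"
      by (rule c0_Urysohn) blast
    then show ?thesis by blast
  qed
  then obtain g h where gh: "\<And>n. (\<forall>x. c0_apply (g n :: 'a c0) x = of_real (h n x)) \<and>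
     (\<forall>x. 0 \<le> h n x \<and> h n x \<le> (1::real)) \<and>
     (\<forall>x\<in>K n. h n x = 1) \<and> (\<forall>x. x \<notin> U \<longrightarrow> h n x = 0)"
    by metis
  have "(\<lambda>n. h n x) \<longlonglongrightarrow> indicator U x" for x
  proof (cases "x \<in> U")
    case True
    then obtain m where "x \<in> K m" using K(3) by blast
    then have "x \<in> K n" if "n \<ge> m" for n using K(2) that by (auto simp: incseq_def)
    then have "\<forall>\<^sub>F n in sequentially. h n x = indicator U x"
      using gh True unfolding eventually_sequentially by (auto intro!: exI[of _ m])
    then show ?thesis by (rule tendsto_eventually)
  next
    case False
    then show ?thesis using gh by simp
  qed
  then show ?thesis using gh by (intro that[of g h]) auto
qed

section \<open>Haar measure\<close>

lemma (in pair_sigma_finite) Fubini_integrableI: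
  fixes f :: "_ \<Rightarrow> _ \<Rightarrow> _::{banach, second_countable_topology}"
  assumes [measurable]: "case_prod f \<in> borel_measurable (M1 \<Otimes>\<^sub>M M2)"
    and "(\<integral>\<^sup>+x. \<integral>\<^sup>+y. ennreal (norm (f x y)) \<partial>M2 \<partial>M1) < \<infinity>"
  shows "integrable (M1 \<Otimes>\<^sub>M M2) (case_prod f)"
proof -
  have "(\<integral>\<^sup>+z. ennreal (norm (case_prod f z)) \<partial>(M1 \<Otimes>\<^sub>M M2)) < \<infinity>"
    using assms(2) by (subst M2.nn_integral_fst[symmetric]) auto
  then show ?thesis by (simp add: integrable_iff_bounded)
qed

locale haar_group =
  fixes \<nu> :: "'g::{topological_group_add,t2_space,second_countable_topology} measure"
    and \<Delta> :: "'g \<Rightarrow> real"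
  assumes locally_compact_group: "locally_compact_space (euclidean :: 'g topology)"
    and right_haar: "right_haar_measure \<nu>"
    and modular: "modular_function (left_haar \<nu>) \<Delta>"
begin

abbreviation \<mu> :: "'g measure" where "\<mu> \<equiv> left_haar \<nu>"

lemma sets_\<nu> [simp, measurable_cong]: "sets \<nu> = sets borel"
  using right_haar by (simp add: right_haar_measure_def)

lemma space_\<nu> [simp]: "space \<nu> = UNIV"
  using sets_eq_imp_space_eq[OF sets_\<nu>] by simp

lemma sets_\<mu> [simp, measurable_cong]: "sets \<mu> = sets borel"
  by (simp add: left_haar_def)

lemma space_\<mu> [simp]: "space \<mu> = UNIV"
  by (simp add: left_haar_def)

lemma measurable_group_uminus [measurable]: "uminus \<in> borel_measurable (borel :: 'g measure)"
  by (intro borel_measurable_continuous_onI continuous_intros)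

lemma measurable_group_uminus' [measurable (raw)]:
  "f \<in> borel_measurable N \<Longrightarrow> (\<lambda>s. - f s :: 'g) \<in> borel_measurable N"
  using measurable_compose[OF _ measurable_group_uminus] by simp

lemma measurable_group_diff [measurable (raw)]:
  "f \<in> borel_measurable N \<Longrightarrow> g \<in> borel_measurable N \<Longrightarrow> (\<lambda>s. f s - g s :: 'g) \<in> borel_measurable N"
  unfolding diff_conv_add_uminus by (intro borel_measurable_add measurable_group_uminus')

lemma \<Delta>_pos: "0 < \<Delta> t"
  using modular by (simp add: modular_function_def)

lemma emeasure_compact_finite: "compact K \<Longrightarrow> emeasure \<nu> K < \<infinity>"
  using right_haar by (simp add: right_haar_measure_def)

lemma distr_right_translate: "distr \<nu> borel (\<lambda>s. s + t) = \<nu>"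
proof (rule measure_eqI)
  fix A assume "A \<in> sets (distr \<nu> borel (\<lambda>s. s + t))"
  then have [measurable]: "A \<in> sets borel" by simp
  have *: "(\<lambda>s. s + t) -` A = (\<lambda>s. s + - t) ` A"
    by (force simp: image_iff add.assoc)
  have "emeasure (distr \<nu> borel (\<lambda>s. s + t)) A = emeasure \<nu> ((\<lambda>s. s + t) -` A)"
    by (simp add: emeasure_distr)
  also have "\<dots> = emeasure \<nu> A"
    unfolding * using right_haar \<open>A \<in> sets borel\<close>
    by (simp del: add_uminus_conv_diff add: right_haar_measure_def)
  finally show "emeasure (distr \<nu> borel (\<lambda>s. s + t)) A = emeasure \<nu> A" .
qed simp

lemma nn_integral_\<mu>:
  assumes [measurable]: "f \<in> borel_measurable borel"
  shows "(\<integral>\<^sup>+t. f t \<partial>\<mu>) = (\<integral>\<^sup>+t. f (- t) \<partial>\<nu>)"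
  unfolding left_haar_def by (simp add: nn_integral_distr)

lemma nn_integral_\<nu>:
  assumes [measurable]: "f \<in> borel_measurable borel"
  shows "(\<integral>\<^sup>+t. f t \<partial>\<nu>) = (\<integral>\<^sup>+t. f (- t) \<partial>\<mu>)"
  using nn_integral_\<mu>[of "\<lambda>t. f (- t)"] by simp

lemma nn_integral_right_translate:
  assumes [measurable]: "f \<in> borel_measurable borel"
  shows "(\<integral>\<^sup>+s. f (s + t) \<partial>\<nu>) = (\<integral>\<^sup>+s. f s \<partial>\<nu>)"
proof -
  have "(\<integral>\<^sup>+s. f s \<partial>\<nu>) = (\<integral>\<^sup>+s. f s \<partial>distr \<nu> borel (\<lambda>s. s + t))" by (simp add: distr_right_translate)
  then show ?thesis by (simp add: nn_integral_distr)
qed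

lemma distr_left_translate: "distr \<mu> borel (\<lambda>s. t + s) = \<mu>"
proof -
  have "distr \<mu> borel (\<lambda>s. t + s) = distr \<nu> borel (\<lambda>s. t + - s)"
    unfolding left_haar_def by (subst distr_distr) (auto simp: comp_def)
  also have "\<dots> = distr (distr \<nu> borel (\<lambda>s. s + - t)) borel uminus"
    by (subst distr_distr) (auto simp: comp_def minus_add)
  also have "\<dots> = \<mu>" unfolding distr_right_translate left_haar_def ..
  finally show ?thesis .
qed

lemma nn_integral_left_translate:
  assumes [measurable]: "f \<in> borel_measurable borel"
  shows "(\<integral>\<^sup>+s. f (t + s) \<partial>\<mu>) = (\<integral>\<^sup>+s. f s \<partial>\<mu>)"
proof -
  have "(\<integral>\<^sup>+s. f s \<partial>\<mu>) = (\<integral>\<^sup>+s. f s \<partial>distr \<mu> borel (\<lambda>s. t + s))" by (simp add: distr_left_translate)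
  then show ?thesis by (simp add: nn_integral_distr)
qed

text \<open>The modular relation for sets, restated as an identity of measures so that it applies to
  integrals.\<close>

lemma density_distr_\<mu>: "density (distr \<mu> borel (\<lambda>s. s + t)) (\<lambda>_. ennreal (\<Delta> t)) = \<mu>"
proof (rule measure_eqI)
  fix A assume "A \<in> sets (density (distr \<mu> borel (\<lambda>s. s + t)) (\<lambda>_. ennreal (\<Delta> t)))"
  then have A [measurable]: "A \<in> sets borel" by simp
  have B: "(\<lambda>s. s + t) -` A \<in> sets borel"
    using measurable_sets[of "\<lambda>s. s + t" borel borel A] by simp
  have "(\<lambda>s. s + t) ` ((\<lambda>s. s + t) -` A) = A"
    by (rule surj_image_vimage_eq, rule surjI[of _ "\<lambda>s. s - t"]) simp
  then have "emeasure \<mu> A = ennreal (\<Delta> t) * emeasure \<mu> ((\<lambda>s. s + t) -` A)"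
    using modular B unfolding modular_function_def by metis
  then show "emeasure (density (distr \<mu> borel (\<lambda>s. s + t)) (\<lambda>_. ennreal (\<Delta> t))) A = emeasure \<mu> A"
    by (simp add: emeasure_density_const emeasure_distr)
qed simp

lemma nn_integral_modular_right:
  assumes [measurable]: "f \<in> borel_measurable borel"
  shows "ennreal (\<Delta> t) * (\<integral>\<^sup>+s. f (s + t) \<partial>\<mu>) = (\<integral>\<^sup>+s. f s \<partial>\<mu>)"
  by (subst (2) density_distr_\<mu>[of t, symmetric])
     (simp add: nn_integral_density nn_integral_distr nn_integral_cmult)

text \<open>Left translation under \<nu> becomes right translation under \<mu> after inversion, and
  there the modular function is defined.\<close>

lemma density_distr_\<nu>: "density (distr \<nu> borel (\<lambda>s. - t + s)) (\<lambda>_. ennreal (\<Delta> t)) = \<nu>"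
proof (rule measure_eqI)
  fix A assume "A \<in> sets (density (distr \<nu> borel (\<lambda>s. - t + s)) (\<lambda>_. ennreal (\<Delta> t)))"
  then have A [measurable]: "A \<in> sets borel" by simp
  have "emeasure (density (distr \<nu> borel (\<lambda>s. - t + s)) (\<lambda>_. ennreal (\<Delta> t))) A
     = ennreal (\<Delta> t) * (\<integral>\<^sup>+s. indicator A (- t + s) \<partial>\<nu>)"
    by (simp add: nn_integral_density nn_integral_distr nn_integral_cmult flip: nn_integral_indicator)
  also have "(\<integral>\<^sup>+s. indicator A (- t + s) \<partial>\<nu>) = (\<integral>\<^sup>+s. indicator A (- (s + t)) \<partial>\<mu>)"
    by (subst nn_integral_\<nu>) (auto simp: minus_add)
  also have "ennreal (\<Delta> t) * \<dots> = (\<integral>\<^sup>+s. indicator A (- s) \<partial>\<mu>)"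
    by (rule nn_integral_modular_right) measurable
  also have "\<dots> = emeasure \<nu> A"
    by (simp add: nn_integral_\<nu>[symmetric])
  finally show "emeasure (density (distr \<nu> borel (\<lambda>s. - t + s)) (\<lambda>_. ennreal (\<Delta> t))) A = emeasure \<nu> A" .
qed simp

lemma nn_integral_modular_left:
  assumes [measurable]: "f \<in> borel_measurable borel"
  shows "ennreal (\<Delta> t) * (\<integral>\<^sup>+s. f (- t + s) \<partial>\<nu>) = (\<integral>\<^sup>+s. f s \<partial>\<nu>)"
  by (subst (2) density_distr_\<nu>[of t, symmetric])
     (simp add: nn_integral_density nn_integral_distr nn_integral_cmult)

lemma integral_modular_left:
  fixes f :: "'g \<Rightarrow> complex"
  assumes [measurable]: "f \<in> borel_measurable borel"
  shows "(\<integral>s. f s \<partial>\<nu>) = complex_of_real (\<Delta> t) * (\<integral>s. f (- t + s) \<partial>\<nu>)"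
  using \<Delta>_pos[of t]
  by (subst density_distr_\<nu>[of t, symmetric])
     (simp add: integral_density integral_distr scaleR_conv_of_real)

lemma compact_cover:
  obtains K :: "nat \<Rightarrow> 'g set" where "\<And>n. compact (K n)" "incseq K" "(\<Union>n. K n) = UNIV"
  by (rule locally_compact_open_sigma_compact[OF locally_compact_group open_UNIV]) blast

lemma sigma_finite_\<nu>: "sigma_finite_measure \<nu>"
proof -
  obtain K :: "nat \<Rightarrow> 'g set" where K: "\<And>n. compact (K n)" "(\<Union>n. K n) = UNIV"
    using compact_cover by metis
  have "emeasure \<nu> (K n) \<noteq> \<infinity>" for n using emeasure_compact_finite[OF K(1)[of n]] by auto
  then show ?thesis
    using K borel_compact[OF K(1)]
    by (intro sigma_finite_measure.intro exI[of _ "range K"]) auto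
qed

lemma sigma_finite_\<mu>: "sigma_finite_measure \<mu>"
proof -
  obtain K :: "nat \<Rightarrow> 'g set" where K: "\<And>n. compact (K n)" "(\<Union>n. K n) = UNIV"
    using compact_cover by metis
  define K' where "K' n = uminus ` K n" for n
  have K': "compact (K' n)" for n
    unfolding K'_def by (intro compact_continuous_image continuous_intros K(1))
  have "emeasure \<mu> (K' n) \<noteq> \<infinity>" for n
  proof -
    have "uminus -` K' n = K n" by (auto simp: K'_def)
    then show ?thesis
      using emeasure_compact_finite[OF K(1)[of n]] borel_compact[OF K'[of n]]
      by (auto simp: left_haar_def emeasure_distr)
  qed
  moreover have "(\<Union>n. K' n) = UNIV"
    using K(2) unfolding K'_def image_UN[symmetric] by (auto simp: surj_def intro: minus_minus[symmetric])
  ultimately show ?thesis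
    using borel_compact[OF K']
    by (intro sigma_finite_measure.intro exI[of _ "range K'"]) auto
qed

sublocale \<nu>: sigma_finite_measure \<nu> by (rule sigma_finite_\<nu>)
sublocale \<mu>: sigma_finite_measure \<mu> by (rule sigma_finite_\<mu>)
sublocale \<mu>\<nu>: pair_sigma_finite \<mu> \<nu> ..
sublocale \<mu>\<mu>: pair_sigma_finite \<mu> \<mu> ..
sublocale \<nu>\<mu>: pair_sigma_finite \<nu> \<mu> ..

text \<open>Supplies a factor that is neither 0 nor infinite, so that it may be cancelled in
  equations between extended reals. A compact exhaustion cannot consist of null sets, since the
  whole group is not null.\<close>

lemma positive_set:
  obtains E where "E \<in> sets borel" "0 < emeasure \<nu> E" "emeasure \<nu> E < \<infinity>"
proof -
  obtain K :: "nat \<Rightarrow> 'g set" where K: "\<And>n. compact (K n)" "(\<Union>n. K n) = UNIV"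
    using compact_cover by metis
  have "\<exists>n. emeasure \<nu> (K n) \<noteq> 0"
  proof (rule ccontr)
    assume "\<not> ?thesis"
    then have "K n \<in> null_sets \<nu>" for n using borel_compact[OF K(1)] by (auto simp: null_sets_def)
    then have "(\<Union>n. K n) \<in> null_sets \<nu>" by blast
    then show False using right_haar K(2) by (auto simp: right_haar_measure_def null_sets_def)
  qed
  then obtain n where "emeasure \<nu> (K n) \<noteq> 0" by blast
  then show ?thesis
    using K emeasure_compact_finite by (intro that[of "K n"]) (auto intro: borel_compact simp: zero_less_iff_neq_zero)
qed

lemma positive_set_\<mu>:
  obtains E where "E \<in> sets borel" "0 < emeasure \<mu> E" "emeasure \<mu> E < \<infinity>"
proof -
  obtain E where [measurable]: "E \<in> sets borel" and E: "0 < emeasure \<nu> E" "emeasure \<nu> E < \<infinity>"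
    by (rule positive_set)
  have "emeasure \<mu> (uminus -` E) = emeasure \<nu> E"
    using measurable_sets[OF measurable_group_uminus, of E]
    by (simp add: left_haar_def emeasure_distr vimage_comp comp_def)
  then show ?thesis
    using E measurable_sets[OF measurable_group_uminus, of E] by (intro that[of "uminus -` E"]) auto
qed

text \<open>For a set E of finite positive measure, \<open>\<Delta> t\<close> is the quotient of
  \<mu>(E) by \<mu>(E t^-1), and the denominator is measurable in t as a parameter integral.\<close>

lemma measurable_\<Delta> [measurable]: "\<Delta> \<in> borel_measurable borel"
proof -
  obtain E where [measurable]: "E \<in> sets borel" and E: "0 < emeasure \<mu> E" "emeasure \<mu> E < \<infinity>"
    by (rule positive_set_\<mu>)
  define m where "m t = (\<integral>\<^sup>+s. indicator E (s + t) \<partial>\<mu>)" for t :: 'g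
  have [measurable]: "m \<in> borel_measurable borel" unfolding m_def by measurable
  have "\<Delta> t = enn2real (emeasure \<mu> E) / enn2real (m t)" for t
  proof -
    have *: "ennreal (\<Delta> t) * m t = emeasure \<mu> E"
      unfolding m_def by (subst nn_integral_modular_right) auto
    then have "m t \<noteq> 0" "m t \<noteq> top"
      using E \<Delta>_pos[of t] by (auto simp: ennreal_mult_eq_top_iff)
    then have "enn2real (m t) \<noteq> 0" by (simp add: enn2real_eq_0_iff)
    moreover have "enn2real (emeasure \<mu> E) = \<Delta> t * enn2real (m t)"
      unfolding *[symmetric] using \<Delta>_pos[of t] by (simp add: enn2real_mult less_imp_le)
    ultimately show ?thesis by simp
  qed
  then have "\<Delta> = (\<lambda>t. enn2real (emeasure \<mu> E) / enn2real (m t))" by blast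
  then show ?thesis by simp
qed

text \<open>Translate E by s and t in one step and in two; the common factor \<open>m\<close> is
  neither 0 nor infinite and cancels.\<close>

lemma \<Delta>_add: "\<Delta> (s + t) = \<Delta> s * \<Delta> t"
proof -
  obtain E where [measurable]: "E \<in> sets borel" and E: "0 < emeasure \<mu> E" "emeasure \<mu> E < \<infinity>"
    by (rule positive_set_\<mu>)
  define m where "m = (\<integral>\<^sup>+r. indicator E (r + (s + t)) \<partial>\<mu>)"
  have 1: "ennreal (\<Delta> (s + t)) * m = emeasure \<mu> E"
    unfolding m_def by (subst nn_integral_modular_right) auto
  have "emeasure \<mu> E = ennreal (\<Delta> t) * (\<integral>\<^sup>+r. indicator E (r + t) \<partial>\<mu>)"
    by (subst nn_integral_modular_right) auto
  also have "(\<integral>\<^sup>+r. indicator E (r + t) \<partial>\<mu>) = ennreal (\<Delta> s) * (\<integral>\<^sup>+r. indicator E ((r + s) + t) \<partial>\<mu>)"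
    by (subst nn_integral_modular_right) auto
  also have "(\<integral>\<^sup>+r. indicator E ((r + s) + t) \<partial>\<mu>) = m" unfolding m_def add.assoc ..
  finally have 2: "ennreal (\<Delta> s * \<Delta> t) * m = emeasure \<mu> E"
    using \<Delta>_pos[of s] \<Delta>_pos[of t] by (simp add: ennreal_mult' mult_ac)
  have "m \<noteq> 0" "m \<noteq> top"
    using E 1 \<Delta>_pos[of "s + t"] by (auto simp: ennreal_mult_eq_top_iff)
  then have "ennreal (\<Delta> (s + t)) = ennreal (\<Delta> s * \<Delta> t)"
    using 1 2 by (metis ennreal_mult_cancel_left mult.commute)
  then show ?thesis using \<Delta>_pos[of s] \<Delta>_pos[of t] \<Delta>_pos[of "s + t"] by simp
qed

lemma \<Delta>_zero: "\<Delta> 0 = 1"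
  using \<Delta>_add[of 0 0] \<Delta>_pos[of 0] by simp

lemma \<Delta>_minus: "\<Delta> (- t) = 1 / \<Delta> t"
  using \<Delta>_add[of t "- t"] \<Delta>_pos[of t] \<Delta>_zero by (simp add: field_simps)

text \<open>
  Integrating against an auxiliary indicator \<open>k\<close> and applying Tonelli's theorem twice avoids the
  uniqueness theorem for Haar measures.
\<close>

lemma nn_integral_\<mu>_density:
  assumes [measurable]: "h \<in> borel_measurable borel"
  shows "(\<integral>\<^sup>+s. h s \<partial>\<mu>) = (\<integral>\<^sup>+s. ennreal (\<Delta> s) * h s \<partial>\<nu>)"
proof -
  obtain E where [measurable]: "E \<in> sets borel" and E: "0 < emeasure \<nu> E" "emeasure \<nu> E < \<infinity>"
    by (rule positive_set)
  define k where "k = (indicator E :: 'g \<Rightarrow> ennreal)"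
  have [measurable]: "k \<in> borel_measurable borel" by (simp add: k_def)
  have k: "(\<integral>\<^sup>+t. k t \<partial>\<nu>) = emeasure \<nu> E" by (simp add: k_def)
  have "emeasure \<nu> E * (\<integral>\<^sup>+s. h s \<partial>\<mu>) = (\<integral>\<^sup>+t. k t * (ennreal (\<Delta> t) * (\<integral>\<^sup>+s. h (s + t) \<partial>\<mu>)) \<partial>\<nu>)"
    by (simp add: k[symmetric] nn_integral_modular_right nn_integral_multc)
  also have "\<dots> = (\<integral>\<^sup>+t. (\<integral>\<^sup>+s. k t * (ennreal (\<Delta> t) * h (s + t)) \<partial>\<mu>) \<partial>\<nu>)"
    by (simp add: nn_integral_cmult)
  also have "\<dots> = (\<integral>\<^sup>+s. (\<integral>\<^sup>+t. k t * (ennreal (\<Delta> t) * h (s + t)) \<partial>\<nu>) \<partial>\<mu>)"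
    by (rule \<mu>\<nu>.Fubini') measurable
  also have "\<dots> = (\<integral>\<^sup>+s. (\<integral>\<^sup>+t. k (- s + t) * (ennreal (\<Delta> t) * h t) \<partial>\<nu>) \<partial>\<mu>)"
  proof (rule nn_integral_cong)
    fix s
    have "(\<integral>\<^sup>+t. k t * (ennreal (\<Delta> t) * h (s + t)) \<partial>\<nu>) =
        ennreal (\<Delta> s) * (\<integral>\<^sup>+t. k (- s + t) * (ennreal (\<Delta> (- s + t)) * h (s + (- s + t))) \<partial>\<nu>)"
      by (rule nn_integral_modular_left[symmetric]) measurable
    also have "\<dots> = (\<integral>\<^sup>+t. ennreal (\<Delta> s) * (k (- s + t) * (ennreal (\<Delta> (- s + t)) * h (s + (- s + t)))) \<partial>\<nu>)"
      by (rule nn_integral_cmult[symmetric]) measurable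
    also have "\<dots> = (\<integral>\<^sup>+t. k (- s + t) * (ennreal (\<Delta> t) * h t) \<partial>\<nu>)"
    proof (rule nn_integral_cong)
      fix t
      have "ennreal (\<Delta> s) * ennreal (\<Delta> (- s + t)) = ennreal (\<Delta> t)"
        using \<Delta>_pos[of s] \<Delta>_pos[of t] by (simp add: ennreal_mult'[symmetric] \<Delta>_add \<Delta>_minus)
      moreover have "s + (- s + t) = t" by (simp add: add.assoc[symmetric])
      ultimately show "ennreal (\<Delta> s) * (k (- s + t) * (ennreal (\<Delta> (- s + t)) * h (s + (- s + t))))
          = k (- s + t) * (ennreal (\<Delta> t) * h t)"
        by (metis (no_types, lifting) mult.assoc mult.left_commute)
    qed
    finally show "(\<integral>\<^sup>+t. k t * (ennreal (\<Delta> t) * h (s + t)) \<partial>\<nu>) =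
      (\<integral>\<^sup>+t. k (- s + t) * (ennreal (\<Delta> t) * h t) \<partial>\<nu>)" .
  qed
  also have "\<dots> = (\<integral>\<^sup>+t. (\<integral>\<^sup>+s. k (- s + t) * (ennreal (\<Delta> t) * h t) \<partial>\<mu>) \<partial>\<nu>)"
    by (rule \<mu>\<nu>.Fubini'[symmetric]) measurable
  also have "\<dots> = (\<integral>\<^sup>+t. emeasure \<nu> E * (ennreal (\<Delta> t) * h t) \<partial>\<nu>)"
  proof (rule nn_integral_cong)
    fix t
    have "(\<integral>\<^sup>+s. k (- s + t) \<partial>\<mu>) = (\<integral>\<^sup>+s. k (s + t) \<partial>\<nu>)" by (subst nn_integral_\<mu>) auto
    also have "\<dots> = emeasure \<nu> E" by (simp add: nn_integral_right_translate k)
    finally show "(\<integral>\<^sup>+s. k (- s + t) * (ennreal (\<Delta> t) * h t) \<partial>\<mu>) = emeasure \<nu> E * (ennreal (\<Delta> t) * h t)"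
      by (simp add: nn_integral_multc)
  qed
  also have "\<dots> = emeasure \<nu> E * (\<integral>\<^sup>+t. ennreal (\<Delta> t) * h t \<partial>\<nu>)"
    by (rule nn_integral_cmult) measurable
  finally show ?thesis
    using E by (auto simp: ennreal_mult_cancel_left)
qed

lemma \<mu>_eq_density: "\<mu> = density \<nu> (\<lambda>s. ennreal (\<Delta> s))"
proof (rule measure_eqI)
  fix A assume "A \<in> sets \<mu>"
  then have [measurable]: "A \<in> sets borel" by simp
  show "emeasure \<mu> A = emeasure (density \<nu> (\<lambda>s. ennreal (\<Delta> s))) A"
    using nn_integral_\<mu>_density[of "indicator A"] by (simp add: emeasure_density)
qed simp

text \<open>The right translates of a nonempty open set cover the group, and countably many of them
  suffice. If the set were null, the whole group would be null.\<close>

lemma emeasure_open_pos: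
  assumes U: "open U" "U \<noteq> {}"
  shows "0 < emeasure \<nu> U"
proof (rule ccontr)
  assume "\<not> ?thesis"
  then have 0: "emeasure \<nu> U = 0" by (simp add: zero_less_iff_neq_zero)
  define T where "T t = (\<lambda>s. s + t) -` U" for t
  have T: "open (T t)" for t
    unfolding T_def by (intro open_vimage U continuous_intros)
  have "emeasure \<nu> (T t) = 0" for t
  proof -
    have "emeasure \<nu> (T t) = emeasure (distr \<nu> borel (\<lambda>s. s + t)) U"
      using U by (subst emeasure_distr) (auto simp: T_def)
    then show ?thesis by (simp add: distr_right_translate 0)
  qed
  then have null: "T t \<in> null_sets \<nu>" for t using T by (auto simp: null_sets_def)
  obtain u where u: "u \<in> U" using U by blast
  have "s \<in> T (- s + u)" for s using u by (simp add: T_def add.assoc[symmetric])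
  then have cover: "\<Union>(range T) = UNIV" by blast
  obtain \<F> where \<F>: "\<F> \<subseteq> range T" "countable \<F>" "\<Union>\<F> = \<Union>(range T)"
    using Lindelof[of "range T"] T by blast
  have "\<Union>\<F> \<in> null_sets \<nu>"
    using null_sets_UN'[OF \<F>(2), of "\<lambda>x. x" \<nu>] null \<F>(1) by auto
  then show False using \<F>(3) cover right_haar by (auto simp: right_haar_measure_def null_sets_def)
qed

end

section \<open>Measurability in \<open>C\<^sub>0(X)\<close>\<close>

lemma norm_c0_le_dense:
  fixes f :: "'x::second_countable_topology c0"
  assumes D: "\<And>S. open S \<Longrightarrow> S \<noteq> {} \<Longrightarrow> \<exists>d\<in>D. d \<in> S"
  shows "norm f \<le> e \<longleftrightarrow> (\<forall>y\<in>D. norm (c0_apply f y) \<le> e)"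
proof
  assume *: "\<forall>y\<in>D. norm (c0_apply f y) \<le> e"
  show "norm f \<le> e"
  proof (rule norm_c0_bound, rule ccontr)
    fix y assume "\<not> norm (c0_apply f y) \<le> e"
    then have "{y. e < norm (c0_apply f y)} \<noteq> {}" by (auto simp: not_le)
    moreover have "open {y. e < norm (c0_apply f y)}"
      by (intro open_Collect_less continuous_intros)
    ultimately obtain d where "d \<in> D" "e < norm (c0_apply f d)" using D by blast
    then show False using * by (simp add: not_le[symmetric])
  qed
qed (use norm_c0_apply_le order_trans in blast)

text \<open>A closed ball of C_0(X) is cut out by conditions at a countable dense set of points, so
  its preimage is measurable; Lindelof reduces open sets to such balls. The convolution integrand,
  the involution and the cut kernels are handled this way, by evaluation at points.\<close>

lemma measurable_c0I:
  fixes F :: "'a \<Rightarrow> 'x::second_countable_topology c0"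
  assumes [measurable]: "\<And>y. (\<lambda>m. c0_apply (F m) y) \<in> borel_measurable M"
  shows "F \<in> borel_measurable M"
proof (rule borel_measurableI)
  fix S :: "'x c0 set" assume S: "open S"
  obtain D :: "'x set" where D: "countable D" "\<And>S. open S \<Longrightarrow> S \<noteq> {} \<Longrightarrow> \<exists>d\<in>D. d \<in> S"
    using countable_dense_exists by metis
  have cball: "{m \<in> space M. norm (F m - h) \<le> e} \<in> sets M" for h e
  proof -
    have [measurable]: "(\<lambda>m. c0_apply (F m) y - c0_apply h y) \<in> borel_measurable M" for y
      by (intro borel_measurable_diff assms borel_measurable_const)
    have "{m \<in> space M. norm (F m - h) \<le> e} =
        {m \<in> space M. \<forall>y\<in>D. norm (c0_apply (F m) y - c0_apply h y) \<le> e}"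
      using norm_c0_le_dense[of D "F m - h" e for m, OF D(2)] by simp
    also have "\<dots> \<in> sets M" by (intro sets.sets_Collect_countable_All' D(1)) measurable
    finally show ?thesis .
  qed
  \<comment> \<open>The open balls are what Lindelof needs, while measurability of preimages is
    known for the closed ones. Each \<open>C b\<close> below lies between the open ball b and
    S.\<close>
  define \<B> where "\<B> = {ball h e | h e. cball h e \<subseteq> S}"
  have cover: "\<Union>\<B> = S"
  proof
    show "\<Union>\<B> \<subseteq> S" unfolding \<B>_def using ball_subset_cball by blast
    show "S \<subseteq> \<Union>\<B>"
    proof
      fix h assume "h \<in> S"
      then obtain e where "e > 0" "cball h e \<subseteq> S" using S open_contains_cball by blast
      then show "h \<in> \<Union>\<B>" unfolding \<B>_def by (intro UnionI[of "ball h e"]) auto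
    qed
  qed
  obtain \<F> where \<F>: "\<F> \<subseteq> \<B>" "countable \<F>" "\<Union>\<F> = \<Union>\<B>"
    using Lindelof[of \<B>] unfolding \<B>_def by blast
  have "\<exists>C. b \<subseteq> C \<and> C \<subseteq> S \<and> F -` C \<inter> space M \<in> sets M" if b: "b \<in> \<F>" for b
  proof -
    obtain h e where he: "b = ball h e" "cball h e \<subseteq> S" using \<F>(1) b unfolding \<B>_def by blast
    have "F -` cball h e \<inter> space M = {m \<in> space M. norm (F m - h) \<le> e}"
      by (auto simp: dist_norm norm_minus_commute)
    then show ?thesis using he cball[of h e] ball_subset_cball by (intro exI[of _ "cball h e"]) auto
  qed
  then obtain C where C: "\<And>b. b \<in> \<F> \<Longrightarrow> b \<subseteq> C b \<and> C b \<subseteq> S \<and> F -` C b \<inter> space M \<in> sets M"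
    by metis
  have "S = (\<Union>b\<in>\<F>. C b)"
  proof
    show "(\<Union>b\<in>\<F>. C b) \<subseteq> S" using C by (intro UN_least) simp
    show "S \<subseteq> (\<Union>b\<in>\<F>. C b)"
    proof
      fix h assume "h \<in> S"
      then obtain b where "b \<in> \<F>" "h \<in> b" using \<F>(3) cover by (metis UnionE)
      then show "h \<in> (\<Union>b\<in>\<F>. C b)" using C by (intro UN_I[of b]) auto
    qed
  qed
  then have "F -` S \<inter> space M = (\<Union>b\<in>\<F>. F -` C b \<inter> space M)"
    by (simp add: vimage_UN)
  also have "\<dots> \<in> sets M" using C \<F>(2) by (intro sets.countable_UN') auto
  finally show "F -` S \<inter> space M \<in> sets M" .
qed

text \<open>Split f'(y') - f(y) into (f' - f)(y'), at most \<parallel>f' - f\<parallel>, and f(y') -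
  f(y), small by continuity of f.\<close>

lemma continuous_c0_apply_pair:
  "continuous_on UNIV (\<lambda>p :: 'x::topological_space c0 \<times> 'x. c0_apply (fst p) (snd p))"
  unfolding continuous_on_def
proof safe
  fix f :: "'x c0" and y :: 'x
  let ?F = "at (f, y) within UNIV"
  have lim: "(fst \<longlongrightarrow> f) ?F" "(snd \<longlongrightarrow> y) ?F"
    by (auto intro!: tendsto_eq_intros)
  have "((\<lambda>p. norm (fst p - f)) \<longlongrightarrow> norm (f - f)) ?F" by (intro tendsto_intros lim)
  then have "((\<lambda>p. norm (fst p - f)) \<longlongrightarrow> 0) ?F" by simp
  from Lim_null_comparison[OF _ this, of "\<lambda>p. c0_apply (fst p - f) (snd p)"]
  have "((\<lambda>p. c0_apply (fst p - f) (snd p)) \<longlongrightarrow> 0) ?F"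
    using norm_c0_apply_le[of "fst p - f" "snd p" for p] by simp
  moreover have "((\<lambda>p. c0_apply f (snd p)) \<longlongrightarrow> c0_apply f y) ?F"
    by (rule continuous_on_tendsto_compose[OF continuous_c0_apply[of UNIV f] lim(2)]) auto
  ultimately have "((\<lambda>p. c0_apply (fst p - f) (snd p) + c0_apply f (snd p)) \<longlongrightarrow> 0 + c0_apply f y) ?F"
    by (rule tendsto_add)
  then show "((\<lambda>p. c0_apply (fst p) (snd p)) \<longlongrightarrow> c0_apply (fst (f, y)) (snd (f, y))) ?F"
    by simp
qed

lemma measurable_c0_apply [measurable (raw)]:
  fixes F :: "'a \<Rightarrow> 'x::second_countable_topology c0"
  assumes [measurable]: "F \<in> borel_measurable M" "Y \<in> borel_measurable M"
  shows "(\<lambda>m. c0_apply (F m) (Y m)) \<in> borel_measurable M"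
  using borel_measurable_continuous_on[OF continuous_c0_apply_pair, of "\<lambda>m. (F m, Y m)" M] by simp

lemma bounded_linear_c0_apply: "bounded_linear (\<lambda>f. c0_apply f y)"
  by (rule bounded_linear_intro[of _ 1]) (use norm_c0_apply_le in auto)

section \<open>The integrated form\<close>

lemma ennreal_mult_le_power2_sum: "a * b \<le> a\<^sup>2 + (b::ennreal)\<^sup>2"
proof (cases "a \<le> b")
  case True
  then have "a * b \<le> b * b" by (rule mult_right_mono) simp
  then show ?thesis by (simp add: power2_eq_square add_increasing)
next
  case False
  then have "a * b \<le> a * a" by (intro mult_left_mono) auto
  then show ?thesis by (simp add: power2_eq_square add_increasing2)
qed

text \<open>Infinite values of h must be allowed because \<open>kern_bound\<close> is later
  iterated. When the last integral is finite, h is finite almost everywhere where w does not vanish,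
  and the real version applies.\<close>

lemma nn_integral_Cauchy_Schwarz_weighted_ennreal:
  fixes w :: "'a \<Rightarrow> real" and h :: "'a \<Rightarrow> ennreal"
  assumes [measurable]: "w \<in> borel_measurable M" "h \<in> borel_measurable M"
    and nonneg: "\<And>t. 0 \<le> w t" and w: "integrable M w"
  shows "(\<integral>\<^sup>+t. ennreal (w t) * h t \<partial>M)\<^sup>2 \<le>
    (\<integral>\<^sup>+t. ennreal (w t) \<partial>M) * (\<integral>\<^sup>+t. ennreal (w t) * (h t)\<^sup>2 \<partial>M)"
proof (cases "(\<integral>\<^sup>+t. ennreal (w t) * (h t)\<^sup>2 \<partial>M) < \<infinity>")
  case True
  have "AE t in M. ennreal (w t) * (h t)\<^sup>2 \<noteq> \<infinity>"
    using True by (intro nn_integral_PInf_AE) auto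
  then have fin: "AE t in M. w t = 0 \<or> h t = ennreal (enn2real (h t))"
  proof eventually_elim
    case (elim t)
    then show ?case using nonneg[of t]
      by (cases "h t") (auto simp: ennreal_mult_eq_top_iff power2_eq_square)
  qed
  have 1: "(\<integral>\<^sup>+t. ennreal (w t) * h t \<partial>M) = (\<integral>\<^sup>+t. ennreal (w t * enn2real (h t)) \<partial>M)"
    by (rule nn_integral_cong_AE, use fin in eventually_elim) (use nonneg in \<open>auto simp: ennreal_mult\<close>)
  have 2: "(\<integral>\<^sup>+t. ennreal (w t) * (h t)\<^sup>2 \<partial>M) = (\<integral>\<^sup>+t. ennreal (w t * (enn2real (h t))\<^sup>2) \<partial>M)"
  proof (rule nn_integral_cong_AE, use fin in eventually_elim)
    case (elim t)
    then show ?case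
    proof
      assume "h t = ennreal (enn2real (h t))"
      then have "(h t)\<^sup>2 = ennreal ((enn2real (h t))\<^sup>2)" by (metis ennreal_power enn2real_nonneg)
      then show ?thesis using nonneg by (simp add: ennreal_mult)
    qed simp
  qed
  show ?thesis
    unfolding 1 2 by (rule nn_integral_Cauchy_Schwarz_weighted) (use nonneg w in auto)
next
  case False
  then have top: "(\<integral>\<^sup>+t. ennreal (w t) * (h t)\<^sup>2 \<partial>M) = top" by (simp add: less_top[symmetric])
  show ?thesis
  proof (cases "(\<integral>\<^sup>+t. ennreal (w t) \<partial>M) = 0")
    case True
    then have "AE t in M. w t = 0"
      using nonneg by (subst (asm) nn_integral_0_iff_AE) (auto simp: order_antisym_conv)
    then have "(\<integral>\<^sup>+t. ennreal (w t) * h t \<partial>M) = 0"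
      by (subst nn_integral_0_iff_AE) auto
    then show ?thesis by simp
  next
    case False
    then show ?thesis unfolding top by (simp add: ennreal_mult_top)
  qed
qed

context haar_group begin

text \<open>Young's inequality for L^1 acting on L^2: Cauchy-Schwarz with weight w, then Tonelli.
  The square of sqrt (\<Delta> t) exactly compensates the left translation under \<nu>.\<close>

lemma nn_integral_convolution_bound:
  fixes w :: "'g \<Rightarrow> real" and e :: "'g \<Rightarrow> ennreal"
  assumes w: "integrable \<mu> w" "\<And>t. 0 \<le> w t" and [measurable]: "e \<in> borel_measurable borel"
  shows "(\<integral>\<^sup>+s. (\<integral>\<^sup>+t. ennreal (w t) * (ennreal (sqrt (\<Delta> t)) * e (- t + s)) \<partial>\<mu>)\<^sup>2 \<partial>\<nu>)
    \<le> (\<integral>\<^sup>+t. ennreal (w t) \<partial>\<mu>)\<^sup>2 * (\<integral>\<^sup>+s. (e s)\<^sup>2 \<partial>\<nu>)"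
proof -
  let ?W = "\<integral>\<^sup>+t. ennreal (w t) \<partial>\<mu>"
  have [measurable]: "w \<in> borel_measurable borel" using borel_measurable_integrable[OF w(1)] by simp
  have sq: "(ennreal (sqrt (\<Delta> t)))\<^sup>2 = ennreal (\<Delta> t)" for t
    using \<Delta>_pos[of t] by (simp add: ennreal_power)
  have "(\<integral>\<^sup>+s. (\<integral>\<^sup>+t. ennreal (w t) * (ennreal (sqrt (\<Delta> t)) * e (- t + s)) \<partial>\<mu>)\<^sup>2 \<partial>\<nu>)
      \<le> (\<integral>\<^sup>+s. ?W * (\<integral>\<^sup>+t. ennreal (w t) * (ennreal (sqrt (\<Delta> t)) * e (- t + s))\<^sup>2 \<partial>\<mu>) \<partial>\<nu>)"
    by (intro nn_integral_mono nn_integral_Cauchy_Schwarz_weighted_ennreal w) measurable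
  also have "\<dots> = ?W * (\<integral>\<^sup>+s. (\<integral>\<^sup>+t. ennreal (w t) * (ennreal (\<Delta> t) * (e (- t + s))\<^sup>2) \<partial>\<mu>) \<partial>\<nu>)"
    unfolding power_mult_distrib sq by (intro nn_integral_cmult) measurable
  also have "(\<integral>\<^sup>+s. (\<integral>\<^sup>+t. ennreal (w t) * (ennreal (\<Delta> t) * (e (- t + s))\<^sup>2) \<partial>\<mu>) \<partial>\<nu>)
      = (\<integral>\<^sup>+t. (\<integral>\<^sup>+s. ennreal (w t) * (ennreal (\<Delta> t) * (e (- t + s))\<^sup>2) \<partial>\<nu>) \<partial>\<mu>)"
    by (rule \<mu>\<nu>.Fubini') measurable
  also have "\<dots> = (\<integral>\<^sup>+t. ennreal (w t) * (\<integral>\<^sup>+s. (e s)\<^sup>2 \<partial>\<nu>) \<partial>\<mu>)"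
  proof (rule nn_integral_cong)
    fix t
    have "(\<integral>\<^sup>+s. ennreal (w t) * (ennreal (\<Delta> t) * (e (- t + s))\<^sup>2) \<partial>\<nu>) =
      ennreal (w t) * (ennreal (\<Delta> t) * (\<integral>\<^sup>+s. (e (- t + s))\<^sup>2 \<partial>\<nu>))"
      by (simp add: nn_integral_cmult)
    also have "ennreal (\<Delta> t) * (\<integral>\<^sup>+s. (e (- t + s))\<^sup>2 \<partial>\<nu>) = (\<integral>\<^sup>+s. (e s)\<^sup>2 \<partial>\<nu>)"
      by (rule nn_integral_modular_left) measurable
    finally show "(\<integral>\<^sup>+s. ennreal (w t) * (ennreal (\<Delta> t) * (e (- t + s))\<^sup>2) \<partial>\<nu>) =
      ennreal (w t) * (\<integral>\<^sup>+s. (e s)\<^sup>2 \<partial>\<nu>)" .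
  qed
  also have "\<dots> = ?W * (\<integral>\<^sup>+s. (e s)\<^sup>2 \<partial>\<nu>)" by (rule nn_integral_multc) measurable
  finally show ?thesis by (simp add: power2_eq_square mult.assoc)
qed

lemma L2_fun_measurable [measurable_dest]: "\<xi> \<in> L2_fun \<nu> \<Longrightarrow> \<xi> \<in> borel_measurable borel"
  using L2_funD(1)[of \<xi> \<nu>] by simp

lemma integral_\<mu>: 
  fixes f :: "'g \<Rightarrow> complex"
  assumes [measurable]: "f \<in> borel_measurable borel"
  shows "(\<integral>t. f t \<partial>\<mu>) = (\<integral>t. f (- t) \<partial>\<nu>)"
  unfolding left_haar_def by (simp add: integral_distr)

lemma integral_\<mu>_density: 
  fixes f :: "'g \<Rightarrow> complex"
  assumes [measurable]: "f \<in> borel_measurable borel"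
  shows "(\<integral>t. f t \<partial>\<mu>) = (\<integral>t. of_real (\<Delta> t) * f t \<partial>\<nu>)"
proof -
  have "AE s in \<nu>. 0 \<le> \<Delta> s" using \<Delta>_pos by (simp add: less_imp_le)
  from integral_density[OF _ _ this, of f] show ?thesis
    by (simp add: \<mu>_eq_density[symmetric] scaleR_conv_of_real)
qed

lemma integral_left_translate: 
  fixes f :: "'g \<Rightarrow> complex"
  assumes [measurable]: "f \<in> borel_measurable borel"
  shows "(\<integral>s. f (t + s) \<partial>\<mu>) = (\<integral>s. f s \<partial>\<mu>)"
proof -
  have "(\<integral>s. f s \<partial>\<mu>) = (\<integral>s. f s \<partial>distr \<mu> borel (\<lambda>s. t + s))" by (simp add: distr_left_translate)
  then show ?thesis by (simp add: integral_distr)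
qed

end

locale induced_rep = haar_group \<nu> \<Delta>
  for \<nu> :: "'g::{topological_group_add,t2_space,second_countable_topology} measure"
    and \<Delta> :: "'g \<Rightarrow> real" +
  fixes act :: "'g \<Rightarrow> 'x::{t2_space,second_countable_topology} \<Rightarrow> 'x" and x :: 'x
  assumes transformation_group: "transformation_group act"
begin

lemma act_add: "act (s + t) y = act s (act t y)"
  using transformation_group by (simp add: transformation_group_def)

lemma measurable_act [measurable (raw)]:
  assumes [measurable]: "S \<in> borel_measurable M" "Y \<in> borel_measurable M"
  shows "(\<lambda>m. act (S m) (Y m)) \<in> borel_measurable M"
proof -
  have "continuous_on UNIV (\<lambda>(s, y). act s y)"
    using transformation_group by (simp add: transformation_group_def)
  from borel_measurable_continuous_on[OF this, of "\<lambda>m. (S m, Y m)" M] show ?thesis by simp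
qed

lemma integrable_\<mu>_measurable [measurable_dest]:
  "integrable \<mu> (f :: 'g \<Rightarrow> 'x c0) \<Longrightarrow> f \<in> borel_measurable borel"
  using borel_measurable_integrable[of \<mu> f] by simp

definition kern :: "('g \<Rightarrow> 'x c0) \<Rightarrow> ('g \<Rightarrow> complex) \<Rightarrow> 'g \<Rightarrow> 'g \<Rightarrow> complex" where
  "kern f \<xi> s t = c0_apply (f t) (act s x) * (of_real (sqrt (\<Delta> t)) * \<xi> (- t + s))"

text \<open>A pointwise version of the weak integral in \<open>integrated_form\<close>, giving a
  function instead of a class. Where the integrand is not integrable the Bochner integral is 0; for
  integrable f and square-integrable \<xi> this happens only on a null set.\<close>

definition ind_op :: "('g \<Rightarrow> 'x c0) \<Rightarrow> ('g \<Rightarrow> complex) \<Rightarrow> 'g \<Rightarrow> complex" where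
  "ind_op f \<xi> s = (\<integral>t. kern f \<xi> s t \<partial>\<mu>)"

text \<open>A majorant with values in the extended reals. It makes sense before any integrability is
  known and can be composed with itself, as Fubini's theorem for products requires.\<close>

definition kern_bound :: "('g \<Rightarrow> 'x c0) \<Rightarrow> ('g \<Rightarrow> ennreal) \<Rightarrow> 'g \<Rightarrow> ennreal" where
  "kern_bound f e s = (\<integral>\<^sup>+t. ennreal (norm (f t)) * (ennreal (sqrt (\<Delta> t)) * e (- t + s)) \<partial>\<mu>)"

lemma measurable_kern' [measurable (raw)]:
  assumes [measurable]: "f \<in> borel_measurable borel" "\<xi> \<in> borel_measurable borel"
    "S \<in> borel_measurable M" "T \<in> borel_measurable M"
  shows "(\<lambda>m. kern f \<xi> (S m) (T m)) \<in> borel_measurable M"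
  unfolding kern_def by measurable

lemma measurable_kern_bound [measurable]:
  assumes [measurable]: "f \<in> borel_measurable borel" "e \<in> borel_measurable borel"
  shows "kern_bound f e \<in> borel_measurable borel"
  unfolding kern_bound_def by measurable

lemma measurable_ind_op [measurable]:
  assumes [measurable]: "f \<in> borel_measurable borel" "\<xi> \<in> borel_measurable borel"
  shows "ind_op f \<xi> \<in> borel_measurable borel"
  unfolding ind_op_def by measurable

lemma norm_kern_le:
  "ennreal (norm (kern f \<xi> s t)) \<le> ennreal (norm (f t)) * (ennreal (sqrt (\<Delta> t)) * ennreal (cmod (\<xi> (- t + s))))"
proof -
  have "norm (kern f \<xi> s t) \<le> norm (f t) * (sqrt (\<Delta> t) * cmod (\<xi> (- t + s)))"
    using \<Delta>_pos[of t] by (auto simp: kern_def norm_mult intro!: mult_right_mono norm_c0_apply_le)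
  then show ?thesis using \<Delta>_pos[of t] by (simp add: ennreal_mult[symmetric] ennreal_leI less_imp_le)
qed

lemma nn_integral_kern_le:
  "(\<integral>\<^sup>+t. ennreal (norm (kern f \<xi> s t)) \<partial>\<mu>) \<le> kern_bound f (\<lambda>s. ennreal (cmod (\<xi> s))) s"
  unfolding kern_bound_def by (intro nn_integral_mono norm_kern_le)

lemma kern_bound_L2:
  assumes "integrable \<mu> f" and [measurable]: "e \<in> borel_measurable borel"
  shows "(\<integral>\<^sup>+s. (kern_bound f e s)\<^sup>2 \<partial>\<nu>) \<le> (\<integral>\<^sup>+t. ennreal (norm (f t)) \<partial>\<mu>)\<^sup>2 * (\<integral>\<^sup>+s. (e s)\<^sup>2 \<partial>\<nu>)"
  unfolding kern_bound_def using assms by (intro nn_integral_convolution_bound) auto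

lemma kern_bound_L2_finite:
  assumes "integrable \<mu> f" and [measurable]: "e \<in> borel_measurable borel"
    and "(\<integral>\<^sup>+s. (e s)\<^sup>2 \<partial>\<nu>) < \<infinity>"
  shows "(\<integral>\<^sup>+s. (kern_bound f e s)\<^sup>2 \<partial>\<nu>) < \<infinity>"
proof (rule le_less_trans[OF kern_bound_L2])
  have "(\<integral>\<^sup>+t. ennreal (norm (f t)) \<partial>\<mu>) < \<infinity>" using assms(1) by (simp add: integrable_iff_bounded)
  then show "(\<integral>\<^sup>+t. ennreal (norm (f t)) \<partial>\<mu>)\<^sup>2 * (\<integral>\<^sup>+s. (e s)\<^sup>2 \<partial>\<nu>) < \<infinity>"
    using assms(3) by (simp add: ennreal_mult_less_top power2_eq_square)
qed (use assms in auto)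

lemma AE_finite_if_L2:
  assumes [measurable]: "e \<in> borel_measurable borel" and "(\<integral>\<^sup>+s. (e s)\<^sup>2 \<partial>\<nu>) < \<infinity>"
  shows "AE s in \<nu>. e s < \<infinity>"
proof -
  have "AE s in \<nu>. (e s)\<^sup>2 \<noteq> \<infinity>" using assms by (intro nn_integral_PInf_AE) auto
  then show ?thesis by eventually_elim (auto simp: power2_eq_square less_top[symmetric])
qed

lemma L2_fun_nn_finite: "\<xi> \<in> L2_fun \<nu> \<Longrightarrow> (\<integral>\<^sup>+s. (ennreal (cmod (\<xi> s)))\<^sup>2 \<partial>\<nu>) < \<infinity>"
  using L2_fun_iff_nn_integral[of \<xi> \<nu>] by (auto simp: ennreal_power dest: L2_funD)

lemma AE_kern_integrable:
  assumes f: "integrable \<mu> f" and \<xi>: "\<xi> \<in> L2_fun \<nu>"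
  shows "AE s in \<nu>. integrable \<mu> (kern f \<xi> s)"
proof -
  note [measurable] = integrable_\<mu>_measurable[OF f] L2_fun_measurable[OF \<xi>]
  have "AE s in \<nu>. kern_bound f (\<lambda>s. ennreal (cmod (\<xi> s))) s < \<infinity>"
    by (intro AE_finite_if_L2 kern_bound_L2_finite f L2_fun_nn_finite \<xi>) measurable
  then show ?thesis
  proof eventually_elim
    case (elim s)
    have "kern f \<xi> s \<in> borel_measurable borel" by measurable
    then show ?case using le_less_trans[OF nn_integral_kern_le elim] by (simp add: integrable_iff_bounded)
  qed
qed

lemma norm_ind_op_le: "ennreal (cmod (ind_op f \<xi> s)) \<le> kern_bound f (\<lambda>s. ennreal (cmod (\<xi> s))) s"
proof (cases "integrable \<mu> (kern f \<xi> s)")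
  case True
  then show ?thesis
    unfolding ind_op_def using integral_norm_bound_ennreal nn_integral_kern_le order_trans by blast
next
  case False
  \<comment> \<open>The default value 0 of the Bochner integral makes the bound true at every point,
    not just almost everywhere.\<close>
  then show ?thesis by (simp add: ind_op_def not_integrable_integral_eq)
qed

lemma
  assumes f: "integrable \<mu> f" and \<xi>: "\<xi> \<in> L2_fun \<nu>"
  shows ind_op_L2: "ind_op f \<xi> \<in> L2_fun \<nu>"
    and L2_norm_ind_op_le: "L2_norm \<nu> (ind_op f \<xi>) \<le> (\<integral>t. norm (f t) \<partial>\<mu>) * L2_norm \<nu> \<xi>"
proof -
  note [measurable] = integrable_\<mu>_measurable[OF f] L2_fun_measurable[OF \<xi>]
  have "(\<integral>\<^sup>+s. ennreal ((cmod (ind_op f \<xi> s))\<^sup>2) \<partial>\<nu>)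
      \<le> (\<integral>\<^sup>+s. (kern_bound f (\<lambda>s. ennreal (cmod (\<xi> s))) s)\<^sup>2 \<partial>\<nu>)"
    by (intro nn_integral_mono) (simp add: ennreal_power[symmetric] norm_ind_op_le power_mono)
  also have "\<dots> \<le> (\<integral>\<^sup>+t. ennreal (norm (f t)) \<partial>\<mu>)\<^sup>2 * (\<integral>\<^sup>+s. (ennreal (cmod (\<xi> s)))\<^sup>2 \<partial>\<nu>)"
    by (intro kern_bound_L2 f) measurable
  also have "(\<integral>\<^sup>+t. ennreal (norm (f t)) \<partial>\<mu>) = ennreal (\<integral>t. norm (f t) \<partial>\<mu>)"
    using f by (intro nn_integral_eq_integral) auto
  also have "(\<integral>\<^sup>+s. (ennreal (cmod (\<xi> s)))\<^sup>2 \<partial>\<nu>) = ennreal ((L2_norm \<nu> \<xi>)\<^sup>2)"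
    by (simp add: L2_norm_eq_nn_integral[OF \<xi>] ennreal_power)
  also have "(ennreal (\<integral>t. norm (f t) \<partial>\<mu>))\<^sup>2 * ennreal ((L2_norm \<nu> \<xi>)\<^sup>2) =
      ennreal (((\<integral>t. norm (f t) \<partial>\<mu>) * L2_norm \<nu> \<xi>)\<^sup>2)"
    by (simp add: ennreal_power ennreal_mult'[symmetric] power_mult_distrib)
  finally have *: "(\<integral>\<^sup>+s. ennreal ((cmod (ind_op f \<xi> s))\<^sup>2) \<partial>\<nu>) \<le> \<dots>" .
  have meas: "ind_op f \<xi> \<in> borel_measurable \<nu>" by measurable
  from L2_fun_boundI[OF meas *]
  show "ind_op f \<xi> \<in> L2_fun \<nu>" "L2_norm \<nu> (ind_op f \<xi>) \<le> (\<integral>t. norm (f t) \<partial>\<mu>) * L2_norm \<nu> \<xi>"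
    by auto
qed

text \<open>Fubini's theorem connects the pointwise integral with the weak one. Absolute
  integrability holds because the product of \<open>kern_bound\<close> and |\<zeta>| is at most the
  sum of their squares, both of finite integral.\<close>

lemma ind_op_inner:
  assumes f: "integrable \<mu> f" and \<xi>: "\<xi> \<in> L2_fun \<nu>" and \<zeta>: "\<zeta> \<in> L2_fun \<nu>"
  shows "L2_fun_inner \<nu> (ind_op f \<xi>) \<zeta> = (\<integral>t. \<integral>s. kern f \<xi> s t * cnj (\<zeta> s) \<partial>\<nu> \<partial>\<mu>)"
proof -
  note [measurable] = integrable_\<mu>_measurable[OF f] L2_fun_measurable[OF \<xi>] L2_fun_measurable[OF L2_fun_cnj[OF \<zeta>]]
  let ?e = "\<lambda>s. ennreal (cmod (\<xi> s))" and ?z = "\<lambda>s. ennreal (cmod (\<zeta> s))"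
  have [measurable]: "?z \<in> borel_measurable borel"
    using L2_fun_measurable[OF \<zeta>] by measurable
  have "(\<integral>\<^sup>+s. \<integral>\<^sup>+t. ennreal (norm (kern f \<xi> s t * cnj (\<zeta> s))) \<partial>\<mu> \<partial>\<nu>)
      \<le> (\<integral>\<^sup>+s. kern_bound f ?e s * ?z s \<partial>\<nu>)"
  proof (rule nn_integral_mono)
    fix s
    have "(\<integral>\<^sup>+t. ennreal (norm (kern f \<xi> s t * cnj (\<zeta> s))) \<partial>\<mu>) =
        (\<integral>\<^sup>+t. ennreal (norm (kern f \<xi> s t)) * ?z s \<partial>\<mu>)"
      by (simp add: norm_mult ennreal_mult)
    also have "\<dots> = (\<integral>\<^sup>+t. ennreal (norm (kern f \<xi> s t)) \<partial>\<mu>) * ?z s"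
      by (intro nn_integral_multc) measurable
    also have "\<dots> \<le> kern_bound f ?e s * ?z s" by (intro mult_right_mono nn_integral_kern_le) simp
    finally show "(\<integral>\<^sup>+t. ennreal (norm (kern f \<xi> s t * cnj (\<zeta> s))) \<partial>\<mu>) \<le> kern_bound f ?e s * ?z s" .
  qed
  also have "\<dots> \<le> (\<integral>\<^sup>+s. (kern_bound f ?e s)\<^sup>2 + (?z s)\<^sup>2 \<partial>\<nu>)"
    by (intro nn_integral_mono ennreal_mult_le_power2_sum)
  also have "\<dots> = (\<integral>\<^sup>+s. (kern_bound f ?e s)\<^sup>2 \<partial>\<nu>) + (\<integral>\<^sup>+s. (?z s)\<^sup>2 \<partial>\<nu>)"
    by (intro nn_integral_add) measurable
  also have "\<dots> < \<infinity>"
    using kern_bound_L2_finite[OF f _ L2_fun_nn_finite[OF \<xi>]] L2_fun_nn_finite[OF \<zeta>]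
    by (simp add: ennreal_add_less_top)
  finally have "integrable (\<nu> \<Otimes>\<^sub>M \<mu>) (\<lambda>(s, t). kern f \<xi> s t * cnj (\<zeta> s))"
    by (intro \<nu>\<mu>.Fubini_integrableI) measurable
  from \<nu>\<mu>.Fubini_integral[OF this] show ?thesis
    by (simp add: L2_fun_inner_def ind_op_def)
qed

end

lemma measurable_cnj [measurable (raw)]:
  assumes "f \<in> borel_measurable M" shows "(\<lambda>m. cnj (f m)) \<in> borel_measurable M"
  using borel_measurable_continuous_on[OF continuous_on_cnj[OF continuous_on_id] assms] .

lemma norm_c0_scale_le: "norm (c0_scale c f) \<le> cmod c * norm f"
  by (rule norm_c0_bound) (simp add: norm_mult mult_left_mono norm_c0_apply_le)

lemma norm_c0_mult_le: "norm (c0_mult f g) \<le> norm f * norm g"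
  by (rule norm_c0_bound) (simp add: norm_mult mult_mono norm_c0_apply_le)

lemma integrable_c0_scale:
  fixes f :: "'a \<Rightarrow> 'x::second_countable_topology c0"
  assumes "integrable M f" shows "integrable M (\<lambda>s. c0_scale c (f s))"
proof (rule Bochner_Integration.integrable_bound)
  show "integrable M (\<lambda>s. cmod c * norm (f s))" using assms by simp
  have [measurable]: "f \<in> borel_measurable M" using assms by simp
  show "(\<lambda>s. c0_scale c (f s)) \<in> borel_measurable M"
    by (rule measurable_c0I) simp
qed (simp add: norm_c0_scale_le)

section \<open>The operations of L^1(G, C_0(X)) and their effect under the integrated form\<close>

context induced_rep begin

abbreviation L1 :: "('g \<Rightarrow> 'x c0) star_alg" where
  "L1 \<equiv> L1_algebra act \<mu> \<Delta>"

definition conv :: "('g \<Rightarrow> 'x c0) \<Rightarrow> ('g \<Rightarrow> 'x c0) \<Rightarrow> 'g \<Rightarrow> 'x c0" where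
  "conv f g s = (\<integral>t. c0_mult (f t) (lt act t (g (- t + s))) \<partial>\<mu>)"

definition invol :: "('g \<Rightarrow> 'x c0) \<Rightarrow> 'g \<Rightarrow> 'x c0" where
  "invol f s = \<Delta> (- s) *\<^sub>R lt act s (c0_cnj (f (- s)))"

lemma L1_simps:
  "elts L1 = {f. integrable \<mu> f}" "sa_add L1 f g = (\<lambda>s. f s + g s)"
  "sa_scale L1 c f = (\<lambda>s. c0_scale c (f s))" "sa_mult L1 f g = conv f g"
  "sa_star L1 f = invol f" "sa_norm L1 f = (\<integral>s. norm (f s) \<partial>\<mu>)"
  by (simp_all add: L1_algebra_def conv_def[abs_def] invol_def[abs_def])

lemma c0_apply_lt' [simp]: "c0_apply (lt act s f) y = c0_apply f (act (- s) y)"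
  by (rule c0_apply_lt[OF transformation_group])

lemma norm_lt_le: "norm (lt act s f) \<le> norm f"
  by (rule norm_c0_bound) (simp add: norm_c0_apply_le)

lemma kern_add: "kern (\<lambda>s. f s + g s) \<xi> s t = kern f \<xi> s t + kern g \<xi> s t"
  by (simp add: kern_def distrib_right)

lemma kern_scale: "kern (\<lambda>s. c0_scale c (f s)) \<xi> s t = c * kern f \<xi> s t"
  by (simp add: kern_def mult_ac)

lemma ind_op_add:
  assumes "integrable \<mu> f" "integrable \<mu> g" "\<xi> \<in> L2_fun \<nu>"
  shows "AE s in \<nu>. ind_op (\<lambda>s. f s + g s) \<xi> s = ind_op f \<xi> s + ind_op g \<xi> s"
  using AE_kern_integrable[OF assms(1,3)] AE_kern_integrable[OF assms(2,3)]
  by eventually_elim (simp add: ind_op_def kern_add)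

lemma ind_op_scale: "ind_op (\<lambda>s. c0_scale c (f s)) \<xi> s = c * ind_op f \<xi> s"
  by (simp add: ind_op_def kern_scale)

lemma ind_op_scale_vector: "ind_op f (\<lambda>s. c * \<xi> s) s = c * ind_op f \<xi> s"
proof -
  have "kern f (\<lambda>s. c * \<xi> s) s = (\<lambda>t. c * kern f \<xi> s t)" by (simp add: kern_def fun_eq_iff mult_ac)
  then show ?thesis by (simp add: ind_op_def)
qed

lemma ind_op_diff_vector:
  assumes "integrable \<mu> f" "\<xi> \<in> L2_fun \<nu>" "\<zeta> \<in> L2_fun \<nu>"
  shows "AE s in \<nu>. ind_op f (\<lambda>s. \<xi> s - \<zeta> s) s = ind_op f \<xi> s - ind_op f \<zeta> s"
proof -
  have "kern f (\<lambda>s. \<xi> s - \<zeta> s) s = (\<lambda>t. kern f \<xi> s t - kern f \<zeta> s t)" for s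
    by (simp add: kern_def fun_eq_iff algebra_simps)
  then show ?thesis
    using AE_kern_integrable[OF assms(1,2)] AE_kern_integrable[OF assms(1,3)]
    by (auto simp: ind_op_def)
qed

text \<open>The difference of the vectors has norm 0, so boundedness of the operator settles the
  claim without following null sets through the translations in \<open>kern\<close>.\<close>

lemma ind_op_cong_AE:
  assumes f: "integrable \<mu> f" and \<xi>: "\<xi> \<in> L2_fun \<nu>" and \<zeta>: "\<zeta> \<in> L2_fun \<nu>"
    and ae: "AE s in \<nu>. \<xi> s = \<zeta> s"
  shows "AE s in \<nu>. ind_op f \<xi> s = ind_op f \<zeta> s"
proof -
  have d: "(\<lambda>s. \<xi> s - \<zeta> s) \<in> L2_fun \<nu>" by (rule L2_fun_diff[OF \<xi> \<zeta>])
  have "L2_norm \<nu> (\<lambda>s. \<xi> s - \<zeta> s) = 0" unfolding L2_norm_eq_0_iff[OF d] using ae by simp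
  then have "L2_norm \<nu> (ind_op f (\<lambda>s. \<xi> s - \<zeta> s)) = 0"
    using L2_norm_ind_op_le[OF f d] L2_norm_nonneg[of \<nu> "ind_op f (\<lambda>s. \<xi> s - \<zeta> s)"] by simp
  then have "AE s in \<nu>. ind_op f (\<lambda>s. \<xi> s - \<zeta> s) s = 0"
    unfolding L2_norm_eq_0_iff[OF ind_op_L2[OF f d]] .
  then show ?thesis using ind_op_diff_vector[OF f \<xi> \<zeta>] by eventually_elim simp
qed

section \<open>Products and adjoints\<close>

lemma measurable_conv_integrand:
  assumes [measurable]: "f \<in> borel_measurable borel" "g \<in> borel_measurable borel"
  shows "(\<lambda>(s, t). c0_mult (f t) (lt act t (g (- t + s)))) \<in> borel_measurable (borel \<Otimes>\<^sub>M borel)"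
proof (rule measurable_c0I)
  fix y
  show "(\<lambda>m. c0_apply (case m of (s, t) \<Rightarrow> c0_mult (f t) (lt act t (g (- t + s)))) y) \<in> borel_measurable (borel \<Otimes>\<^sub>M borel)"
    unfolding split_beta c0_apply_mult c0_apply_lt' by measurable
qed

lemma norm_conv_integrand_le:
  "norm (c0_mult (f t) (lt act t (g (- t + s)))) \<le> norm (f t) * norm (g (- t + s))"
  using norm_c0_mult_le[of "f t" "lt act t (g (- t + s))"] norm_lt_le[of t "g (- t + s)"]
  by (meson mult_left_mono norm_ge_zero order_trans)

lemma nn_integral_conv:
  fixes f g :: "'g \<Rightarrow> 'x c0"
  assumes f: "integrable \<mu> f" and g: "integrable \<mu> g"
  shows "(\<integral>\<^sup>+s. \<integral>\<^sup>+t. ennreal (norm (f t)) * ennreal (norm (g (- t + s))) \<partial>\<mu> \<partial>\<mu>) =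
    (\<integral>\<^sup>+t. ennreal (norm (f t)) \<partial>\<mu>) * (\<integral>\<^sup>+t. ennreal (norm (g t)) \<partial>\<mu>)"
proof -
  note [measurable] = integrable_\<mu>_measurable[OF f] integrable_\<mu>_measurable[OF g]
  have "(\<integral>\<^sup>+s. \<integral>\<^sup>+t. ennreal (norm (f t)) * ennreal (norm (g (- t + s))) \<partial>\<mu> \<partial>\<mu>) =
      (\<integral>\<^sup>+t. \<integral>\<^sup>+s. ennreal (norm (f t)) * ennreal (norm (g (- t + s))) \<partial>\<mu> \<partial>\<mu>)"
    by (rule \<mu>\<mu>.Fubini') measurable
  also have "\<dots> = (\<integral>\<^sup>+t. ennreal (norm (f t)) * (\<integral>\<^sup>+s. ennreal (norm (g s)) \<partial>\<mu>) \<partial>\<mu>)"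
  proof (rule nn_integral_cong)
    fix t
    have "(\<integral>\<^sup>+s. ennreal (norm (g (- t + s))) \<partial>\<mu>) = (\<integral>\<^sup>+s. ennreal (norm (g s)) \<partial>\<mu>)"
      by (rule nn_integral_left_translate) measurable
    then show "(\<integral>\<^sup>+s. ennreal (norm (f t)) * ennreal (norm (g (- t + s))) \<partial>\<mu>) =
      ennreal (norm (f t)) * (\<integral>\<^sup>+s. ennreal (norm (g s)) \<partial>\<mu>)"
      by (simp add: nn_integral_cmult)
  qed
  also have "\<dots> = (\<integral>\<^sup>+t. ennreal (norm (f t)) \<partial>\<mu>) * (\<integral>\<^sup>+t. ennreal (norm (g t)) \<partial>\<mu>)"
    by (rule nn_integral_multc) measurable
  finally show ?thesis .
qed

text \<open>Both parts come from joint integrability of the integrand, whose norm has integral at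
  most \<parallel>f\<parallel>_1 \<parallel>g\<parallel>_1. The first part is needed separately:
  evaluation at a point is moved through the integral in \<open>conv\<close> only at such s.\<close>

lemma
  assumes f: "integrable \<mu> f" and g: "integrable \<mu> g"
  shows AE_conv_integrable: "AE s in \<mu>. integrable \<mu> (\<lambda>t. c0_mult (f t) (lt act t (g (- t + s))))"
    and conv_integrable: "integrable \<mu> (conv f g)"
proof -
  note [measurable] = integrable_\<mu>_measurable[OF f] integrable_\<mu>_measurable[OF g]
  let ?c = "\<lambda>s t. c0_mult (f t) (lt act t (g (- t + s)))"
  have m: "case_prod ?c \<in> borel_measurable (\<mu> \<Otimes>\<^sub>M \<mu>)"
    using measurable_conv_integrand[of f g] by measurable
  have "(\<integral>\<^sup>+s. \<integral>\<^sup>+t. ennreal (norm (?c s t)) \<partial>\<mu> \<partial>\<mu>) \<le>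
      (\<integral>\<^sup>+s. \<integral>\<^sup>+t. ennreal (norm (f t)) * ennreal (norm (g (- t + s))) \<partial>\<mu> \<partial>\<mu>)"
    by (intro nn_integral_mono) (simp add: ennreal_mult[symmetric] norm_conv_integrand_le ennreal_leI)
  also have "\<dots> < \<infinity>"
    unfolding nn_integral_conv[OF f g] using f g by (simp add: integrable_iff_bounded ennreal_mult_less_top)
  finally have *: "integrable (\<mu> \<Otimes>\<^sub>M \<mu>) (case_prod ?c)"
    by (intro \<mu>\<mu>.Fubini_integrableI m)
  from \<mu>\<mu>.AE_integrable_fst[OF *] show "AE s in \<mu>. integrable \<mu> (?c s)" .
  from \<mu>\<mu>.integrable_fst[OF *] show "integrable \<mu> (conv f g)"
    unfolding conv_def[abs_def] .
qed

text \<open>Covariance of the pair, in integrated form. The two sides are the two iterated integrals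
  of one function of s and t. Fubini applies at every r where the iterated majorant
  \<open>kern_bound f (kern_bound g _)\<close> is finite, hence almost everywhere.\<close>

lemma ind_op_conv:
  assumes f: "integrable \<mu> f" and g: "integrable \<mu> g" and \<xi>: "\<xi> \<in> L2_fun \<nu>"
  shows "AE r in \<nu>. ind_op (conv f g) \<xi> r = ind_op f (ind_op g \<xi>) r"
proof -
  note [measurable] = integrable_\<mu>_measurable[OF f] integrable_\<mu>_measurable[OF g] L2_fun_measurable[OF \<xi>]
  let ?e = "\<lambda>s. ennreal (cmod (\<xi> s))"
  have fin: "AE r in \<nu>. kern_bound f (kern_bound g ?e) r < \<infinity>"
    by (intro AE_finite_if_L2 kern_bound_L2_finite f g L2_fun_nn_finite \<xi>) measurable
  \<comment> \<open>Integrating F over t gives the kernel of the convolution. After the substitution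
    s \<mapsto> t + s it splits into a factor depending on t and the kernel of g at - t + r, by the
    cocycle rules for \<open>act\<close> and \<Delta>.\<close>
  define F where "F r s t = c0_apply (f t) (act r x) *
    (c0_apply (g (- t + s)) (act (- t) (act r x)) * (of_real (sqrt (\<Delta> s)) * \<xi> (- s + r)))" for r s t
  have F_translate: "F r (t + s) t =
      (c0_apply (f t) (act r x) * of_real (sqrt (\<Delta> t))) * kern g \<xi> (- t + r) s" for r s t
  proof -
    have "- t + (t + s) = s" by (simp add: add.assoc[symmetric])
    moreover have "- (t + s) + r = - s + (- t + r)" by (simp only: minus_add add.assoc)
    ultimately show ?thesis
      by (simp add: F_def kern_def act_add \<Delta>_add real_sqrt_mult mult_ac)
  qed
  have [measurable]: "(\<lambda>(s, t). F r s t) \<in> borel_measurable (borel \<Otimes>\<^sub>M borel)" for r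
    unfolding F_def by measurable
  have "AE r in \<nu>. (\<integral>t. \<integral>s. F r s t \<partial>\<mu> \<partial>\<mu>) = (\<integral>s. \<integral>t. F r s t \<partial>\<mu> \<partial>\<mu>)"
    using fin
  proof eventually_elim
    case (elim r)
    have "(\<integral>\<^sup>+s. \<integral>\<^sup>+t. ennreal (norm (F r s t)) \<partial>\<mu> \<partial>\<mu>) = (\<integral>\<^sup>+t. \<integral>\<^sup>+s. ennreal (norm (F r s t)) \<partial>\<mu> \<partial>\<mu>)"
      by (rule \<mu>\<mu>.Fubini') measurable
    also have "\<dots> \<le> (\<integral>\<^sup>+t. ennreal (norm (f t)) * (ennreal (sqrt (\<Delta> t)) * kern_bound g ?e (- t + r)) \<partial>\<mu>)"
    proof (rule nn_integral_mono)
      fix t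
      have "(\<integral>\<^sup>+s. ennreal (norm (F r s t)) \<partial>\<mu>) = (\<integral>\<^sup>+s. ennreal (norm (F r (t + s) t)) \<partial>\<mu>)"
        by (rule nn_integral_left_translate[symmetric]) measurable
      also have "\<dots> \<le> (\<integral>\<^sup>+s. ennreal (norm (f t)) * ennreal (sqrt (\<Delta> t)) * ennreal (norm (kern g \<xi> (- t + r) s)) \<partial>\<mu>)"
      proof (rule nn_integral_mono)
        fix s
        have "norm (F r (t + s) t) \<le> norm (f t) * sqrt (\<Delta> t) * norm (kern g \<xi> (- t + r) s)"
          unfolding F_translate norm_mult using \<Delta>_pos[of t]
          by (intro mult_right_mono) (auto intro: norm_c0_apply_le)
        then show "ennreal (norm (F r (t + s) t)) \<le> ennreal (norm (f t)) * ennreal (sqrt (\<Delta> t)) * ennreal (norm (kern g \<xi> (- t + r) s))"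
          using \<Delta>_pos[of t] by (simp add: ennreal_mult[symmetric] ennreal_leI less_imp_le)
      qed
      also have "\<dots> = ennreal (norm (f t)) * ennreal (sqrt (\<Delta> t)) * (\<integral>\<^sup>+s. ennreal (norm (kern g \<xi> (- t + r) s)) \<partial>\<mu>)"
        by (rule nn_integral_cmult) measurable
      also have "\<dots> \<le> ennreal (norm (f t)) * ennreal (sqrt (\<Delta> t)) * kern_bound g ?e (- t + r)"
        by (intro mult_left_mono nn_integral_kern_le) simp
      finally show "(\<integral>\<^sup>+s. ennreal (norm (F r s t)) \<partial>\<mu>) \<le> ennreal (norm (f t)) * (ennreal (sqrt (\<Delta> t)) * kern_bound g ?e (- t + r))"
        by (simp add: mult.assoc)
    qed
    also have "\<dots> < \<infinity>" using elim unfolding kern_bound_def[of f] by simp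
    finally have "integrable (\<mu> \<Otimes>\<^sub>M \<mu>) (\<lambda>(s, t). F r s t)"
      by (intro \<mu>\<mu>.Fubini_integrableI) measurable
    from \<mu>\<mu>.Fubini_integral[OF this] show ?case .
  qed
  moreover have "(\<integral>t. \<integral>s. F r s t \<partial>\<mu> \<partial>\<mu>) = ind_op f (ind_op g \<xi>) r" for r
    unfolding ind_op_def[of f]
  proof (rule Bochner_Integration.integral_cong[OF refl])
    fix t
    have "(\<integral>s. F r s t \<partial>\<mu>) = (\<integral>s. F r (t + s) t \<partial>\<mu>)"
      by (rule integral_left_translate[symmetric]) measurable
    then show "(\<integral>s. F r s t \<partial>\<mu>) = kern f (ind_op g \<xi>) r t"
      unfolding F_translate by (simp add: kern_def[of f] ind_op_def[of g] mult.assoc)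
  qed
  moreover have "(\<integral>s. \<integral>t. F r s t \<partial>\<mu> \<partial>\<mu>) = ind_op (conv f g) \<xi> r" for r
    unfolding ind_op_def
  proof (rule integral_cong_AE)
    note [measurable] = integrable_\<mu>_measurable[OF conv_integrable[OF f g]]
    show "(\<lambda>s. \<integral>t. F r s t \<partial>\<mu>) \<in> borel_measurable \<mu>" by measurable
    show "kern (conv f g) \<xi> r \<in> borel_measurable \<mu>" by measurable
    show "AE s in \<mu>. (\<integral>t. F r s t \<partial>\<mu>) = kern (conv f g) \<xi> r s"
      using AE_conv_integrable[OF f g]
    proof eventually_elim
      case (elim s)
      have "c0_apply (conv f g s) (act r x) =
          (\<integral>t. c0_apply (c0_mult (f t) (lt act t (g (- t + s)))) (act r x) \<partial>\<mu>)"
        unfolding conv_def by (rule integral_bounded_linear[OF bounded_linear_c0_apply elim, symmetric])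
      then show ?case
        unfolding F_def kern_def by (simp add: mult.assoc[symmetric])
    qed
  qed
  ultimately have "AE r in \<nu>. ind_op f (ind_op g \<xi>) r = ind_op (conv f g) \<xi> r" by simp
  then show ?thesis by eventually_elim simp
qed

lemma norm_invol_le: "norm (invol f s) \<le> \<Delta> (- s) * norm (f (- s))"
proof -
  have "norm (c0_cnj (f (- s))) \<le> norm (f (- s))"
    by (rule norm_c0_bound) (simp add: norm_c0_apply_le)
  then show ?thesis
    using norm_lt_le[of s "c0_cnj (f (- s))"] \<Delta>_pos[of "- s"] by (simp add: invol_def mult_left_mono)
qed

lemma invol_integrable:
  assumes f: "integrable \<mu> f"
  shows "integrable \<mu> (invol f)"
proof -
  note [measurable] = integrable_\<mu>_measurable[OF f]
  have m: "invol f \<in> borel_measurable \<mu>"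
  proof (rule measurable_c0I)
    show "(\<lambda>s. c0_apply (invol f s) y) \<in> borel_measurable \<mu>" for y
      unfolding invol_def by simp
  qed
  have "(\<integral>\<^sup>+s. ennreal (norm (invol f s)) \<partial>\<mu>) \<le> (\<integral>\<^sup>+s. ennreal (\<Delta> (- s) * norm (f (- s))) \<partial>\<mu>)"
    by (intro nn_integral_mono ennreal_leI norm_invol_le)
  also have "\<dots> = (\<integral>\<^sup>+s. ennreal (\<Delta> s * norm (f s)) \<partial>\<nu>)" by (subst nn_integral_\<mu>) auto
  also have "\<dots> = (\<integral>\<^sup>+s. ennreal (norm (f s)) \<partial>\<mu>)"
    using \<Delta>_pos by (subst nn_integral_\<mu>_density) (auto simp: ennreal_mult less_imp_le)
  also have "\<dots> < \<infinity>" using f by (simp add: integrable_iff_bounded)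
  finally show ?thesis using m by (simp add: integrable_iff_bounded)
qed

text \<open>Both sides are double integrals by \<open>ind_op_inner\<close>. Inverting t passes from
  \<mu> to \<nu>, translating s moves the shift from \<xi> to \<zeta>, and the density \<Delta>
  leads back from \<nu> to \<mu>.\<close>

lemma ind_op_invol:
  assumes f: "integrable \<mu> f" and \<xi>: "\<xi> \<in> L2_fun \<nu>" and \<zeta>: "\<zeta> \<in> L2_fun \<nu>"
  shows "L2_fun_inner \<nu> (ind_op (invol f) \<xi>) \<zeta> = L2_fun_inner \<nu> \<xi> (ind_op f \<zeta>)"
proof -
  note [measurable] = integrable_\<mu>_measurable[OF f] L2_fun_measurable[OF \<xi>] L2_fun_measurable[OF \<zeta>]
    integrable_\<mu>_measurable[OF invol_integrable[OF f]]
  define J where "J t = (\<integral>s. cnj (c0_apply (f t) (act s x)) * \<xi> s * cnj (\<zeta> (- t + s)) \<partial>\<nu>)" for t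
  have Jm [measurable]: "J \<in> borel_measurable borel" unfolding J_def by measurable
  \<comment> \<open>The first \<Delta> (- t) belongs to the involution, the root to the translation
    operator, and the second \<Delta> (- t) to the left translation of \<nu>.\<close>
  have inner: "(\<integral>s. kern (invol f) \<xi> s t * cnj (\<zeta> s) \<partial>\<nu>) =
      of_real (\<Delta> (- t) * sqrt (\<Delta> t) * \<Delta> (- t)) * J (- t)" for t
  proof -
    define H where "H s = cnj (c0_apply (f (- t)) (act s x)) * \<xi> s * cnj (\<zeta> (t + s))" for s
    have [measurable]: "H \<in> borel_measurable borel" unfolding H_def by measurable
    have "(\<integral>s. H s \<partial>\<nu>) = of_real (\<Delta> t) * (\<integral>s. H (- t + s) \<partial>\<nu>)"
      by (rule integral_modular_left) measurable
    then have H: "(\<integral>s. H (- t + s) \<partial>\<nu>) = of_real (\<Delta> (- t)) * J (- t)"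
      using \<Delta>_pos[of t] by (simp add: J_def H_def \<Delta>_minus)
    have "kern (invol f) \<xi> s t * cnj (\<zeta> s) = of_real (\<Delta> (- t) * sqrt (\<Delta> t)) * H (- t + s)" for s
    proof -
      have "t + (- t + s) = s" by (simp add: add.assoc[symmetric])
      then show ?thesis
        by (simp add: kern_def invol_def H_def act_add scaleR_conv_of_real mult_ac)
    qed
    then show ?thesis using H by (simp add: mult.assoc)
  qed
  have "L2_fun_inner \<nu> (ind_op (invol f) \<xi>) \<zeta> = (\<integral>t. of_real (\<Delta> (- t) * sqrt (\<Delta> t) * \<Delta> (- t)) * J (- t) \<partial>\<mu>)"
    unfolding ind_op_inner[OF invol_integrable[OF f] \<xi> \<zeta>] inner ..
  also have "\<dots> = (\<integral>t. of_real (\<Delta> t * sqrt (\<Delta> (- t)) * \<Delta> t) * J t \<partial>\<nu>)"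
    by (subst integral_\<mu>) auto
  also have "\<dots> = (\<integral>t. of_real (\<Delta> t) * (of_real (sqrt (\<Delta> t)) * J t) \<partial>\<nu>)"
  proof (rule Bochner_Integration.integral_cong[OF refl])
    fix t
    have "sqrt (\<Delta> (- t)) * \<Delta> t = sqrt (\<Delta> t)"
      using \<Delta>_pos[of t] by (simp add: \<Delta>_minus real_sqrt_divide real_div_sqrt)
    then have "\<Delta> t * sqrt (\<Delta> (- t)) * \<Delta> t = \<Delta> t * sqrt (\<Delta> t)" by (simp add: mult.assoc)
    then show "of_real (\<Delta> t * sqrt (\<Delta> (- t)) * \<Delta> t) * J t = of_real (\<Delta> t) * (of_real (sqrt (\<Delta> t)) * J t)"
      by (simp only: of_real_mult[symmetric] mult.assoc[symmetric])
  qed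
  also have "\<dots> = (\<integral>t. of_real (sqrt (\<Delta> t)) * J t \<partial>\<mu>)"
    by (rule integral_\<mu>_density[symmetric]) measurable
  also have "\<dots> = (\<integral>t. cnj (\<integral>s. kern f \<zeta> s t * cnj (\<xi> s) \<partial>\<nu>) \<partial>\<mu>)"
  proof (rule Bochner_Integration.integral_cong[OF refl])
    fix t
    have "cnj (\<integral>s. kern f \<zeta> s t * cnj (\<xi> s) \<partial>\<nu>) = (\<integral>s. cnj (kern f \<zeta> s t * cnj (\<xi> s)) \<partial>\<nu>)"
      by (rule Bochner_Integration.integral_cnj[symmetric])
    also have "\<dots> = (\<integral>s. of_real (sqrt (\<Delta> t)) * (cnj (c0_apply (f t) (act s x)) * \<xi> s * cnj (\<zeta> (- t + s))) \<partial>\<nu>)"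
      by (rule Bochner_Integration.integral_cong) (simp_all add: kern_def mult_ac)
    finally show "of_real (sqrt (\<Delta> t)) * J t = cnj (\<integral>s. kern f \<zeta> s t * cnj (\<xi> s) \<partial>\<nu>)"
      by (simp add: J_def)
  qed
  also have "\<dots> = cnj (L2_fun_inner \<nu> (ind_op f \<zeta>) \<xi>)"
    by (simp add: ind_op_inner[OF f \<zeta> \<xi>])
  finally show ?thesis by (simp add: L2_fun_inner_cnj)
qed


section \<open>The operator norm is a \<open>C\<^sup>*\<close>-seminorm\<close>

definition op_norm :: "('g \<Rightarrow> 'x c0) \<Rightarrow> real" where
  "op_norm f = (SUP \<xi>\<in>{\<xi> \<in> L2_fun \<nu>. L2_norm \<nu> \<xi> \<le> 1}. L2_norm \<nu> (ind_op f \<xi>))"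

lemma unit_ball_nonempty: "{\<xi> \<in> L2_fun \<nu>. L2_norm \<nu> \<xi> \<le> 1} \<noteq> {}"
  using L2_fun_zero[of \<nu>] L2_norm_zero[of \<nu>] by force

lemma op_norm_bdd:
  assumes f: "integrable \<mu> f"
  shows "bdd_above ((\<lambda>\<xi>. L2_norm \<nu> (ind_op f \<xi>)) ` {\<xi> \<in> L2_fun \<nu>. L2_norm \<nu> \<xi> \<le> 1})"
proof (rule bdd_aboveI2)
  fix \<xi> assume "\<xi> \<in> {\<xi> \<in> L2_fun \<nu>. L2_norm \<nu> \<xi> \<le> 1}"
  then have \<xi>: "\<xi> \<in> L2_fun \<nu>" "L2_norm \<nu> \<xi> \<le> 1" by auto
  have "(\<integral>t. norm (f t) \<partial>\<mu>) * L2_norm \<nu> \<xi> \<le> (\<integral>t. norm (f t) \<partial>\<mu>) * 1"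
    by (intro mult_left_mono \<xi>) simp
  then show "L2_norm \<nu> (ind_op f \<xi>) \<le> (\<integral>t. norm (f t) \<partial>\<mu>)"
    using L2_norm_ind_op_le[OF f \<xi>(1)] by simp
qed

lemma op_norm_leI:
  assumes f: "integrable \<mu> f"
    and "\<And>\<xi>. \<xi> \<in> L2_fun \<nu> \<Longrightarrow> L2_norm \<nu> \<xi> \<le> 1 \<Longrightarrow> L2_norm \<nu> (ind_op f \<xi>) \<le> B"
  shows "op_norm f \<le> B"
  unfolding op_norm_def using assms(2) unit_ball_nonempty by (intro cSUP_least) auto

lemma op_norm_upper:
  assumes f: "integrable \<mu> f" and "\<xi> \<in> L2_fun \<nu>" "L2_norm \<nu> \<xi> \<le> 1"
  shows "L2_norm \<nu> (ind_op f \<xi>) \<le> op_norm f"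
  unfolding op_norm_def using assms by (intro cSUP_upper op_norm_bdd) auto

lemma op_norm_nonneg:
  assumes f: "integrable \<mu> f" shows "0 \<le> op_norm f"
  by (rule order_trans[OF L2_norm_nonneg op_norm_upper[OF f L2_fun_zero]]) (simp add: L2_norm_zero)

lemma L2_norm_ind_op_le_op_norm:
  assumes f: "integrable \<mu> f" and \<xi>: "\<xi> \<in> L2_fun \<nu>"
  shows "L2_norm \<nu> (ind_op f \<xi>) \<le> op_norm f * L2_norm \<nu> \<xi>"
proof (cases "L2_norm \<nu> \<xi> = 0")
  case True
  then show ?thesis using L2_norm_ind_op_le[OF f \<xi>] by simp
next
  case False
  then have pos: "0 < L2_norm \<nu> \<xi>" by (simp add: order_less_le)
  let ?c = "complex_of_real (1 / L2_norm \<nu> \<xi>)"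
  have c: "cmod ?c = 1 / L2_norm \<nu> \<xi>" using pos by (simp only: norm_of_real abs_of_pos zero_less_divide_1_iff)
  have "L2_norm \<nu> (ind_op f (\<lambda>s. ?c * \<xi> s)) \<le> op_norm f"
    by (rule op_norm_upper[OF f L2_fun_scale[OF \<xi>]]) (use pos in \<open>simp only: L2_norm_scale c, simp\<close>)
  moreover have "L2_norm \<nu> (ind_op f (\<lambda>s. ?c * \<xi> s)) = (1 / L2_norm \<nu> \<xi>) * L2_norm \<nu> (ind_op f \<xi>)"
    by (simp only: ind_op_scale_vector[abs_def] L2_norm_scale c)
  ultimately have "(1 / L2_norm \<nu> \<xi>) * L2_norm \<nu> (ind_op f \<xi>) \<le> op_norm f" by (simp only:)
  then show ?thesis using pos by (simp add: field_simps)
qed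

lemma op_norm_conv_le:
  assumes f: "integrable \<mu> f" and g: "integrable \<mu> g"
  shows "op_norm (conv f g) \<le> op_norm f * op_norm g"
proof (rule op_norm_leI[OF conv_integrable[OF f g]])
  fix \<xi> assume \<xi>: "\<xi> \<in> L2_fun \<nu>" "L2_norm \<nu> \<xi> \<le> 1"
  have g\<xi>: "ind_op g \<xi> \<in> L2_fun \<nu>" by (rule ind_op_L2[OF g \<xi>(1)])
  have "L2_norm \<nu> (ind_op (conv f g) \<xi>) = L2_norm \<nu> (ind_op f (ind_op g \<xi>))"
    by (intro L2_norm_cong ind_op_L2 conv_integrable f g g\<xi> \<xi> ind_op_conv)
  also have "\<dots> \<le> op_norm f * L2_norm \<nu> (ind_op g \<xi>)"
    by (rule L2_norm_ind_op_le_op_norm[OF f g\<xi>])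
  also have "\<dots> \<le> op_norm f * op_norm g"
    by (intro mult_left_mono op_norm_upper g \<xi> op_norm_nonneg f)
  finally show "L2_norm \<nu> (ind_op (conv f g) \<xi>) \<le> op_norm f * op_norm g" .
qed

lemma op_norm_add_le:
  assumes f: "integrable \<mu> f" and g: "integrable \<mu> g"
  shows "op_norm (\<lambda>s. f s + g s) \<le> op_norm f + op_norm g"
proof (rule op_norm_leI)
  show fg: "integrable \<mu> (\<lambda>s. f s + g s)" using f g by simp
  fix \<xi> assume \<xi>: "\<xi> \<in> L2_fun \<nu>" "L2_norm \<nu> \<xi> \<le> 1"
  have "L2_norm \<nu> (ind_op (\<lambda>s. f s + g s) \<xi>) = L2_norm \<nu> (\<lambda>s. ind_op f \<xi> s + ind_op g \<xi> s)"
    by (intro L2_norm_cong ind_op_L2 L2_fun_add ind_op_add fg f g \<xi>)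
  also have "\<dots> \<le> L2_norm \<nu> (ind_op f \<xi>) + L2_norm \<nu> (ind_op g \<xi>)"
    by (intro L2_norm_triangle ind_op_L2 f g \<xi>)
  also have "\<dots> \<le> op_norm f + op_norm g" by (intro add_mono op_norm_upper f g \<xi>)
  finally show "L2_norm \<nu> (ind_op (\<lambda>s. f s + g s) \<xi>) \<le> op_norm f + op_norm g" .
qed

lemma op_norm_scale:
  assumes f: "integrable \<mu> f"
  shows "op_norm (\<lambda>s. c0_scale c (f s)) = cmod c * op_norm f"
proof -
  have eq: "L2_norm \<nu> (ind_op (\<lambda>s. c0_scale c (f s)) \<xi>) = cmod c * L2_norm \<nu> (ind_op f \<xi>)" for \<xi>
    by (simp add: ind_op_scale[abs_def] L2_norm_scale)
  have cf: "integrable \<mu> (\<lambda>s. c0_scale c (f s))" by (rule integrable_c0_scale[OF f])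
  show ?thesis
  proof (rule antisym)
    show "op_norm (\<lambda>s. c0_scale c (f s)) \<le> cmod c * op_norm f"
      by (rule op_norm_leI[OF cf]) (simp add: eq mult_left_mono op_norm_upper f)
    show "cmod c * op_norm f \<le> op_norm (\<lambda>s. c0_scale c (f s))"
    proof (cases "c = 0")
      case True
      then show ?thesis using op_norm_nonneg[OF cf] by simp
    next
      case False
      have "op_norm f \<le> op_norm (\<lambda>s. c0_scale c (f s)) / cmod c"
      proof (rule op_norm_leI[OF f])
        fix \<xi> assume "\<xi> \<in> L2_fun \<nu>" "L2_norm \<nu> \<xi> \<le> 1"
        then have "cmod c * L2_norm \<nu> (ind_op f \<xi>) \<le> op_norm (\<lambda>s. c0_scale c (f s))"
          using op_norm_upper[OF cf, of \<xi>] unfolding eq by simp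
        then show "L2_norm \<nu> (ind_op f \<xi>) \<le> op_norm (\<lambda>s. c0_scale c (f s)) / cmod c"
          using False by (simp add: field_simps)
      qed
      then show ?thesis using False by (simp add: field_simps)
    qed
  qed
qed

text \<open>Serves twice: for the C^*-identity of the operator norm, and later to turn closeness of
  states at c^* c into a lower bound for \<parallel>c \<xi>\<parallel>.\<close>

lemma inner_ind_op_square:
  assumes f: "integrable \<mu> f" and \<xi>: "\<xi> \<in> L2_fun \<nu>"
  shows "L2_fun_inner \<nu> (ind_op (conv (invol f) f) \<xi>) \<xi> = of_real ((L2_norm \<nu> (ind_op f \<xi>))\<^sup>2)"
proof -
  have f': "integrable \<mu> (invol f)" by (rule invol_integrable[OF f])
  have f\<xi>: "ind_op f \<xi> \<in> L2_fun \<nu>" by (rule ind_op_L2[OF f \<xi>])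
  have "L2_fun_inner \<nu> (ind_op (conv (invol f) f) \<xi>) \<xi> = L2_fun_inner \<nu> (ind_op (invol f) (ind_op f \<xi>)) \<xi>"
    by (intro L2_fun_inner_cong ind_op_L2 conv_integrable f' f\<xi> \<xi> ind_op_conv f) simp
  also have "\<dots> = L2_fun_inner \<nu> (ind_op f \<xi>) (ind_op f \<xi>)"
    by (rule ind_op_invol[OF f f\<xi> \<xi>])
  finally show ?thesis by (simp only: L2_fun_inner_self)
qed

text \<open>One inequality is Cauchy-Schwarz for <f^* f \<xi>, \<xi>> = \<parallel>f
  \<xi>\<parallel>^2. The other is submultiplicativity together with \<parallel>f^*\<parallel> \<le>
  \<parallel>f\<parallel>, which follows from \<parallel>f^* \<xi>\<parallel>^2 = <\<xi>, f f^*
  \<xi>> by dividing out one factor \<parallel>f^* \<xi>\<parallel>.\<close>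

lemma op_norm_invol_mult:
  assumes f: "integrable \<mu> f"
  shows "op_norm (conv (invol f) f) = (op_norm f)\<^sup>2"
proof -
  let ?f' = "invol f"
  have f': "integrable \<mu> ?f'" by (rule invol_integrable[OF f])
  have ff: "integrable \<mu> (conv ?f' f)" by (rule conv_integrable[OF f' f])
  have eq: "(L2_norm \<nu> (ind_op f \<xi>))\<^sup>2 = Re (L2_fun_inner \<nu> (ind_op (conv ?f' f) \<xi>) \<xi>)"
    if "\<xi> \<in> L2_fun \<nu>" for \<xi>
    by (simp add: inner_ind_op_square[OF f that])
  have le: "(op_norm f)\<^sup>2 \<le> op_norm (conv ?f' f)"
  proof -
    have "op_norm f \<le> sqrt (op_norm (conv ?f' f))"
    proof (rule op_norm_leI[OF f], rule real_le_rsqrt)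
      fix \<xi> assume \<xi>: "\<xi> \<in> L2_fun \<nu>" "L2_norm \<nu> \<xi> \<le> 1"
      have "(L2_norm \<nu> (ind_op f \<xi>))\<^sup>2 \<le> cmod (L2_fun_inner \<nu> (ind_op (conv ?f' f) \<xi>) \<xi>)"
        unfolding eq[OF \<xi>(1)] by (rule complex_Re_le_cmod)
      also have "\<dots> \<le> L2_norm \<nu> (ind_op (conv ?f' f) \<xi>) * L2_norm \<nu> \<xi>"
        by (intro L2_Cauchy_Schwarz ind_op_L2 ff \<xi>)
      also have "\<dots> \<le> op_norm (conv ?f' f) * 1"
        by (intro mult_mono op_norm_upper ff \<xi> op_norm_nonneg) simp
      finally show "(L2_norm \<nu> (ind_op f \<xi>))\<^sup>2 \<le> op_norm (conv ?f' f)" by simp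
    qed
    then show ?thesis
      using power_mono[OF _ op_norm_nonneg[OF f], of _ 2] op_norm_nonneg[OF ff] by fastforce
  qed
  have star: "op_norm ?f' \<le> op_norm f"
  proof (rule op_norm_leI[OF f'])
    fix \<xi> assume \<xi>: "\<xi> \<in> L2_fun \<nu>" "L2_norm \<nu> \<xi> \<le> 1"
    let ?\<eta> = "ind_op ?f' \<xi>"
    have \<eta>: "?\<eta> \<in> L2_fun \<nu>" by (rule ind_op_L2[OF f' \<xi>(1)])
    have "(L2_norm \<nu> ?\<eta>)\<^sup>2 = cmod (L2_fun_inner \<nu> ?\<eta> ?\<eta>)" by (simp add: L2_fun_inner_self norm_power)
    also have "\<dots> = cmod (L2_fun_inner \<nu> \<xi> (ind_op f ?\<eta>))" by (simp add: ind_op_invol[OF f \<xi>(1) \<eta>])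
    also have "\<dots> \<le> L2_norm \<nu> \<xi> * L2_norm \<nu> (ind_op f ?\<eta>)"
      by (intro L2_Cauchy_Schwarz ind_op_L2 f \<eta> \<xi>)
    also have "\<dots> \<le> 1 * (op_norm f * L2_norm \<nu> ?\<eta>)"
      by (intro mult_mono L2_norm_ind_op_le_op_norm f \<eta> \<xi>) auto
    finally have "L2_norm \<nu> ?\<eta> * L2_norm \<nu> ?\<eta> \<le> op_norm f * L2_norm \<nu> ?\<eta>"
      by (simp add: power2_eq_square)
    then show "L2_norm \<nu> ?\<eta> \<le> op_norm f"
      using op_norm_nonneg[OF f] L2_norm_nonneg[of \<nu> ?\<eta>] by (cases "L2_norm \<nu> ?\<eta> = 0") auto
  qed
  have "op_norm (conv ?f' f) \<le> op_norm ?f' * op_norm f"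
    by (rule op_norm_conv_le[OF f' f])
  also have "\<dots> \<le> op_norm f * op_norm f" by (intro mult_right_mono star op_norm_nonneg f)
  finally show ?thesis using le by (simp add: power2_eq_square)
qed

lemma cstar_seminorm_op_norm: "cstar_seminorm L1 op_norm"
  unfolding cstar_seminorm_def L1_simps mem_Collect_eq
proof (intro conjI ballI allI; (unfold mem_Collect_eq)?)
  fix f g :: "'g \<Rightarrow> 'x c0" and c :: complex
  assume f: "integrable \<mu> f"
  show "0 \<le> op_norm f" by (rule op_norm_nonneg[OF f])
  show "op_norm f \<le> (\<integral>s. norm (f s) \<partial>\<mu>)"
  proof (rule op_norm_leI[OF f])
    fix \<xi> assume \<xi>: "\<xi> \<in> L2_fun \<nu>" "L2_norm \<nu> \<xi> \<le> 1"
    have "(\<integral>t. norm (f t) \<partial>\<mu>) * L2_norm \<nu> \<xi> \<le> (\<integral>t. norm (f t) \<partial>\<mu>) * 1"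
      by (intro mult_left_mono \<xi>) simp
    then show "L2_norm \<nu> (ind_op f \<xi>) \<le> (\<integral>t. norm (f t) \<partial>\<mu>)"
      using L2_norm_ind_op_le[OF f \<xi>(1)] by simp
  qed
  show "op_norm (conv (invol f) f) = (op_norm f)\<^sup>2" by (rule op_norm_invol_mult[OF f])
  show "op_norm (\<lambda>s. c0_scale c (f s)) = cmod c * op_norm f" by (rule op_norm_scale[OF f])
  assume g: "integrable \<mu> g"
  show "op_norm (conv f g) \<le> op_norm f * op_norm g" by (rule op_norm_conv_le[OF f g])
  show "op_norm (\<lambda>s. f s + g s) \<le> op_norm f + op_norm g" by (rule op_norm_add_le[OF f g])
qed

end

section \<open>Vector functionals of the crossed product\<close>

context induced_rep begin

text \<open>
  As a \<open>C\<^sup>*\<close>-seminorm, the operator norm is dominated by the enveloping norm. Hence all Cauchy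
  sequences in a class act alike, and \<^const>\<open>L2_inner\<close> is not applied to junk values.
\<close>

abbreviation env :: "('g \<Rightarrow> 'x c0) \<Rightarrow> real" where
  "env \<equiv> enveloping_norm L1"

lemma op_norm_le_env:
  assumes f: "integrable \<mu> f"
  shows "op_norm f \<le> env f"
  unfolding enveloping_norm_def
proof (rule cSUP_upper)
  show "op_norm \<in> {p. cstar_seminorm L1 p}" using cstar_seminorm_op_norm by simp
  show "bdd_above ((\<lambda>p. p f) ` {p. cstar_seminorm L1 p})"
    by (rule bdd_aboveI2[of _ _ "sa_norm L1 f"]) (use f in \<open>auto simp: cstar_seminorm_def L1_simps(1)\<close>)
qed

lemma env_zero: "env (\<lambda>s. 0) = 0"
proof -
  have "p (\<lambda>s. 0) = 0" if "cstar_seminorm L1 p" for p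
  proof -
    have "0 \<le> p (\<lambda>s. 0) \<and> p (\<lambda>s. 0) \<le> sa_norm L1 (\<lambda>s. 0)"
      using that unfolding cstar_seminorm_def L1_simps(1) by simp
    then show ?thesis by (simp add: L1_simps)
  qed
  \<comment> \<open>The operator norm witnesses that some C^*-seminorm exists; the real supremum
    over an empty family would have no specified value.\<close>
  then have "(\<lambda>p. p (\<lambda>s. 0)) ` {p. cstar_seminorm L1 p} = {0}"
    using cstar_seminorm_op_norm by (force simp: image_iff)
  then show ?thesis by (simp add: enveloping_norm_def)
qed

lemma sa_diff_eq: "sa_diff L1 f g = (\<lambda>s. f s - g s)"
  by (simp add: sa_diff_def L1_simps fun_eq_iff) (auto intro!: c0_eqI)

text \<open>Constant sequences embed L^1(G, C_0(X)) into its completion. The element on which states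
  are compared enters in this form.\<close>

lemma const_in_env_class:
  assumes b: "integrable \<mu> b"
  shows "(\<lambda>n. b) \<in> env_cauchy L1" "(\<lambda>n. b) \<in> env_class L1 (\<lambda>n. b)"
proof -
  show "(\<lambda>n. b) \<in> env_cauchy L1"
    using b by (simp add: env_cauchy_def L1_simps(1) sa_diff_eq env_zero)
  then show "(\<lambda>n. b) \<in> env_class L1 (\<lambda>n. b)"
    by (simp add: env_class_def sa_diff_eq env_zero)
qed

text \<open>By \<open>ind_op_inner\<close> the right side of the weak equation is the inner product
  of \<open>ind_op f \<xi>'\<close> with \<zeta>. Testing against all \<zeta> fixes the vector up to
  null sets, whichever representative \<xi>' is taken.\<close>

lemma integrated_form_eq:
  assumes f: "integrable \<mu> f" and \<xi>: "\<xi> \<in> L2_fun \<nu>"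
  shows "integrated_form act \<nu> \<Delta> x f (L2_class \<nu> \<xi>) = L2_class \<nu> (ind_op f \<xi>)"
proof -
  have eq: "(\<integral>t. L2_fun_inner \<nu> (eval_rep act x (f t) (translation_rep \<Delta> t \<xi>')) \<zeta> \<partial>\<mu>) =
      L2_fun_inner \<nu> (ind_op f \<xi>') \<zeta>" if "\<xi>' \<in> L2_fun \<nu>" "\<zeta> \<in> L2_fun \<nu>" for \<xi>' \<zeta>
    unfolding ind_op_inner[OF f that]
    by (simp add: L2_fun_inner_def eval_rep_def translation_rep_def kern_def)
  show ?thesis
  proof (intro equalityI subsetI)
    fix \<eta> assume "\<eta> \<in> integrated_form act \<nu> \<Delta> x f (L2_class \<nu> \<xi>)"
    then obtain \<xi>' where \<eta>: "\<eta> \<in> L2_fun \<nu>" and \<xi>': "\<xi>' \<in> L2_fun \<nu>" "AE s in \<nu>. \<xi>' s = \<xi> s"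
      and "\<And>\<zeta>. \<zeta> \<in> L2_fun \<nu> \<Longrightarrow> L2_fun_inner \<nu> \<eta> \<zeta> = L2_fun_inner \<nu> (ind_op f \<xi>') \<zeta>"
      using eq by (auto simp: integrated_form_def L2_class_def)
    then have "AE s in \<nu>. \<eta> s = ind_op f \<xi>' s"
      by (intro L2_AE_eqI ind_op_L2 f)
    then have "AE s in \<nu>. \<eta> s = ind_op f \<xi> s"
      using ind_op_cong_AE[OF f \<xi>'(1) \<xi> \<xi>'(2)] by eventually_elim simp
    then show "\<eta> \<in> L2_class \<nu> (ind_op f \<xi>)" using \<eta> by (simp add: L2_class_def)
  next
    fix \<eta> assume "\<eta> \<in> L2_class \<nu> (ind_op f \<xi>)"
    then have \<eta>: "\<eta> \<in> L2_fun \<nu>" "AE s in \<nu>. \<eta> s = ind_op f \<xi> s" by (auto simp: L2_class_def)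
    have "L2_fun_inner \<nu> \<eta> \<zeta> = L2_fun_inner \<nu> (ind_op f \<xi>) \<zeta>" if "\<zeta> \<in> L2_fun \<nu>" for \<zeta>
      by (intro L2_fun_inner_cong ind_op_L2 f \<xi> \<eta> that) simp
    then show "\<eta> \<in> integrated_form act \<nu> \<Delta> x f (L2_class \<nu> \<xi>)"
      using \<eta>(1) eq[OF \<xi>] unfolding integrated_form_def
      by (auto intro!: bexI[OF _ L2_classI[OF \<xi>]])
  qed
qed

text \<open>The definition admits any Cauchy sequence F equivalent to the constant b. The distance
  from \<open>ind_op b \<xi>\<close> to \<eta> is at most the enveloping norm of b - F n times
  \<parallel>\<xi>\<parallel>, plus \<parallel>\<zeta> n - \<eta>\<parallel>, and both terms tend to
  0.\<close>

lemma rep_act_Ind: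
  assumes b: "integrable \<mu> b" and \<xi>: "\<xi> \<in> L2_fun \<nu>"
  shows "rep_act (Ind act \<nu> \<Delta> x) (env_class L1 (\<lambda>n. b)) (L2_class \<nu> \<xi>) = L2_class \<nu> (ind_op b \<xi>)"
    (is "?R = _")
proof (intro equalityI subsetI)
  fix \<eta> assume "\<eta> \<in> L2_class \<nu> (ind_op b \<xi>)"
  then have \<eta>: "\<eta> \<in> L2_fun \<nu>" "\<eta> \<in> integrated_form act \<nu> \<Delta> x b (L2_class \<nu> \<xi>)"
    unfolding integrated_form_eq[OF b \<xi>] by (auto simp: L2_class_def)
  then show "\<eta> \<in> ?R"
    using const_in_env_class(2)[OF b]
    by (auto simp: Ind_def intro!: bexI[of _ "\<lambda>n. b"] exI[of _ "\<lambda>n. \<eta>"])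
next
  fix \<eta> assume "\<eta> \<in> ?R"
  then obtain F \<zeta> where \<eta>: "\<eta> \<in> L2_fun \<nu>" and F: "F \<in> env_class L1 (\<lambda>n. b)"
    and \<zeta>: "\<And>n. \<zeta> n \<in> integrated_form act \<nu> \<Delta> x (F n) (L2_class \<nu> \<xi>)"
    and lim: "(\<lambda>n. \<integral>s. (cmod (\<zeta> n s - \<eta> s))\<^sup>2 \<partial>\<nu>) \<longlonglongrightarrow> 0"
    by (auto simp: Ind_def)
  have Fi: "integrable \<mu> (F n)" for n using F by (simp add: env_class_def env_cauchy_def L1_simps(1))
  have env_lim: "(\<lambda>n. env (\<lambda>s. b s - F n s)) \<longlonglongrightarrow> 0"
    using F by (simp add: env_class_def sa_diff_eq)
  have \<zeta>2: "\<zeta> n \<in> L2_fun \<nu>" "AE s in \<nu>. \<zeta> n s = ind_op (F n) \<xi> s" for n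
    using \<zeta>[of n] unfolding integrated_form_eq[OF Fi \<xi>] by (auto simp: L2_class_def)
  have b\<xi>: "ind_op b \<xi> \<in> L2_fun \<nu>" by (rule ind_op_L2[OF b \<xi>])
  have bound: "L2_norm \<nu> (\<lambda>s. ind_op b \<xi> s - \<eta> s) \<le>
      env (\<lambda>s. b s - F n s) * L2_norm \<nu> \<xi> + L2_norm \<nu> (\<lambda>s. \<zeta> n s - \<eta> s)" for n
  proof -
    have d: "integrable \<mu> (\<lambda>s. b s - F n s)" using b Fi by simp
    have "AE s in \<nu>. ind_op (\<lambda>s. F n s + (b s - F n s)) \<xi> s = ind_op (F n) \<xi> s + ind_op (\<lambda>s. b s - F n s) \<xi> s"
      by (rule ind_op_add[OF Fi d \<xi>])
    then have "AE s in \<nu>. ind_op b \<xi> s - \<zeta> n s = ind_op (\<lambda>s. b s - F n s) \<xi> s"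
      using \<zeta>2(2)[of n] by eventually_elim simp
    then have "L2_norm \<nu> (\<lambda>s. ind_op b \<xi> s - \<zeta> n s) = L2_norm \<nu> (ind_op (\<lambda>s. b s - F n s) \<xi>)"
      by (intro L2_norm_cong L2_fun_diff ind_op_L2 b d \<xi> \<zeta>2)
    also have "\<dots> \<le> op_norm (\<lambda>s. b s - F n s) * L2_norm \<nu> \<xi>"
      by (rule L2_norm_ind_op_le_op_norm[OF d \<xi>])
    also have "\<dots> \<le> env (\<lambda>s. b s - F n s) * L2_norm \<nu> \<xi>"
      by (intro mult_right_mono op_norm_le_env d) simp
    finally show ?thesis
      using L2_norm_triangle[OF L2_fun_diff[OF b\<xi> \<zeta>2(1)[of n]] L2_fun_diff[OF \<zeta>2(1)[of n] \<eta>]] by simp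
  qed
  have "(\<lambda>n. env (\<lambda>s. b s - F n s) * L2_norm \<nu> \<xi> + L2_norm \<nu> (\<lambda>s. \<zeta> n s - \<eta> s))
      \<longlonglongrightarrow> 0 * L2_norm \<nu> \<xi> + 0"
    using tendsto_real_sqrt[OF lim]
    by (intro tendsto_add tendsto_mult env_lim tendsto_const) (simp add: L2_norm_def)
  then have "L2_norm \<nu> (\<lambda>s. ind_op b \<xi> s - \<eta> s) \<le> 0"
    using bound by (intro LIMSEQ_le_const) auto
  then have "L2_norm \<nu> (\<lambda>s. ind_op b \<xi> s - \<eta> s) = 0" by (simp add: antisym)
  then have "AE s in \<nu>. ind_op b \<xi> s - \<eta> s = 0"
    using L2_norm_eq_0_iff[OF L2_fun_diff[OF b\<xi> \<eta>]] by simp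
  then show "\<eta> \<in> L2_class \<nu> (ind_op b \<xi>)"
    using \<eta> by (auto simp: L2_class_def)
qed

lemma vector_functional_Ind:
  assumes b: "integrable \<mu> b" and \<xi>: "\<xi> \<in> L2_fun \<nu>"
  shows "vector_functional (Ind act \<nu> \<Delta> x) (L2_class \<nu> \<xi>) (env_class L1 (\<lambda>n. b)) =
    L2_fun_inner \<nu> (ind_op b \<xi>) \<xi>"
  unfolding vector_functional_def rep_act_Ind[OF b \<xi>]
  using L2_inner_eq[of "L2_class \<nu> (ind_op b \<xi>)" "L2_class \<nu> \<xi>" "ind_op b \<xi>" \<nu> \<xi>]
    ind_op_L2[OF b \<xi>] \<xi> L2_classI[OF ind_op_L2[OF b \<xi>]] L2_classI[OF \<xi>]
  by (auto simp: Ind_def)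

lemma vector_functional_Ind_square:
  assumes c: "integrable \<mu> c" and \<xi>: "\<xi> \<in> L2_fun \<nu>"
  shows "vector_functional (Ind act \<nu> \<Delta> x) (L2_class \<nu> \<xi>) (env_class L1 (\<lambda>n. conv (invol c) c)) =
    of_real ((L2_norm \<nu> (ind_op c \<xi>))\<^sup>2)"
  unfolding vector_functional_Ind[OF conv_integrable[OF invol_integrable[OF c] c] \<xi>]
    inner_ind_op_square[OF c \<xi>] ..

section \<open>Approximate rank-one operators\<close>

text \<open>The substitution t = s v^-1, for fixed s. It rewrites the integrated form as an integral
  operator with respect to \<nu> in the variable v.\<close>

lemma integral_kernel_form:
  fixes H :: "'g \<Rightarrow> complex"
  assumes [measurable]: "H \<in> borel_measurable borel"
  shows "(\<integral>t. H t \<partial>\<mu>) = (\<integral>v. H (s - v) \<partial>\<nu>)"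
proof -
  have "(\<integral>t. H t \<partial>\<mu>) = (\<integral>v. H (- v) \<partial>\<nu>)" by (rule integral_\<mu>) measurable
  also have "\<dots> = (\<integral>v. H (- v) \<partial>distr \<nu> borel (\<lambda>v. v + - s))" by (simp only: distr_right_translate)
  also have "\<dots> = (\<integral>v. H (- (v + - s)) \<partial>\<nu>)" by (rule integral_distr) measurable
  finally show ?thesis by simp
qed

lemma nn_integral_kernel_form:
  assumes [measurable]: "H \<in> borel_measurable borel"
  shows "(\<integral>\<^sup>+t. H t \<partial>\<mu>) = (\<integral>\<^sup>+v. H (s - v) \<partial>\<nu>)"
proof -
  have "(\<integral>\<^sup>+t. H t \<partial>\<mu>) = (\<integral>\<^sup>+v. H (- v) \<partial>\<nu>)" by (rule nn_integral_\<mu>) measurable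
  also have "\<dots> = (\<integral>\<^sup>+v. H (- (v + - s)) \<partial>\<nu>)" by (rule nn_integral_right_translate[symmetric]) measurable
  finally show ?thesis by simp
qed

text \<open>Division by sqrt (\<Delta> t) cancels the factor in the translation operator. With t = s
  v^-1 the point t^-1\<cdot>(s\<cdot>x) is v\<cdot>x, so the integral kernel is f(s\<cdot>x) times
  the conjugate of \<open>cut_vec C g s v\<close>.\<close>

definition cut_kernel :: "'g set \<Rightarrow> 'x c0 \<Rightarrow> 'x c0 \<Rightarrow> 'g \<Rightarrow> 'x c0" where
  "cut_kernel C f g t = (indicator C t / sqrt (\<Delta> t)) *\<^sub>R c0_mult f (c0_cnj (lt act t g))"

definition cut_vec :: "'g set \<Rightarrow> 'x c0 \<Rightarrow> 'g \<Rightarrow> 'g \<Rightarrow> complex" where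
  "cut_vec C g s v = indicator C (s - v) * c0_apply g (act v x)"

lemma emeasure_\<mu>_compact_finite:
  assumes "compact C" shows "emeasure \<mu> C < \<infinity>"
proof -
  have C: "compact (uminus ` C)" by (intro compact_continuous_image continuous_intros assms)
  have "emeasure \<mu> C = emeasure \<nu> (uminus -` C)"
    using borel_compact[OF assms] by (simp add: left_haar_def emeasure_distr)
  also have "uminus -` C = uminus ` C" by (force simp: image_iff)
  finally show ?thesis using emeasure_compact_finite[OF C] by simp
qed

text \<open>The weight 1 / sqrt \<Delta> has to be integrable on C, and no bound for \<Delta> on C
  is used. With respect to \<nu> the weight becomes sqrt \<Delta>, which is at most 1 + \<Delta>,
  and the integral over C is at most \<nu>(C) + \<mu>(C).\<close>

lemma cut_kernel_integrable:
  assumes C: "compact C"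
  shows "integrable \<mu> (cut_kernel C f g)"
proof -
  have [measurable]: "C \<in> sets borel" by (rule borel_compact[OF C])
  have m: "cut_kernel C f g \<in> borel_measurable \<mu>"
  proof (rule measurable_c0I)
    show "(\<lambda>t. c0_apply (cut_kernel C f g t) y) \<in> borel_measurable \<mu>" for y
      unfolding cut_kernel_def by simp
  qed
  have "norm (cut_kernel C f g t) \<le> norm f * norm g * (indicator C t / sqrt (\<Delta> t))" for t
  proof -
    have "norm (c0_mult f (c0_cnj (lt act t g))) \<le> norm f * norm g"
      by (rule norm_c0_bound) (simp add: norm_mult mult_mono norm_c0_apply_le)
    then show ?thesis using \<Delta>_pos[of t]
      by (auto simp: cut_kernel_def indicator_def divide_right_mono mult.commute)
  qed
  then have "(\<integral>\<^sup>+t. ennreal (norm (cut_kernel C f g t)) \<partial>\<mu>) \<le>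
      (\<integral>\<^sup>+t. ennreal (norm f * norm g * (indicator C t / sqrt (\<Delta> t))) \<partial>\<mu>)"
    by (intro nn_integral_mono ennreal_leI)
  also have "\<dots> = ennreal (norm f * norm g) * (\<integral>\<^sup>+t. ennreal (indicator C t / sqrt (\<Delta> t)) \<partial>\<mu>)"
  proof -
    have "ennreal (norm f * norm g * (indicator C t / sqrt (\<Delta> t))) =
        ennreal (norm f * norm g) * ennreal (indicator C t / sqrt (\<Delta> t))" for t
      by (rule ennreal_mult) (use \<Delta>_pos[of t] in auto)
    then show ?thesis by (simp only:) (rule nn_integral_cmult, measurable)
  qed
  also have "(\<integral>\<^sup>+t. ennreal (indicator C t / sqrt (\<Delta> t)) \<partial>\<mu>) =
      (\<integral>\<^sup>+t. ennreal (\<Delta> t) * ennreal (indicator C t / sqrt (\<Delta> t)) \<partial>\<nu>)"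
    by (rule nn_integral_\<mu>_density) measurable
  also have "\<dots> \<le> (\<integral>\<^sup>+t. indicator C t + ennreal (\<Delta> t) * indicator C t \<partial>\<nu>)"
  proof (rule nn_integral_mono)
    fix t
    have "\<Delta> t / sqrt (\<Delta> t) \<le> 1 + \<Delta> t"
    proof -
      have "\<Delta> t / sqrt (\<Delta> t) = sqrt (\<Delta> t)" using \<Delta>_pos[of t] by (simp add: real_div_sqrt)
      moreover have "sqrt (\<Delta> t) \<le> 1 + \<Delta> t"
        using \<Delta>_pos[of t] by (intro real_le_lsqrt) (auto simp: power2_eq_square algebra_simps add_pos_pos)
      ultimately show ?thesis by simp
    qed
    then show "ennreal (\<Delta> t) * ennreal (indicator C t / sqrt (\<Delta> t)) \<le> indicator C t + ennreal (\<Delta> t) * indicator C t"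
      using \<Delta>_pos[of t] by (auto simp: indicator_def ennreal_mult'[symmetric] ennreal_leI simp flip: ennreal_1 ennreal_plus)
  qed
  also have "\<dots> = emeasure \<nu> C + (\<integral>\<^sup>+t. ennreal (\<Delta> t) * indicator C t \<partial>\<nu>)"
    by (subst nn_integral_add) auto
  also have "(\<integral>\<^sup>+t. ennreal (\<Delta> t) * indicator C t \<partial>\<nu>) = emeasure \<mu> C"
    by (subst nn_integral_\<mu>_density[symmetric]) auto
  finally have *: "(\<integral>\<^sup>+t. ennreal (norm (cut_kernel C f g t)) \<partial>\<mu>) \<le>
     ennreal (norm f * norm g) * (emeasure \<nu> C + emeasure \<mu> C)" by (simp add: mult_left_mono)
  also have "\<dots> < \<infinity>"
    using emeasure_compact_finite[OF C] emeasure_\<mu>_compact_finite[OF C]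
    by (simp add: ennreal_mult_less_top)
  finally show ?thesis using m by (simp add: integrable_iff_bounded)
qed

lemma measurable_cut_vec:
  assumes C: "compact C"
  shows "cut_vec C g s \<in> borel_measurable borel"
proof -
  have [measurable]: "C \<in> sets borel" by (rule borel_compact[OF C])
  show ?thesis unfolding cut_vec_def by measurable
qed

text \<open>Undoing the substitution replaces v\<cdot>x by t^-1\<cdot>(s\<cdot>x). The right side
  mentions s and x only through the point s\<cdot>x, so a bound for it can be imposed on points of
  X.\<close>

lemma cut_vec_nn_norm:
  assumes C: "compact C"
  shows "(\<integral>\<^sup>+v. ennreal ((cmod (cut_vec C g s v))\<^sup>2) \<partial>\<nu>) =
    (\<integral>\<^sup>+t. indicator C t * ennreal ((cmod (c0_apply g (act (- t) (act s x))))\<^sup>2) \<partial>\<mu>)"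
proof -
  have [measurable]: "C \<in> sets borel" by (rule borel_compact[OF C])
  have "(\<integral>\<^sup>+t. indicator C t * ennreal ((cmod (c0_apply g (act (- t) (act s x))))\<^sup>2) \<partial>\<mu>) =
    (\<integral>\<^sup>+v. indicator C (s - v) * ennreal ((cmod (c0_apply g (act (- (s - v)) (act s x))))\<^sup>2) \<partial>\<nu>)"
    by (rule nn_integral_kernel_form) measurable
  also have "\<dots> = (\<integral>\<^sup>+v. ennreal ((cmod (cut_vec C g s v))\<^sup>2) \<partial>\<nu>)"
    by (intro nn_integral_cong) (auto simp: cut_vec_def indicator_def act_add[symmetric])
  finally show ?thesis by simp
qed

lemma cut_vec_L2:
  assumes C: "compact C"
  shows "cut_vec C g s \<in> L2_fun \<nu>"
proof -
  have [measurable]: "C \<in> sets borel" by (rule borel_compact[OF C])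
  have "(\<integral>\<^sup>+v. ennreal ((cmod (cut_vec C g s v))\<^sup>2) \<partial>\<nu>) \<le> (\<integral>\<^sup>+t. ennreal ((norm g)\<^sup>2) * indicator C t \<partial>\<mu>)"
    unfolding cut_vec_nn_norm[OF C]
    by (intro nn_integral_mono) (auto simp: indicator_def intro!: ennreal_leI power_mono norm_c0_apply_le)
  also have "\<dots> = ennreal ((norm g)\<^sup>2) * emeasure \<mu> C" by (subst nn_integral_cmult_indicator) auto
  also have "\<dots> < \<infinity>" using emeasure_\<mu>_compact_finite[OF C] by (simp add: ennreal_mult_less_top)
  finally show ?thesis using measurable_cut_vec[OF C] by (simp add: L2_fun_iff_nn_integral)
qed

lemma ind_op_cut_kernel:
  assumes C: "compact C" and [measurable]: "\<xi> \<in> borel_measurable borel"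
  shows "ind_op (cut_kernel C f g) \<xi> s = c0_apply f (act s x) * L2_fun_inner \<nu> \<xi> (cut_vec C g s)"
proof -
  have [measurable]: "C \<in> sets borel" by (rule borel_compact[OF C])
  define H where "H t = c0_apply f (act s x) *
    (\<xi> (- t + s) * cnj (indicator C t * c0_apply g (act (- t) (act s x))))" for t
  have "kern (cut_kernel C f g) \<xi> s t = H t" for t
  proof -
    have "sqrt (\<Delta> t) \<noteq> 0" using \<Delta>_pos[of t] by simp
    then show ?thesis
      by (auto simp: kern_def cut_kernel_def H_def indicator_def scaleR_conv_of_real)
  qed
  then have "ind_op (cut_kernel C f g) \<xi> s = (\<integral>t. H t \<partial>\<mu>)" by (simp add: ind_op_def)
  also have "\<dots> = (\<integral>v. H (s - v) \<partial>\<nu>)"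
    by (rule integral_kernel_form) (unfold H_def, measurable)
  also have "\<dots> = (\<integral>v. c0_apply f (act s x) * (\<xi> v * cnj (cut_vec C g s v)) \<partial>\<nu>)"
    by (intro Bochner_Integration.integral_cong) (auto simp: H_def cut_vec_def act_add[symmetric])
  finally show ?thesis by (simp add: L2_fun_inner_def)
qed

text \<open>Bessel's inequality for the rows of the kernel bounds the Hilbert-Schmidt norm.\<close>

lemma sum_ind_op_cut_kernel_le:
  assumes C: "compact C" and I: "finite I" and \<xi>: "\<And>i. i \<in> I \<Longrightarrow> \<xi> i \<in> L2_fun \<nu>"
    and orth: "\<And>i j. i \<in> I \<Longrightarrow> j \<in> I \<Longrightarrow> L2_fun_inner \<nu> (\<xi> i) (\<xi> j) = (if i = j then 1 else 0)"
    and row: "\<And>y. c0_apply f y \<noteq> 0 \<Longrightarrow>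
      (\<integral>\<^sup>+t. indicator C t * ennreal ((cmod (c0_apply g (act (- t) y)))\<^sup>2) \<partial>\<mu>) \<le> ennreal r"
  shows "(\<Sum>i\<in>I. ennreal ((L2_norm \<nu> (ind_op (cut_kernel C f g) (\<xi> i)))\<^sup>2)) \<le>
    ennreal r * (\<integral>\<^sup>+s. ennreal ((cmod (c0_apply f (act s x)))\<^sup>2) \<partial>\<nu>)"
proof -
  let ?c = "cut_kernel C f g"
  have c: "integrable \<mu> ?c" by (rule cut_kernel_integrable[OF C])
  note [measurable] = integrable_\<mu>_measurable[OF c]
  have meas: "\<xi> i \<in> borel_measurable borel" if "i \<in> I" for i using L2_fun_measurable[OF \<xi>[OF that]] .
  have "(\<Sum>i\<in>I. ennreal ((L2_norm \<nu> (ind_op ?c (\<xi> i)))\<^sup>2)) =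
      (\<Sum>i\<in>I. \<integral>\<^sup>+s. ennreal ((cmod (ind_op ?c (\<xi> i) s))\<^sup>2) \<partial>\<nu>)"
    by (intro sum.cong refl L2_norm_eq_nn_integral ind_op_L2 c \<xi>)
  also have "\<dots> = (\<integral>\<^sup>+s. (\<Sum>i\<in>I. ennreal ((cmod (ind_op ?c (\<xi> i) s))\<^sup>2)) \<partial>\<nu>)"
    by (intro nn_integral_sum[symmetric]) (use L2_funD(1)[OF ind_op_L2[OF c \<xi>]] in auto)
  also have "\<dots> \<le> (\<integral>\<^sup>+s. ennreal r * ennreal ((cmod (c0_apply f (act s x)))\<^sup>2) \<partial>\<nu>)"
  proof (rule nn_integral_mono)
    fix s
    let ?k = "cut_vec C g s"
    have k: "?k \<in> L2_fun \<nu>" by (rule cut_vec_L2[OF C])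
    have "(\<Sum>i\<in>I. ennreal ((cmod (ind_op ?c (\<xi> i) s))\<^sup>2)) =
        ennreal ((cmod (c0_apply f (act s x)))\<^sup>2 * (\<Sum>i\<in>I. (cmod (L2_fun_inner \<nu> ?k (\<xi> i)))\<^sup>2))"
    proof -
      have "cmod (ind_op ?c (\<xi> i) s) = cmod (c0_apply f (act s x)) * cmod (L2_fun_inner \<nu> ?k (\<xi> i))" if "i \<in> I" for i
        unfolding ind_op_cut_kernel[OF C meas[OF that]] norm_mult
        by (metis L2_fun_inner_cnj complex_mod_cnj)
      then show ?thesis by (simp add: sum_distrib_left power_mult_distrib)
    qed
    also have "\<dots> \<le> ennreal ((cmod (c0_apply f (act s x)))\<^sup>2 * (L2_norm \<nu> ?k)\<^sup>2)"
      by (intro ennreal_leI mult_left_mono L2_Bessel I \<xi> k orth) auto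
    also have "\<dots> = ennreal ((cmod (c0_apply f (act s x)))\<^sup>2) * ennreal ((L2_norm \<nu> ?k)\<^sup>2)"
      by (rule ennreal_mult) auto
    also have "\<dots> \<le> ennreal r * ennreal ((cmod (c0_apply f (act s x)))\<^sup>2)"
    proof (cases "c0_apply f (act s x) = 0")
      case False
      then have "ennreal ((L2_norm \<nu> ?k)\<^sup>2) \<le> ennreal r"
        unfolding L2_norm_eq_nn_integral[OF k] cut_vec_nn_norm[OF C] by (rule row)
      then show ?thesis by (subst mult.commute) (rule mult_right_mono, simp_all)
    qed simp
    finally show "(\<Sum>i\<in>I. ennreal ((cmod (ind_op ?c (\<xi> i) s))\<^sup>2)) \<le> ennreal r * ennreal ((cmod (c0_apply f (act s x)))\<^sup>2)" .
  qed
  also have "\<dots> = ennreal r * (\<integral>\<^sup>+s. ennreal ((cmod (c0_apply f (act s x)))\<^sup>2) \<partial>\<nu>)"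
    by (rule nn_integral_cmult) measurable
  finally show ?thesis .
qed

end

section \<open>Indicators of countable disjoint unions\<close>

lemma sum_indicator_disjoint:
  fixes A :: "nat \<Rightarrow> 'a set"
  assumes "disjoint_family A"
  shows "(\<Sum>i<n. indicator (A i) s) = (indicator (\<Union>i<n. A i) s :: 'b::semiring_1)"
proof (induction n)
  case (Suc n)
  have "A n \<inter> A i = {}" if "i < n" for i
    using assms that by (simp add: disjoint_family_on_def)
  then have "A n \<inter> (\<Union>i<n. A i) = {}" by blast
  then show ?case unfolding sum.lessThan_Suc Suc.IH by (auto simp: indicator_def lessThan_Suc)
qed simp

lemma LIMSEQ_indicator_UN_disjoint:
  fixes A :: "nat \<Rightarrow> 'a set"
  assumes "disjoint_family A"
  shows "(\<lambda>n. \<Sum>i<n. indicator (A i) s) \<longlonglongrightarrow> (indicator (\<Union>i. A i) s :: 'b::{topological_space,semiring_1})"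
  unfolding sum_indicator_disjoint[OF assms] by (rule LIMSEQ_indicator_UN)

lemma sum_indicator_disjoint_le:
  fixes A :: "nat \<Rightarrow> 'a set"
  assumes "disjoint_family A" "(\<Union>i. A i) \<subseteq> W"
  shows "cmod (\<Sum>i<n. indicator (A i) s) \<le> cmod (indicator W s)"
  unfolding sum_indicator_disjoint[OF assms(1)] using assms(2) by (auto simp: indicator_def)

context induced_rep begin

section \<open>Density of \<open>C\<^sub>0(X)\<close> along the orbit\<close>

definition orbit_fun :: "'x c0 \<Rightarrow> 'g \<Rightarrow> complex" where
  "orbit_fun g s = c0_apply g (act s x)"

text \<open>Membership in the L^2-closure of the functions g_x that vanish off a compact set of the
  group. Vanishing there makes g_x square-integrable, which membership of g in C_0(X) alone does not
  ensure, and it later yields a compact cutoff set C.\<close>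

definition orbit_approx :: "('g \<Rightarrow> complex) \<Rightarrow> bool" where
  "orbit_approx \<xi> \<longleftrightarrow> \<xi> \<in> L2_fun \<nu> \<and>
     (\<forall>e>0. \<exists>g K. compact K \<and> (\<forall>s. s \<notin> K \<longrightarrow> orbit_fun g s = 0) \<and>
        L2_norm \<nu> (\<lambda>s. orbit_fun g s - \<xi> s) < e)"

lemma indicator_L2:
  assumes "A \<in> sets borel" "emeasure \<nu> A < \<infinity>"
  shows "(indicator A :: 'g \<Rightarrow> complex) \<in> L2_fun \<nu>"
proof -
  have "(cmod (indicator A s))\<^sup>2 = indicat_real A s" for s by (simp add: indicator_def)
  then show ?thesis using assms by (simp add: L2_fun_def less_top)
qed

lemma measurable_orbit_fun [measurable]: "orbit_fun g \<in> borel_measurable borel"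
  unfolding orbit_fun_def by measurable

lemma orbit_fun_L2:
  assumes K: "compact K" and 0: "\<And>s. s \<notin> K \<Longrightarrow> orbit_fun g s = 0"
  shows "orbit_fun g \<in> L2_fun \<nu>"
proof (rule L2_fun_dominated)
  show "(indicator K :: 'g \<Rightarrow> complex) \<in> L2_fun \<nu>"
    by (intro indicator_L2 borel_compact emeasure_compact_finite K)
  have "cmod (orbit_fun g s) \<le> norm g * cmod (indicator K s)" for s
    using 0[of s] norm_c0_apply_le[of g "act s x"] by (auto simp: indicator_def orbit_fun_def)
  then show "AE s in \<nu>. cmod (orbit_fun g s) \<le> norm g * cmod (indicator K s)" by simp
qed measurable

lemma orbit_approx_L2: "orbit_approx \<xi> \<Longrightarrow> \<xi> \<in> L2_fun \<nu>"
  by (simp add: orbit_approx_def)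

lemma orbit_approxE:
  assumes "orbit_approx \<xi>" "e > 0"
  obtains g K where "compact K" "\<And>s. s \<notin> K \<Longrightarrow> orbit_fun g s = 0"
    "L2_norm \<nu> (\<lambda>s. orbit_fun g s - \<xi> s) < e"
  using assms unfolding orbit_approx_def by metis

lemma orbit_approx_orbit_fun:
  assumes "compact K" "\<And>s. s \<notin> K \<Longrightarrow> orbit_fun g s = 0"
  shows "orbit_approx (orbit_fun g)"
  unfolding orbit_approx_def using assms orbit_fun_L2[OF assms]
  by (auto simp: L2_norm_zero intro!: exI[of _ g] exI[of _ K])

lemma orbit_approx_closed:
  assumes \<xi>: "\<xi> \<in> L2_fun \<nu>"
    and "\<And>e. e > 0 \<Longrightarrow> \<exists>\<eta>. orbit_approx \<eta> \<and> L2_norm \<nu> (\<lambda>s. \<eta> s - \<xi> s) < e"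
  shows "orbit_approx \<xi>"
  unfolding orbit_approx_def
proof (intro conjI allI impI \<xi>)
  fix e :: real assume "e > 0"
  then obtain \<eta> where \<eta>: "orbit_approx \<eta>" "L2_norm \<nu> (\<lambda>s. \<eta> s - \<xi> s) < e / 2"
    using assms(2)[of "e/2"] by auto
  obtain g K where g: "compact K" "\<And>s. s \<notin> K \<Longrightarrow> orbit_fun g s = 0"
    "L2_norm \<nu> (\<lambda>s. orbit_fun g s - \<eta> s) < e / 2"
    using orbit_approxE[OF \<eta>(1) half_gt_zero[OF \<open>e > 0\<close>]] by metis
  have "L2_norm \<nu> (\<lambda>s. (orbit_fun g s - \<eta> s) + (\<eta> s - \<xi> s)) \<le>
      L2_norm \<nu> (\<lambda>s. orbit_fun g s - \<eta> s) + L2_norm \<nu> (\<lambda>s. \<eta> s - \<xi> s)"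
    using orbit_approx_L2[OF \<eta>(1)] orbit_fun_L2[OF g(1,2)] \<xi>
    by (intro L2_norm_triangle L2_fun_diff) auto
  then have "L2_norm \<nu> (\<lambda>s. orbit_fun g s - \<xi> s) < e" using \<eta>(2) g(3) by simp
  then show "\<exists>g K. compact K \<and> (\<forall>s. s \<notin> K \<longrightarrow> orbit_fun g s = 0) \<and>
      L2_norm \<nu> (\<lambda>s. orbit_fun g s - \<xi> s) < e"
    using g by blast
qed

lemma orbit_approx_add:
  assumes \<xi>: "orbit_approx \<xi>" and \<zeta>: "orbit_approx \<zeta>"
  shows "orbit_approx (\<lambda>s. \<xi> s + \<zeta> s)"
  unfolding orbit_approx_def
proof (intro conjI allI impI L2_fun_add orbit_approx_L2 \<xi> \<zeta>)
  fix e :: real assume "e > 0"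
  then have e: "e / 2 > 0" by simp
  obtain g K where g: "compact K" "\<And>s. s \<notin> K \<Longrightarrow> orbit_fun g s = 0"
    "L2_norm \<nu> (\<lambda>s. orbit_fun g s - \<xi> s) < e / 2"
    using orbit_approxE[OF \<xi> e] by metis
  obtain h L where h: "compact L" "\<And>s. s \<notin> L \<Longrightarrow> orbit_fun h s = 0"
    "L2_norm \<nu> (\<lambda>s. orbit_fun h s - \<zeta> s) < e / 2"
    using orbit_approxE[OF \<zeta> e] by metis
  have "L2_norm \<nu> (\<lambda>s. (orbit_fun g s - \<xi> s) + (orbit_fun h s - \<zeta> s)) \<le>
      L2_norm \<nu> (\<lambda>s. orbit_fun g s - \<xi> s) + L2_norm \<nu> (\<lambda>s. orbit_fun h s - \<zeta> s)"
    using orbit_approx_L2[OF \<xi>] orbit_approx_L2[OF \<zeta>] orbit_fun_L2[OF g(1,2)] orbit_fun_L2[OF h(1,2)]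
    by (intro L2_norm_triangle L2_fun_diff) auto
  moreover have "(orbit_fun g s - \<xi> s) + (orbit_fun h s - \<zeta> s) = orbit_fun (g + h) s - (\<xi> s + \<zeta> s)" for s
    by (simp add: orbit_fun_def)
  ultimately have "L2_norm \<nu> (\<lambda>s. orbit_fun (g + h) s - (\<xi> s + \<zeta> s)) < e" using g(3) h(3) by simp
  then show "\<exists>g K. compact K \<and> (\<forall>s. s \<notin> K \<longrightarrow> orbit_fun g s = 0) \<and>
      L2_norm \<nu> (\<lambda>s. orbit_fun g s - (\<xi> s + \<zeta> s)) < e"
    using g(1,2) h(1,2)
    by (intro exI[of _ "g + h"] exI[of _ "K \<union> L"]) (auto simp: orbit_fun_def compact_Un)
qed

lemma orbit_approx_zero: "orbit_approx (\<lambda>s. 0)"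
proof -
  have "orbit_fun 0 = (\<lambda>s. 0)" by (simp add: orbit_fun_def fun_eq_iff)
  then show ?thesis using orbit_approx_orbit_fun[of "{}" 0] by simp
qed

lemma orbit_approx_scale:
  assumes \<xi>: "orbit_approx \<xi>"
  shows "orbit_approx (\<lambda>s. c * \<xi> s)"
proof (cases "c = 0")
  case True
  then show ?thesis by (simp add: orbit_approx_zero)
next
  case False
  show ?thesis
    unfolding orbit_approx_def
  proof (intro conjI allI impI L2_fun_scale orbit_approx_L2 \<xi>)
    fix e :: real assume "e > 0"
    then have e: "e / cmod c > 0" using False by simp
    obtain g K where g: "compact K" "\<And>s. s \<notin> K \<Longrightarrow> orbit_fun g s = 0"
      "L2_norm \<nu> (\<lambda>s. orbit_fun g s - \<xi> s) < e / cmod c"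
      using orbit_approxE[OF \<xi> e] by metis
    have "orbit_fun (c0_scale c g) s - c * \<xi> s = c * (orbit_fun g s - \<xi> s)" for s
      by (simp add: orbit_fun_def algebra_simps)
    then have "L2_norm \<nu> (\<lambda>s. orbit_fun (c0_scale c g) s - c * \<xi> s) =
        cmod c * L2_norm \<nu> (\<lambda>s. orbit_fun g s - \<xi> s)"
      by (simp only: L2_norm_scale)
    then have "L2_norm \<nu> (\<lambda>s. orbit_fun (c0_scale c g) s - c * \<xi> s) < e"
      using g(3) False by (simp add: field_simps)
    then show "\<exists>g K. compact K \<and> (\<forall>s. s \<notin> K \<longrightarrow> orbit_fun g s = 0) \<and>
        L2_norm \<nu> (\<lambda>s. orbit_fun g s - c * \<xi> s) < e"
      using g(1,2) by (intro exI[of _ "c0_scale c g"] exI[of _ K]) (auto simp: orbit_fun_def)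
  qed
qed

lemma orbit_approx_sum:
  "(\<And>i. i \<in> I \<Longrightarrow> orbit_approx (\<xi> i)) \<Longrightarrow> orbit_approx (\<lambda>s. \<Sum>i\<in>I. \<xi> i s)"
  by (induction I rule: infinite_finite_induct) (auto intro: orbit_approx_zero orbit_approx_add)

text \<open>The density proof advances by such limits: Urysohn functions, disjoint unions, simple
  functions. Approximants and limit are bounded by |w|, so their difference is at most 2|w|; hence
  the majorant 4|w|^2.\<close>

lemma orbit_approx_dominated_limit:
  assumes \<xi>n: "\<And>n. orbit_approx (\<xi>n n)" and lim: "\<And>s. (\<lambda>n. \<xi>n n s) \<longlonglongrightarrow> \<xi> s"
    and w: "w \<in> L2_fun \<nu>" and bound: "\<And>n s. cmod (\<xi>n n s) \<le> cmod (w s)"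
  shows "orbit_approx \<xi>"
proof (rule orbit_approx_closed)
  have [measurable]: "\<xi>n n \<in> borel_measurable borel" for n
    by (rule L2_fun_measurable[OF orbit_approx_L2[OF \<xi>n]])
  have [measurable]: "\<xi> \<in> borel_measurable borel"
    by (rule borel_measurable_LIMSEQ_metric[OF _ lim]) measurable
  have bound': "cmod (\<xi> s) \<le> cmod (w s)" for s
    by (rule LIMSEQ_le_const2[OF tendsto_norm[OF lim]]) (use bound in auto)
  show \<xi>: "\<xi> \<in> L2_fun \<nu>"
    by (rule L2_fun_dominated[OF w, of _ 1]) (use bound' in auto)
  have "(\<lambda>n. \<integral>s. (cmod (\<xi>n n s - \<xi> s))\<^sup>2 \<partial>\<nu>) \<longlonglongrightarrow> (\<integral>s. 0 \<partial>\<nu>)"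
  proof (rule integral_dominated_convergence[where w = "\<lambda>s. 4 * (cmod (w s))\<^sup>2"])
    show "integrable \<nu> (\<lambda>s. 4 * (cmod (w s))\<^sup>2)" using L2_funD(2)[OF w] by simp
    have "(\<lambda>n. (cmod (\<xi>n n s - \<xi> s))\<^sup>2) \<longlonglongrightarrow> (cmod (\<xi> s - \<xi> s))\<^sup>2" for s
      by (intro tendsto_intros lim)
    then show "AE s in \<nu>. (\<lambda>n. (cmod (\<xi>n n s - \<xi> s))\<^sup>2) \<longlonglongrightarrow> 0" by simp
    fix n
    have "(cmod (\<xi>n n s - \<xi> s))\<^sup>2 \<le> 4 * (cmod (w s))\<^sup>2" for s
    proof -
      have "cmod (\<xi>n n s - \<xi> s) \<le> 2 * cmod (w s)"
        using norm_triangle_ineq4[of "\<xi>n n s" "\<xi> s"] bound[of n s] bound'[of s] by simp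
      then have "(cmod (\<xi>n n s - \<xi> s))\<^sup>2 \<le> (2 * cmod (w s))\<^sup>2" by (intro power_mono) auto
      then show ?thesis by (simp add: power_mult_distrib)
    qed
    then show "AE s in \<nu>. norm ((cmod (\<xi>n n s - \<xi> s))\<^sup>2) \<le> 4 * (cmod (w s))\<^sup>2" by simp
  qed measurable
  from tendsto_real_sqrt[OF this] have l: "(\<lambda>n. L2_norm \<nu> (\<lambda>s. \<xi>n n s - \<xi> s)) \<longlonglongrightarrow> 0"
    by (simp add: L2_norm_def)
  fix e :: real assume "e > 0"
  from order_tendstoD(2)[OF l this] obtain n where "L2_norm \<nu> (\<lambda>s. \<xi>n n s - \<xi> s) < e"
    by (auto simp: eventually_sequentially)
  then show "\<exists>\<eta>. orbit_approx \<eta> \<and> L2_norm \<nu> (\<lambda>s. \<eta> s - \<xi> s) < e" using \<xi>n by blast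
qed

lemma continuous_act: "continuous_on UNIV (\<lambda>s. act s y)" "continuous_on UNIV (act s)"
proof -
  have C: "continuous_on UNIV (\<lambda>(s, y). act s y)"
    using transformation_group by (simp add: transformation_group_def)
  show "continuous_on UNIV (\<lambda>s. act s y)"
    using continuous_on_compose2[OF C continuous_on_Pair[OF continuous_on_id[of UNIV] continuous_on_const[of UNIV y]]]
    by simp
  show "continuous_on UNIV (act s)"
    using continuous_on_compose2[OF C continuous_on_Pair[OF continuous_on_const[of UNIV s] continuous_on_id[of UNIV]]]
    by simp
qed

lemma act_zero: "act 0 y = y"
  using transformation_group by (simp add: transformation_group_def)

lemma act_minus_cancel: "act (- s) (act s y) = y" "act s (act (- s) y) = y"
  by (simp_all add: act_add[symmetric] act_zero)

lemma locally_compact_X: "locally_compact_space (euclidean :: 'x topology)"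
  using transformation_group by (simp add: transformation_group_def)

lemma open_orbit_preimage: "open V \<Longrightarrow> open {s. act s y \<in> V}"
  using continuous_act(1)[of y] by (simp add: continuous_on_open_vimage vimage_def)

lemma orbit_preimage_finite:
  assumes "compact (closure {s. act s x \<in> V})"
  shows "emeasure \<nu> {s. act s x \<in> V} < \<infinity>"
proof -
  have "emeasure \<nu> {s. act s x \<in> V} \<le> emeasure \<nu> (closure {s. act s x \<in> V})"
    by (intro emeasure_mono closure_subset) auto
  then show ?thesis using emeasure_compact_finite[OF assms] by (rule le_less_trans)
qed

text \<open>An arbitrary open subset of W is the preimage of an open set of X: remove from V the
  image of the compact set K - O', which is compact and hence closed. Freeness makes the orbit map
  injective, so no point of W \<inter> O' is lost. Urysohn functions for the resulting U then
  converge to the indicator along the orbit.\<close>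

lemma orbit_approx_indicator_open:
  assumes free: "free_action act" and V: "open V" "compact (closure {s. act s x \<in> V})" and O: "open O'"
  shows "orbit_approx (indicator ({s. act s x \<in> V} \<inter> O'))"
proof -
  define W where "W = {s. act s x \<in> V}"
  define K where "K = closure W"
  have W: "open W" unfolding W_def by (rule open_orbit_preimage[OF V(1)])
  have K: "compact K" "W \<subseteq> K" using V(2) closure_subset[of W] by (simp_all add: K_def W_def)
  define U where "U = V - (\<lambda>s. act s x) ` (K - O')"
  have "compact ((\<lambda>s. act s x) ` (K - O'))"
    by (intro compact_continuous_image continuous_on_subset[OF continuous_act(1)] compact_diff K O) auto
  then have U: "open U" unfolding U_def by (intro open_Diff V(1) compact_imp_closed)
  have inj: "s = s'" if "act s x = act s' x" for s s'
  proof -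
    have "act (- s' + s) x = x" by (simp add: act_add that act_minus_cancel)
    then have "- s' + s = 0" using free unfolding free_action_def by blast
    then show ?thesis by (metis add.inverse_inverse add_eq_0_iff2 neg_eq_iff_add_eq_0)
  qed
  have eq: "{s. act s x \<in> U} = W \<inter> O'"
  proof (intro equalityI subsetI)
    fix s assume "s \<in> {s. act s x \<in> U}"
    then have "s \<in> W" "s \<notin> K - O'" by (auto simp: U_def W_def)
    then show "s \<in> W \<inter> O'" using K(2) by blast
  next
    fix s assume s: "s \<in> W \<inter> O'"
    have "act s x \<notin> (\<lambda>s. act s x) ` (K - O')"
    proof
      assume "act s x \<in> (\<lambda>s. act s x) ` (K - O')"
      then obtain s' where "s' \<in> K - O'" "act s x = act s' x" by blast
      then show False using inj[of s s'] s by simp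
    qed
    then show "s \<in> {s. act s x \<in> U}" using s by (simp add: U_def W_def)
  qed
  obtain g :: "nat \<Rightarrow> 'x c0" and h :: "nat \<Rightarrow> 'x \<Rightarrow> real"
    where gh: "\<And>n y. c0_apply (g n) y = of_real (h n y)" "\<And>n y. 0 \<le> h n y" "\<And>n y. h n y \<le> 1"
      "\<And>n y. y \<notin> U \<Longrightarrow> h n y = 0" "\<And>y. (\<lambda>n. h n y) \<longlonglongrightarrow> indicator U y"
    by (rule c0_approx_indicator[OF locally_compact_X U]) blast
  have [measurable]: "W \<in> sets borel" using W by simp
  show ?thesis
    unfolding W_def[symmetric]
  proof (rule orbit_approx_dominated_limit[where \<xi>n = "\<lambda>n. orbit_fun (g n)"])
    have W_iff: "act s x \<in> U \<longleftrightarrow> s \<in> W \<inter> O'" for s using eq by blast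
    show "orbit_approx (orbit_fun (g n))" for n
    proof (rule orbit_approx_orbit_fun[OF K(1)])
      fix s assume "s \<notin> K"
      then have "act s x \<notin> U" using K(2) W_iff by blast
      then show "orbit_fun (g n) s = 0" by (simp add: orbit_fun_def gh)
    qed
    show "(\<lambda>n. orbit_fun (g n) s) \<longlonglongrightarrow> indicator (W \<inter> O') s" for s
    proof -
      have "(\<lambda>n. complex_of_real (h n (act s x))) \<longlonglongrightarrow> of_real (indicator U (act s x))"
        by (intro tendsto_of_real gh(5))
      moreover have "complex_of_real (indicator U (act s x)) = indicator (W \<inter> O') s"
        using W_iff[of s] by (simp add: indicator_def)
      ultimately show ?thesis by (simp only: orbit_fun_def gh(1))
    qed
    show "(indicator W :: 'g \<Rightarrow> complex) \<in> L2_fun \<nu>"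
      using orbit_preimage_finite[OF V(2)] by (intro indicator_L2) (auto simp: W_def[symmetric])
    show "cmod (orbit_fun (g n) s) \<le> cmod (indicator W s)" for n s
      using gh(2,3)[of n "act s x"] gh(4)[of "act s x" n] W_iff[of s] by (auto simp: orbit_fun_def gh(1) indicator_def)
  qed
qed

text \<open>Induction from the open sets through complements and disjoint unions. Intersecting with
  W, which has finite measure, keeps all indicators square-integrable: complements are differences
  from the indicator of W, and that indicator dominates the partial sums of disjoint unions.\<close>

lemma orbit_approx_indicator_borel:
  assumes free: "free_action act" and V: "open V" "compact (closure {s. act s x \<in> V})"
    and E: "E \<in> sets borel"
  shows "orbit_approx (indicator ({s. act s x \<in> V} \<inter> E))"
proof -
  define W where "W = {s. act s x \<in> V}"
  have [measurable]: "W \<in> sets borel" using open_orbit_preimage[OF V(1)] by (simp add: W_def)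
  have WL2: "(indicator W :: 'g \<Rightarrow> complex) \<in> L2_fun \<nu>"
    using orbit_preimage_finite[OF V(2)] by (intro indicator_L2) (auto simp: W_def[symmetric])
  have E': "E \<in> sigma_sets UNIV {S. open S}" using E by (simp add: borel_def)
  have "Int_stable {S :: 'g set. open S}" "{S :: 'g set. open S} \<subseteq> Pow UNIV"
    by (auto simp: Int_stable_def)
  then have "orbit_approx (indicator (W \<inter> E))"
    using E'
  proof (induction rule: sigma_sets_induct_disjoint)
    case (basic A)
    then show ?case unfolding W_def using orbit_approx_indicator_open[OF free V] by simp
  next
    case empty
    have "(indicator (W \<inter> {}) :: 'g \<Rightarrow> complex) = (\<lambda>s. 0)" by auto
    then show ?case using orbit_approx_zero by simp
  next
    case (compl A)
    have "orbit_approx (\<lambda>s. indicator (W \<inter> UNIV) s + (-1) * indicator (W \<inter> A) s)"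
      using orbit_approx_indicator_open[OF free V open_UNIV]
      by (intro orbit_approx_add orbit_approx_scale compl) (simp add: W_def)
    moreover have "(\<lambda>s. indicator (W \<inter> UNIV) s + (-1) * indicator (W \<inter> A) s) =
        (indicator (W \<inter> (UNIV - A)) :: 'g \<Rightarrow> complex)"
      by (auto simp: indicator_def fun_eq_iff)
    ultimately show ?case by simp
  next
    case (union A)
    have disj: "disjoint_family (\<lambda>i. W \<inter> A i)" using union(1) by (auto simp: disjoint_family_on_def)
    show ?case
    proof (rule orbit_approx_dominated_limit[where w = "indicator W"])
      show "orbit_approx (\<lambda>s. \<Sum>i<n. indicator (W \<inter> A i) s)" for n
        by (intro orbit_approx_sum union)
      show "(\<lambda>n. \<Sum>i<n. indicator (W \<inter> A i) s) \<longlonglongrightarrow> (indicator (W \<inter> \<Union> (range A)) s :: complex)" for s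
        using LIMSEQ_indicator_UN_disjoint[OF disj, of s] by simp
      show "cmod (\<Sum>i<n. indicator (W \<inter> A i) s) \<le> cmod (indicator W s)" for n s
        using sum_indicator_disjoint_le[OF disj, where W = W and n = n and s = s] by auto
    qed (rule WL2)
  qed
  then show ?thesis by (simp add: W_def)
qed

text \<open>\<open>W t\<close> is the left translate of the preimage of V by t and is itself the
  preimage of the open set \<open>V' t\<close>, so the preceding lemma applies on it. Making a
  countable subcover disjoint cuts any set of finite measure into pieces that each lie in one
  \<open>W t\<close>; simple functions then exhaust L^2.\<close>

lemma orbit_approx_all:
  assumes free: "free_action act" and V: "open V" "x \<in> V" "compact (closure {s. act s x \<in> V})"
    and \<xi>: "\<xi> \<in> L2_fun \<nu>"
  shows "orbit_approx \<xi>"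
proof -
  define V' where "V' t = {y. act (- t) y \<in> V}" for t
  define W where "W t = {s. act s x \<in> V' t}" for t
  have V'_open: "open (V' t)" for t
    using V(1) continuous_act(2)[of "- t"] by (simp add: V'_def continuous_on_open_vimage vimage_def)
  have W_eq: "W t = (\<lambda>s. t + s) ` {s. act s x \<in> V}" for t
  proof (intro equalityI subsetI)
    fix s assume "s \<in> W t"
    then show "s \<in> (\<lambda>s. t + s) ` {s. act s x \<in> V}"
      by (intro image_eqI[of _ _ "- t + s"]) (auto simp: W_def V'_def act_add add.assoc[symmetric])
  qed (auto simp: W_def V'_def act_add act_minus_cancel)
  have W_compact: "compact (closure (W t))" for t
  proof -
    have "compact ((\<lambda>s. t + s) ` closure {s. act s x \<in> V})"
      by (intro compact_continuous_image continuous_intros V)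
    moreover have "W t \<subseteq> (\<lambda>s. t + s) ` closure {s. act s x \<in> V}"
      unfolding W_eq by (intro image_mono closure_subset)
    ultimately show ?thesis
      using closure_minimal compact_imp_closed compact_Int_closed closed_closure inf.absorb2 by metis
  qed
  have W_open: "open (W t)" for t unfolding W_def by (rule open_orbit_preimage[OF V'_open])
  have "t \<in> W t" for t using V(2) by (simp add: W_def V'_def act_minus_cancel)
  then have cover: "\<Union>(range W) = UNIV" by blast
  obtain \<F> where \<F>: "\<F> \<subseteq> range W" "countable \<F>" "\<Union>\<F> = \<Union>(range W)"
    using Lindelof[of "range W"] W_open by (metis (no_types, lifting) rangeE)
  then have "\<F> \<noteq> {}" using cover by auto
  then obtain F :: "nat \<Rightarrow> 'g set" where F: "range F = \<F>"
    using \<F>(2) range_from_nat_into by metis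
  then have "\<forall>i. \<exists>t. F i = W t" using \<F>(1) by blast
  then obtain t where t: "\<And>i. F i = W (t i)" by metis
  have UF: "(\<Union>i. F i) = UNIV" using F \<F>(3) cover by simp
  have ind: "orbit_approx (indicator E)" if E [measurable]: "E \<in> sets borel"
    and EL2: "(indicator E :: 'g \<Rightarrow> complex) \<in> L2_fun \<nu>" for E
  proof -
    define A where "A i = E \<inter> disjointed F i" for i
    have F_sets: "F i \<in> sets borel" for i unfolding t using W_open by simp
    have [measurable]: "disjointed F i \<in> sets borel" for i
      using sets.range_disjointed_sets[of F borel] F_sets by (auto simp: image_subset_iff)
    have A_sets: "A i \<in> sets borel" for i unfolding A_def by measurable
    have disj: "disjoint_family A"
      using disjoint_family_disjointed[of F] by (auto simp: A_def disjoint_family_on_def)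
    have UA: "(\<Union>i. A i) = E" using UF UN_disjointed_eq[of F] by (auto simp: A_def)
    have "orbit_approx (indicator (A i))" for i
    proof -
      have "A i = {s. act s x \<in> V' (t i)} \<inter> A i"
        using disjointed_subset[of F i] t[of i] unfolding A_def W_def by blast
      then show ?thesis
        using orbit_approx_indicator_borel[OF free V'_open _ A_sets, of "t i" i] W_compact[of "t i"]
        by (simp add: W_def)
    qed
    then have "orbit_approx (\<lambda>s. \<Sum>i<n. indicator (A i) s)" for n by (intro orbit_approx_sum)
    then show ?thesis
    proof (rule orbit_approx_dominated_limit)
      show "(\<lambda>n. \<Sum>i<n. indicator (A i) s) \<longlonglongrightarrow> (indicator E s :: complex)" for s
        using LIMSEQ_indicator_UN_disjoint[OF disj, of s] UA by simp
      show "cmod (\<Sum>i<n. indicator (A i) s) \<le> cmod (indicator E s)" for n s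
        using sum_indicator_disjoint_le[OF disj, where W = E and n = n and s = s] UA by auto
    qed (rule EL2)
  qed
  have [measurable]: "\<xi> \<in> borel_measurable borel" by (rule L2_fun_measurable[OF \<xi>])
  obtain S where S: "\<And>i. simple_function borel (S i)" "\<And>s. (\<lambda>i. S i s) \<longlonglongrightarrow> \<xi> s"
    "\<And>i s. cmod (S i s) \<le> 2 * cmod (\<xi> s)"
    using borel_measurable_implies_sequence_metric[of \<xi> borel 0] by (auto simp: dist_norm)
  have S_approx: "orbit_approx (S i)" for i
  proof -
    have fin: "finite (range (S i))" using simple_functionD(1)[OF S(1)[of i]] by simp
    have [measurable]: "S i \<in> borel_measurable borel" by (rule borel_measurable_simple_function[OF S(1)])
    have SL2: "S i \<in> L2_fun \<nu>" by (rule L2_fun_dominated[OF \<xi>]) (use S(3) in auto)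
    have "orbit_approx (\<lambda>s. y * indicator (S i -` {y}) s)" for y
    \<comment> \<open>The level set of a nonzero value has finite measure, since its indicator is at
      most |S i| / |y|. The level set of 0 may have infinite measure, but it contributes
      nothing.\<close>
    proof (cases "y = 0")
      case False
      have meas: "S i -` {y} \<in> sets borel"
        using measurable_sets[of "S i" borel borel "{y}"] by simp
      have "(indicator (S i -` {y}) :: 'g \<Rightarrow> complex) \<in> L2_fun \<nu>"
      proof (rule L2_fun_dominated[OF SL2])
        show "AE s in \<nu>. cmod (indicator (S i -` {y}) s) \<le> (1 / cmod y) * cmod (S i s)"
          using False by (auto simp: indicator_def)
      qed (use meas in measurable)
      then show ?thesis using meas by (intro orbit_approx_scale ind)
    qed (simp add: orbit_approx_zero)
    then have "orbit_approx (\<lambda>s. \<Sum>y\<in>range (S i). y * indicator (S i -` {y}) s)"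
      by (intro orbit_approx_sum)
    moreover have "(\<Sum>y\<in>range (S i). y * indicator (S i -` {y}) s) = S i s" for s
    proof -
      have "(\<Sum>y\<in>range (S i). y * indicator (S i -` {y}) s) = (\<Sum>y\<in>range (S i). if y = S i s then y else 0)"
        by (rule sum.cong) (auto simp: indicator_def)
      then show ?thesis using fin by simp
    qed
    ultimately show ?thesis by simp
  qed
  show ?thesis
    by (rule orbit_approx_dominated_limit[OF S_approx S(2) L2_fun_scale[OF \<xi>, of 2]])
       (use S(3) in \<open>simp add: norm_mult\<close>)
qed

lemma orbit_fun_correlation:
  assumes approx: "orbit_approx u" and u: "L2_norm \<nu> u = 1" and e: "0 < e" "e < 1"
  obtains g K where "compact K" "\<And>s. s \<notin> K \<Longrightarrow> orbit_fun g s = 0" "L2_norm \<nu> (orbit_fun g) \<le> 1"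
    "1 - e \<le> cmod (L2_fun_inner \<nu> u (orbit_fun g))"
proof -
  \<comment> \<open>The approximant g has norm at most 1 + d and correlation at least 1 - d with u.
    Dividing by 1 + d restores norm at most 1, and (1 - d) / (1 + d) \<ge> 1 - 2d = 1 - e.\<close>
  define d where "d = e / 2"
  have d: "0 < d" "d < 1/2" using e by (auto simp: d_def)
  have uL: "u \<in> L2_fun \<nu>" by (rule orbit_approx_L2[OF approx])
  obtain g K where K: "compact K" and g0: "\<And>s. s \<notin> K \<Longrightarrow> orbit_fun g s = 0"
    and gd: "L2_norm \<nu> (\<lambda>s. orbit_fun g s - u s) < d"
    using orbit_approxE[OF approx d(1)] by metis
  have gL: "orbit_fun g \<in> L2_fun \<nu>" by (rule orbit_fun_L2[OF K g0])
  have gu: "(\<lambda>s. orbit_fun g s - u s) \<in> L2_fun \<nu>" by (rule L2_fun_diff[OF gL uL])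
  have norm: "L2_norm \<nu> (orbit_fun g) \<le> 1 + d"
    using L2_norm_triangle[OF gu uL] gd u by simp
  have "L2_fun_inner \<nu> (orbit_fun g) u = L2_fun_inner \<nu> (\<lambda>s. orbit_fun g s - u s) u + 1"
    using L2_fun_inner_diff_left[OF gL uL uL] by (simp add: L2_fun_inner_self u)
  moreover have "cmod (L2_fun_inner \<nu> (\<lambda>s. orbit_fun g s - u s) u) \<le> d"
    using L2_Cauchy_Schwarz[OF gu uL] gd u by simp
  ultimately have corr: "1 - d \<le> cmod (L2_fun_inner \<nu> (orbit_fun g) u)"
    using norm_triangle_ineq4[of "L2_fun_inner \<nu> (orbit_fun g) u" "L2_fun_inner \<nu> (\<lambda>s. orbit_fun g s - u s) u"]
    by simp
  define h where "h = c0_scale (of_real (1 / (1 + d))) g"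
  have h: "orbit_fun h = (\<lambda>s. of_real (1 / (1 + d)) * orbit_fun g s)"
    by (simp add: h_def orbit_fun_def fun_eq_iff)
  have c: "cmod (of_real (1 / (1 + d))) = 1 / (1 + d)" using d by (simp only: norm_of_real) simp
  have "1 - e \<le> (1 - d) / (1 + d)" using d by (simp add: d_def field_simps)
  also have "\<dots> \<le> 1 / (1 + d) * cmod (L2_fun_inner \<nu> (orbit_fun g) u)"
    using corr d by (simp add: divide_right_mono)
  also have "\<dots> = cmod (L2_fun_inner \<nu> (orbit_fun h) u)"
    unfolding h L2_fun_inner_scale_left norm_mult c ..
  also have "\<dots> = cmod (L2_fun_inner \<nu> u (orbit_fun h))"
    by (metis L2_fun_inner_cnj complex_mod_cnj)
  finally have "1 - e \<le> cmod (L2_fun_inner \<nu> u (orbit_fun h))" .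
  moreover have "L2_norm \<nu> (orbit_fun h) \<le> 1"
    unfolding h L2_norm_scale c using norm d by (simp add: field_simps)
  ultimately show ?thesis using that[of K h] K g0 by (simp add: h)
qed


section \<open>Kernels with controlled rows\<close>

definition row_norm :: "'g set \<Rightarrow> 'x c0 \<Rightarrow> 'x \<Rightarrow> ennreal" where
  "row_norm C g y = (\<integral>\<^sup>+t. indicator C t * ennreal ((cmod (c0_apply g (act (- t) y)))\<^sup>2) \<partial>\<mu>)"

lemma row_norm_orbit_le:
  assumes C: "compact C" and g: "orbit_fun g \<in> L2_fun \<nu>"
  shows "row_norm C g (act s x) \<le> ennreal ((L2_norm \<nu> (orbit_fun g))\<^sup>2)"
  unfolding row_norm_def cut_vec_nn_norm[OF C, symmetric] L2_norm_eq_nn_integral[OF g]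
  by (intro nn_integral_mono) (auto simp: cut_vec_def orbit_fun_def indicator_def)

text \<open>The integral depends continuously on y by dominated convergence: C has finite measure
  and |g|^2 is bounded by \<parallel>g\<parallel>^2. Convergent sequences suffice because X is first
  countable.\<close>

lemma open_row_norm_less:
  assumes C: "compact C" and c: "0 \<le> c"
  shows "open {y. row_norm C g y < ennreal c}"
proof -
  have [measurable]: "C \<in> sets borel" by (rule borel_compact[OF C])
  define I where "I y = (\<integral>t. indicator C t * (cmod (c0_apply g (act (- t) y)))\<^sup>2 \<partial>\<mu>)" for y
  have dom: "integrable \<mu> (\<lambda>t. (norm g)\<^sup>2 * indicator C t)"
    using emeasure_\<mu>_compact_finite[OF C] by (intro integrable_mult_right integrable_real_indicator) auto
  have le: "norm (indicator C t * (cmod (c0_apply g (act (- t) y)))\<^sup>2) \<le> (norm g)\<^sup>2 * indicator C t" for t y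
    by (auto simp: indicator_def intro!: power_mono norm_c0_apply_le)
  have int: "integrable \<mu> (\<lambda>t. indicator C t * (cmod (c0_apply g (act (- t) y)))\<^sup>2)" for y
    by (rule Bochner_Integration.integrable_bound[OF dom])
       (measurable, use le in \<open>auto intro!: AE_I2 order_trans[OF le] simp: abs_mult\<close>)
  have "row_norm C g y = ennreal (I y)" for y
  proof -
    have "row_norm C g y = (\<integral>\<^sup>+t. ennreal (indicator C t * (cmod (c0_apply g (act (- t) y)))\<^sup>2) \<partial>\<mu>)"
      unfolding row_norm_def by (intro nn_integral_cong) (auto simp: indicator_def)
    then show ?thesis unfolding I_def by (simp add: nn_integral_eq_integral[OF int])
  qed
  moreover have "0 \<le> I y" for y unfolding I_def by (rule Bochner_Integration.integral_nonneg) simp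
  ultimately have eq: "{y. row_norm C g y < ennreal c} = {y. I y < c}"
    by (simp add: ennreal_less_iff)
  have I_lim: "(\<lambda>n. I (Y n)) \<longlonglongrightarrow> I y" if Y: "Y \<longlonglongrightarrow> y" for Y y
    unfolding I_def
  proof (rule integral_dominated_convergence[OF _ _ dom])
    have "(\<lambda>n. c0_apply g (act (- t) (Y n))) \<longlonglongrightarrow> c0_apply g (act (- t) y)" for t
    proof (rule continuous_on_tendsto_compose[OF continuous_c0_apply[of UNIV g]])
      show "(\<lambda>n. act (- t) (Y n)) \<longlonglongrightarrow> act (- t) y"
        by (rule continuous_on_tendsto_compose[OF continuous_act(2) Y]) auto
    qed auto
    then show "AE t in \<mu>. (\<lambda>n. indicator C t * (cmod (c0_apply g (act (- t) (Y n))))\<^sup>2)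
        \<longlonglongrightarrow> indicator C t * (cmod (c0_apply g (act (- t) y)))\<^sup>2"
      by (intro AE_I2 tendsto_intros)
  qed (measurable, use le in auto)
  show ?thesis
    unfolding eq
  proof (subst open_subopen, intro ballI)
    fix y assume "y \<in> {y. I y < c}"
    then have "\<forall>\<^sub>F n in sequentially. I (Y n) < c" if "Y \<longlonglongrightarrow> y" for Y
      using order_tendstoD(2)[OF I_lim[OF that]] by simp
    then have "\<forall>\<^sub>F y in nhds y. I y < c"
      by (simp add: eventually_nhds_iff_sequentially)
    then show "\<exists>T. open T \<and> y \<in> T \<and> T \<subseteq> {y. I y < c}"
      unfolding eventually_nhds by (auto simp: subset_iff)
  qed
qed

text \<open>Where f does not vanish, the cutoff removes no nonzero value of g along this orbit, so
  row s is all of g_x and the operator is exactly of rank one.\<close>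

lemma ind_op_cut_kernel_orbit:
  assumes C: "compact C" and [measurable]: "u \<in> borel_measurable borel"
    and supp: "\<And>s v. orbit_fun f s \<noteq> 0 \<Longrightarrow> orbit_fun g v \<noteq> 0 \<Longrightarrow> s - v \<in> C"
  shows "ind_op (cut_kernel C f g) u s = L2_fun_inner \<nu> u (orbit_fun g) * orbit_fun f s"
proof (cases "orbit_fun f s = 0")
  case False
  then have "cut_vec C g s = orbit_fun g"
    using supp[of s] by (auto simp: cut_vec_def orbit_fun_def fun_eq_iff indicator_def)
  then show ?thesis by (simp add: ind_op_cut_kernel[OF C] orbit_fun_def)
qed (simp add: ind_op_cut_kernel[OF C] orbit_fun_def)

text \<open>The order of choices matters: g from u, then C from the two supports, then the open set
  Y of small rows from g and C, and only then f inside V \<inter> Y. The whole orbit of x lies in Y,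
  so the restriction to Y costs nothing along it.\<close>

lemma cut_kernel_exists:
  assumes free: "free_action act" and V: "open V" "x \<in> V" "compact (closure {s. act s x \<in> V})"
    and u: "u \<in> L2_fun \<nu>" "L2_norm \<nu> u = 1" and e: "0 < e" "e < 1"
  obtains C f g where "compact C" "\<And>y. y \<notin> V \<Longrightarrow> c0_apply f y = 0" "\<And>y. cmod (c0_apply f y) \<le> 1"
    "\<And>y. c0_apply f y \<noteq> 0 \<Longrightarrow> row_norm C g y \<le> ennreal (1 + e)"
    "(1 - e) ^ 3 * measure \<nu> {s. act s x \<in> V} \<le> (L2_norm \<nu> (ind_op (cut_kernel C f g) u))\<^sup>2"
proof -
  obtain g K' where K': "compact K'" and gK': "\<And>s. s \<notin> K' \<Longrightarrow> orbit_fun g s = 0"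
    and g1: "L2_norm \<nu> (orbit_fun g) \<le> 1" and gu: "1 - e \<le> cmod (L2_fun_inner \<nu> u (orbit_fun g))"
    using orbit_fun_correlation[OF orbit_approx_all[OF free V u(1)] u(2) e] by metis
  define W where "W = {s. act s x \<in> V}"
  define K where "K = closure W"
  have K: "compact K" "W \<subseteq> K" using V(3) closure_subset[of W] by (simp_all add: K_def W_def)
  define C where "C = (\<lambda>(s, t). s - t) ` (K \<times> K')"
  have C: "compact C"
    unfolding C_def case_prod_unfold
    by (intro compact_continuous_image compact_Times K(1) K' continuous_intros)
  define Y where "Y = {y. row_norm C g y < ennreal (1 + e)}"
  have Y: "open Y" unfolding Y_def using e by (intro open_row_norm_less C) auto
  have orbit_Y: "act s x \<in> Y" for s
  proof -
    have "row_norm C g (act s x) \<le> ennreal ((L2_norm \<nu> (orbit_fun g))\<^sup>2)"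
      by (rule row_norm_orbit_le[OF C orbit_fun_L2[OF K' gK']])
    also have "\<dots> \<le> ennreal 1" using g1 by (intro ennreal_leI) (simp add: power_le_one)
    also have "\<dots> < ennreal (1 + e)" using e by (intro ennreal_lessI) auto
    finally show ?thesis by (simp add: Y_def)
  qed
  obtain fn :: "nat \<Rightarrow> 'x c0" and h :: "nat \<Rightarrow> 'x \<Rightarrow> real"
    where fh: "\<And>n y. c0_apply (fn n) y = of_real (h n y)" "\<And>n y. 0 \<le> h n y" "\<And>n y. h n y \<le> 1"
      "\<And>n y. y \<notin> V \<inter> Y \<Longrightarrow> h n y = 0" "\<And>y. (\<lambda>n. h n y) \<longlonglongrightarrow> indicator (V \<inter> Y) y"
    by (rule c0_approx_indicator[OF locally_compact_X open_Int[OF V(1) Y]]) blast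
  have [measurable]: "W \<in> sets borel" using open_orbit_preimage[OF V(1)] by (simp add: W_def)
  have W_fin: "emeasure \<nu> W < \<infinity>" unfolding W_def by (rule orbit_preimage_finite[OF V(3)])
  have fW: "orbit_fun (fn n) s = 0" if "s \<notin> W" for n s
    using that fh(4)[of "act s x" n] by (simp add: W_def orbit_fun_def fh(1))
  have "(\<lambda>n. \<integral>s. (cmod (orbit_fun (fn n) s))\<^sup>2 \<partial>\<nu>) \<longlonglongrightarrow> (\<integral>s. indicator W s \<partial>\<nu>)"
  proof (rule integral_dominated_convergence[where w = "indicator W"])
    show "integrable \<nu> (indicat_real W)" using W_fin by (intro integrable_real_indicator) auto
    have "(\<lambda>n. (cmod (orbit_fun (fn n) s))\<^sup>2) \<longlonglongrightarrow> indicator W s" for s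
    proof -
      have "(\<lambda>n. (h n (act s x))\<^sup>2) \<longlonglongrightarrow> (indicator (V \<inter> Y) (act s x))\<^sup>2"
        by (intro tendsto_intros fh(5))
      moreover have "(indicator (V \<inter> Y) (act s x))\<^sup>2 = indicat_real W s"
        using orbit_Y[of s] by (simp add: indicator_def W_def)
      ultimately show ?thesis by (simp add: orbit_fun_def fh(1))
    qed
    then show "AE s in \<nu>. (\<lambda>n. (cmod (orbit_fun (fn n) s))\<^sup>2) \<longlonglongrightarrow> indicator W s" by simp
    fix n
    have "norm ((cmod (orbit_fun (fn n) s))\<^sup>2) \<le> indicator W s" for s
      using fh(2,3)[of n "act s x"] fW[of s n] by (auto simp: orbit_fun_def fh(1) indicator_def power_le_one)
    then show "AE s in \<nu>. norm ((cmod (orbit_fun (fn n) s))\<^sup>2) \<le> indicator W s" by simp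
  qed measurable
  then have lim: "(\<lambda>n. (L2_norm \<nu> (orbit_fun (fn n)))\<^sup>2) \<longlonglongrightarrow> measure \<nu> W"
    by (simp add: L2_norm_power2)
  \<comment> \<open>Positive and finite measure makes (1 - e) times the measure strictly smaller
    than the limit, so some member of the sequence exceeds it.\<close>
  have "open W" "0 \<in> W" using open_orbit_preimage[OF V(1)] V(2) by (simp_all add: W_def act_zero)
  then have "0 < emeasure \<nu> W" by (intro emeasure_open_pos) auto
  then have pos: "0 < measure \<nu> W" using W_fin by (simp add: measure_def enn2real_positive_iff)
  then have "(1 - e) * measure \<nu> W < measure \<nu> W" using e by simp
  from order_tendstoD(1)[OF lim this] obtain n where n: "(1 - e) * measure \<nu> W < (L2_norm \<nu> (orbit_fun (fn n)))\<^sup>2"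
    by (auto simp: eventually_sequentially)
  show ?thesis
  proof (rule that[of C "fn n" g])
    show "compact C" by (rule C)
    show "c0_apply (fn n) y = 0" if "y \<notin> V" for y using fh(4)[of y n] that by (simp add: fh(1))
    show "cmod (c0_apply (fn n) y) \<le> 1" for y using fh(2,3)[of n y] by (simp add: fh(1))
    show "row_norm C g y \<le> ennreal (1 + e)" if "c0_apply (fn n) y \<noteq> 0" for y
    proof -
      have "y \<in> Y" using that fh(4)[of y n] by (auto simp: fh(1))
      then show ?thesis by (simp add: Y_def less_imp_le)
    qed
    have supp: "s - v \<in> C" if "orbit_fun (fn n) s \<noteq> 0" "orbit_fun g v \<noteq> 0" for s v
      using that fW[of s n] gK'[of v] K(2) by (force simp: C_def)
    have "ind_op (cut_kernel C (fn n) g) u = (\<lambda>s. L2_fun_inner \<nu> u (orbit_fun g) * orbit_fun (fn n) s)"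
      by (rule ext, rule ind_op_cut_kernel_orbit[OF C L2_fun_measurable[OF u(1)] supp])
    then have "(L2_norm \<nu> (ind_op (cut_kernel C (fn n) g) u))\<^sup>2 =
        (cmod (L2_fun_inner \<nu> u (orbit_fun g)))\<^sup>2 * (L2_norm \<nu> (orbit_fun (fn n)))\<^sup>2"
      by (simp add: L2_norm_scale power_mult_distrib)
    also have "\<dots> \<ge> (1 - e)\<^sup>2 * ((1 - e) * measure \<nu> W)"
      using e pos n gu by (intro mult_mono power_mono) auto
    finally show "(1 - e) ^ 3 * measure \<nu> {s. act s x \<in> V} \<le> (L2_norm \<nu> (ind_op (cut_kernel C (fn n) g) u))\<^sup>2"
      by (simp add: W_def power3_eq_cube power2_eq_square mult_ac)
  qed
qed

lemma L2_inner_class: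
  assumes "\<xi> \<in> L2_fun \<nu>" "\<zeta> \<in> L2_fun \<nu>"
  shows "L2_inner \<nu> (L2_class \<nu> \<xi>) (L2_class \<nu> \<zeta>) = L2_fun_inner \<nu> \<xi> \<zeta>"
  using assms L2_classI[OF assms(1)] L2_classI[OF assms(2)] by (intro L2_inner_eq) auto

text \<open>Each vector of S contributes at least q to a sum bounded by r * m through the
  Hilbert-Schmidt estimate. The row condition speaks of points of X only, so a kernel built at
  another base point may be inserted.\<close>

lemma card_Vec_le:
  assumes C: "compact C" and f: "\<And>y. y \<notin> V \<Longrightarrow> c0_apply f y = 0" "\<And>y. cmod (c0_apply f y) \<le> 1"
    and row: "\<And>y. c0_apply f y \<noteq> 0 \<Longrightarrow> row_norm C g y \<le> ennreal r" and r: "0 \<le> r"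
    and V: "open V" "emeasure \<nu> {s. act s x \<in> V} \<le> ennreal m" "0 \<le> m"
    and S: "finite S" "S \<subseteq> rep_space (Ind act \<nu> \<Delta> x)" "orthonormal (Ind act \<nu> \<Delta> x) S"
    and b: "\<And>u. u \<in> S \<Longrightarrow> q \<le> Re (vector_functional (Ind act \<nu> \<Delta> x) u
        (env_class L1 (\<lambda>n. conv (invol (cut_kernel C f g)) (cut_kernel C f g))))"
  shows "real (card S) * q \<le> r * m"
proof -
  let ?c = "cut_kernel C f g"
  have c: "integrable \<mu> ?c" by (rule cut_kernel_integrable[OF C])
  have "\<exists>\<xi>. \<xi> \<in> L2_fun \<nu> \<and> u = L2_class \<nu> \<xi>" if "u \<in> S" for u
    using S(2) that by (auto simp: Ind_def L2_space_def)
  then obtain \<xi> where \<xi>: "\<And>u. u \<in> S \<Longrightarrow> \<xi> u \<in> L2_fun \<nu>" "\<And>u. u \<in> S \<Longrightarrow> u = L2_class \<nu> (\<xi> u)"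
    by metis
  have orth: "L2_fun_inner \<nu> (\<xi> u) (\<xi> v) = (if u = v then 1 else 0)" if "u \<in> S" "v \<in> S" for u v
  proof -
    have "L2_inner \<nu> u v = (if u = v then 1 else 0)"
      using S(3) that by (simp add: orthonormal_def Ind_def)
    then show ?thesis using L2_inner_class[OF \<xi>(1)[OF that(1)] \<xi>(1)[OF that(2)]] \<xi>(2) that by metis
  qed
  have q: "q \<le> (L2_norm \<nu> (ind_op ?c (\<xi> u)))\<^sup>2" if "u \<in> S" for u
    using b[OF that] vector_functional_Ind_square[OF c \<xi>(1)[OF that]] \<xi>(2)[OF that] by (metis Re_complex_of_real)
  have "ennreal (\<Sum>u\<in>S. (L2_norm \<nu> (ind_op ?c (\<xi> u)))\<^sup>2) = (\<Sum>u\<in>S. ennreal ((L2_norm \<nu> (ind_op ?c (\<xi> u)))\<^sup>2))"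
    by (rule sum_ennreal[symmetric]) simp
  also have "\<dots> \<le> ennreal r * (\<integral>\<^sup>+s. ennreal ((cmod (c0_apply f (act s x)))\<^sup>2) \<partial>\<nu>)"
    by (rule sum_ind_op_cut_kernel_le[OF C S(1) \<xi>(1) orth]) (use row in \<open>auto simp: row_norm_def\<close>)
  also have "(\<integral>\<^sup>+s. ennreal ((cmod (c0_apply f (act s x)))\<^sup>2) \<partial>\<nu>) \<le> (\<integral>\<^sup>+s. indicator {s. act s x \<in> V} s \<partial>\<nu>)"
    by (intro nn_integral_mono) (auto simp: indicator_def f power_le_one intro!: ennreal_leI)
  also have "\<dots> = emeasure \<nu> {s. act s x \<in> V}"
    using open_orbit_preimage[OF V(1)] by (intro nn_integral_indicator) simp
  also have "\<dots> \<le> ennreal m" by (rule V(2))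
  also have "ennreal r * ennreal m = ennreal (r * m)" using r V(3) by (simp add: ennreal_mult)
  finally have "(\<Sum>u\<in>S. (L2_norm \<nu> (ind_op ?c (\<xi> u)))\<^sup>2) \<le> r * m"
    using r V(3) by (simp add: ennreal_le_iff mult_left_mono)
  moreover have "real (card S) * q \<le> (\<Sum>u\<in>S. (L2_norm \<nu> (ind_op ?c (\<xi> u)))\<^sup>2)"
    using sum_mono[of S "\<lambda>_. q"] q by simp
  ultimately show ?thesis by simp
qed

end

section \<open>The bound for the lower multiplicity\<close>

lemma Liminf_le_if_frequently:
  fixes f :: "'i \<Rightarrow> 'a::{complete_linorder}"
  assumes "\<exists>\<^sub>F i in F. f i \<le> c"
  shows "Liminf F f \<le> c"
proof (rule ccontr)
  assume "\<not> ?thesis"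
  then have "\<forall>\<^sub>F i in F. c < f i" by (intro less_LiminfD) simp
  then show False using assms by (simp add: frequently_def not_le)
qed

theorem theorem3p5:
  fixes act :: "'g::{topological_group_add,t2_space,second_countable_topology} \<Rightarrow>
      'x::{t2_space,second_countable_topology} \<Rightarrow> 'x"
    and \<nu> :: "'g measure"
    and \<Delta> :: "'g \<Rightarrow> real"
    and M :: real
    and z :: 'x
    and x :: "nat \<Rightarrow> 'x"
    and \<phi> :: "(nat \<Rightarrow> 'g \<Rightarrow> 'x c0) set \<Rightarrow> complex"
  assumes "transformation_group act"
    and "free_action act"
    and "right_haar_measure \<nu>"
    and "modular_function (left_haar \<nu>) \<Delta>"
    and "M \<ge> 1"
    and "locally_closed (orbit act z)"
    and "\<exists>V. open V \<and> z \<in> V \<and> compact (closure {s. act s z \<in> V}) \<and>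
           (\<exists>\<^sub>F n in sequentially.
              emeasure \<nu> {s. act s (x n) \<in> V} \<le> ennreal M * emeasure \<nu> {s. act s z \<in> V})"
    and "\<phi> \<in> associated_pure_states (crossed_product act (left_haar \<nu>) \<Delta>) (Ind act \<nu> \<Delta> z)"
  shows "lower_multiplicity (crossed_product act (left_haar \<nu>) \<Delta>) \<phi> sequentially
           (\<lambda>n. Ind act \<nu> \<Delta> (x n)) \<le> enat (nat \<lfloor>M\<rfloor>)"
proof -
  have ind: "induced_rep \<nu> \<Delta> act"
    using assms(1,3,4) by unfold_locales (auto simp: transformation_group_def)
  interpret z: induced_rep \<nu> \<Delta> act z by (rule ind)
  let ?A = "crossed_product act (left_haar \<nu>) \<Delta>"
  obtain V where V: "open V" "z \<in> V" "compact (closure {s. act s z \<in> V})"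
    and freq: "\<exists>\<^sub>F n in sequentially.
      emeasure \<nu> {s. act s (x n) \<in> V} \<le> ennreal M * emeasure \<nu> {s. act s z \<in> V}"
    using assms(7) by blast
  define m where "m = measure \<nu> {s. act s z \<in> V}"
  have m_eq: "emeasure \<nu> {s. act s z \<in> V} = ennreal m"
    using z.orbit_preimage_finite[OF V(3)] by (simp add: m_def emeasure_eq_ennreal_measure less_top[symmetric])
  \<comment> \<open>Positivity of m is used twice: for the radius e * m of the weak* neighbourhood
    and for cancelling m in the final count.\<close>
  have "0 \<in> {s. act s z \<in> V}" using V(2) by (simp add: z.act_zero)
  then have "0 < emeasure \<nu> {s. act s z \<in> V}"
    using z.open_orbit_preimage[OF V(1)] by (intro z.emeasure_open_pos) blast+
  then have m: "0 < m" by (simp add: m_eq)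
  obtain w where w: "w \<in> L2_space \<nu>" "L2_inner \<nu> w w = 1"
    and \<phi>: "\<And>a. a \<in> elts ?A \<Longrightarrow> \<phi> a = vector_functional (Ind act \<nu> \<Delta> z) w a"
    using assms(8) by (auto simp: associated_pure_states_def Ind_def)
  then obtain u where u: "u \<in> L2_fun \<nu>" "w = L2_class \<nu> u" by (auto simp: L2_space_def)
  have u1: "L2_norm \<nu> u = 1"
  proof -
    have "complex_of_real ((L2_norm \<nu> u)\<^sup>2) = 1"
      using w(2) unfolding u(2) z.L2_inner_class[OF u(1) u(1)] L2_fun_inner_self .
    then have "(L2_norm \<nu> u)\<^sup>2 = 1" by (simp only: of_real_eq_1_iff)
    then show ?thesis using L2_norm_nonneg[of \<nu> u] by (simp add: power2_eq_1_iff)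
  qed
  \<comment> \<open>The first cardinality to be excluded: a natural number below k is at most the
    floor of M.\<close>
  define k where "k = real (nat \<lfloor>M\<rfloor>) + 1"
  have k: "M < k" using assms(5) by (simp add: k_def)
  \<comment> \<open>Chosen so that e * (4 * k + M) is half of k - M and thus smaller than k - M,
    which rearranges to (1 + e) * M < k * (1 - 4 * e). Bernoulli's inequality then gives 1 - 4 * e
    \<le> (1 - e) ^ 3 - e.\<close>
  define e where "e = (k - M) / (2 * (4 * k + M))"
  have e: "0 < e" "e < 1 / 4" using k assms(5) by (auto simp: e_def field_simps)
  then have e1: "e < 1" by simp
  have e_bound: "(1 + e) * M < k * ((1 - e) ^ 3 - e)"
  proof -
    have "4 * k + M \<noteq> 0" using k assms(5) by simp
    then have "e * (4 * k + M) = (k - M) / 2"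
      unfolding e_def times_divide_eq_left by (rule nonzero_mult_divide_mult_cancel_right)
    then have "(1 + e) * M < k * (1 - 4 * e)" using k by (simp add: algebra_simps)
    also have "\<dots> \<le> k * ((1 - e) ^ 3 - e)"
    proof -
      have "1 - 3 * e \<le> (1 - e) ^ 3"
        using e Bernoulli_inequality[of "- e" 3] by simp
      then show ?thesis using k assms(5) by (intro mult_left_mono) auto
    qed
    finally show ?thesis .
  qed
  obtain C f g where C: "compact C" and f: "\<And>y. y \<notin> V \<Longrightarrow> c0_apply f y = 0" "\<And>y. cmod (c0_apply f y) \<le> 1"
    and row: "\<And>y. c0_apply f y \<noteq> 0 \<Longrightarrow> z.row_norm C g y \<le> ennreal (1 + e)"
    and low: "(1 - e) ^ 3 * m \<le> (L2_norm \<nu> (z.ind_op (z.cut_kernel C f g) u))\<^sup>2"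
    using z.cut_kernel_exists[OF assms(2) V u(1) u1 e(1) e1] unfolding m_def by metis
  let ?c = "z.cut_kernel C f g"
  let ?b = "z.conv (z.invol ?c) ?c"
  let ?a = "env_class z.L1 (\<lambda>n. ?b)"
  have c: "integrable z.\<mu> ?c" by (rule z.cut_kernel_integrable[OF C])
  have b: "integrable z.\<mu> ?b" by (rule z.conv_integrable[OF z.invol_integrable[OF c] c])
  have a: "?a \<in> elts ?A"
    using z.const_in_env_class(1)[OF b] by (simp add: crossed_product_def enveloping_algebra_def)
  have \<phi>a: "\<phi> ?a = of_real ((L2_norm \<nu> (z.ind_op ?c u))\<^sup>2)"
    unfolding \<phi>[OF a] u(2) by (rule z.vector_functional_Ind_square[OF c u(1)])
  \<comment> \<open>The tolerance is measured in units of m: the state of \<phi> at the test element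
    is at least (1 - e) ^ 3 * m, so nearby states are at least ((1 - e) ^ 3 - e) * m.\<close>
  define N where "N = {\<psi> \<in> dual ?A. \<forall>a\<in>{?a}. cmod (\<psi> a) < e * m}"
  have N: "N \<in> zero_nhd_base ?A"
    unfolding zero_nhd_base_def N_def mem_Collect_eq
    by (rule exI[of _ "{?a}"], rule exI[of _ "e * m"]) (simp add: a e(1) m)
  have "vec_dim (Ind act \<nu> \<Delta> (x n)) \<phi> N \<le> enat (nat \<lfloor>M\<rfloor>)"
    if n: "emeasure \<nu> {s. act s (x n) \<in> V} \<le> ennreal M * emeasure \<nu> {s. act s z \<in> V}" for n
    unfolding vec_dim_def
  proof (rule SUP_least)
    fix S assume "S \<in> {S. finite S \<and> S \<subseteq> Vec (Ind act \<nu> \<Delta> (x n)) \<phi> N \<and> orthonormal (Ind act \<nu> \<Delta> (x n)) S}"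
    then have S: "finite S" "S \<subseteq> Vec (Ind act \<nu> \<Delta> (x n)) \<phi> N" "orthonormal (Ind act \<nu> \<Delta> (x n)) S" by auto
    \<comment> \<open>The kernel built at z is now read at \<open>x n\<close>. The facts
      \<open>f\<close> and \<open>row\<close> carry over because they concern points of X and not a
      base point.\<close>
    interpret xn: induced_rep \<nu> \<Delta> act "x n" by (rule ind)
    have "real (card S) * (((1 - e) ^ 3 - e) * m) \<le> (1 + e) * (M * m)"
    proof (rule xn.card_Vec_le[OF C f row _ V(1) _ _ S(1) _ S(3)])
      show "S \<subseteq> rep_space (Ind act \<nu> \<Delta> (x n))" using S(2) by (auto simp: Vec_def)
      show "emeasure \<nu> {s. act s (x n) \<in> V} \<le> ennreal (M * m)"
        using n assms(5) m by (simp add: m_eq ennreal_mult)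
      show "0 \<le> M * m" "0 \<le> 1 + e" using assms(5) m e by auto
      fix v assume "v \<in> S"
      then have "cmod (vector_functional (Ind act \<nu> \<Delta> (x n)) v ?a - \<phi> ?a) < e * m"
        using S(2) by (auto simp: Vec_def N_def)
      then have "\<bar>Re (vector_functional (Ind act \<nu> \<Delta> (x n)) v ?a) - Re (\<phi> ?a)\<bar> < e * m"
        using abs_Re_le_cmod[of "vector_functional (Ind act \<nu> \<Delta> (x n)) v ?a - \<phi> ?a"] by simp
      moreover have "(1 - e) ^ 3 * m \<le> Re (\<phi> ?a)" unfolding \<phi>a using low by simp
      ultimately show "((1 - e) ^ 3 - e) * m \<le> Re (vector_functional (Ind act \<nu> \<Delta> (x n)) v ?a)"
        unfolding left_diff_distrib by linarith
    qed
    then have "real (card S) * ((1 - e) ^ 3 - e) \<le> (1 + e) * M"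
      using m by (simp add: mult.assoc[symmetric])
    then have "real (card S) * ((1 - e) ^ 3 - e) < k * ((1 - e) ^ 3 - e)" using e_bound by simp
    \<comment> \<open>Its product with the positive k exceeds (1 + e) * M, which is nonnegative;
      hence it may be cancelled from the strict inequality.\<close>
    moreover have "0 < (1 - e) ^ 3 - e"
    proof -
      have "0 < k * ((1 - e) ^ 3 - e)"
        using e_bound e assms(5) by (intro le_less_trans[OF _ e_bound]) simp
      then show ?thesis using k assms(5) by (simp add: zero_less_mult_iff)
    qed
    ultimately have "real (card S) < k" by simp
    then show "enat (card S) \<le> enat (nat \<lfloor>M\<rfloor>)" by (simp add: k_def)
  qed
  then have "\<exists>\<^sub>F n in sequentially. vec_dim (Ind act \<nu> \<Delta> (x n)) \<phi> N \<le> enat (nat \<lfloor>M\<rfloor>)"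
    using freq by (rule frequently_elim1[rotated])
  then have "Liminf sequentially (\<lambda>n. vec_dim (Ind act \<nu> \<Delta> (x n)) \<phi> N) \<le> enat (nat \<lfloor>M\<rfloor>)"
    by (rule Liminf_le_if_frequently)
  then show ?thesis
    unfolding lower_multiplicity_def using N by (rule INF_lower2[rotated])
qed

end
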